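(* Let $V_\infty$ be a neighborhood of infinity in a real Hilbert space $H$ and $\mathcal L:V_\infty\to\mathbb R$ a $C^1$-functional. Suppose $A:=\nabla\mathcal L:V_\infty\to H$ is continuously directional differentiable and there is a map $B:V_\infty\cup\{\infty\}\to L_s(H)$ into the bounded self-adjoint operators such that $(D\nabla\mathcal L(x)(u),v)_H=(B(x)u,v)_H$ for all $x\in V_\infty$, $u,v\in H$. Suppose: (b) $0\in\sigma(B(\infty))$ and $B(\infty)=P(\infty)+Q(\infty)$, where $P(\infty)\in L_s(H)$ is positive definite and $Q(\infty)\in L_s(H)$ is compact; (c) for every sequence $\{x_n\}\subset V_\infty$ with $\|x_n\|\to\infty$ there exist $C_0>0$ and $n_0>0$ with $([B(x_n)-Q(\infty)]u,u)_H\ge C_0\|u\|^2$ for all $u\in H$, $n\ge n_0$; (d) $H^0_\infty:=\mathrm{Ker}(B(\infty))\ne\{\theta\}$ and, with $H^\pm_\infty:=(H^0_\infty)^\perp$, $P^0_\infty$ the orthogonal projection onto $H^0_\infty$, $C_1^\infty=\|(B(\infty)|_{H^\pm_\infty})^{-1}\|_{L(H^\pm_\infty)}$ and $M(A):=\lim_{R\to\infty}\sup\{\|(I-P^0_\infty)A(z)\|: z\in H^0_\infty,\|z\|\ge R\}$, there exist $R_1>0$, $\kappa>1$ and $\rho_A$ such that $$\|(I-P^0_\infty)[B(z+y)-B(\infty)]|_{H^\pm_\infty}\|_{L(H^\pm_\infty)}\le\frac1{\kappa C_1^\infty}$$ for all $y\in B_{H^\pm_\infty}(\theta,\rho_A)$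 and $z\in\bar B_{H^0_\infty}(\infty,R_1)$, where either $M(A)<\infty$ and $\rho_A\in(\frac{\kappa}{\kappa-1}C_1^\infty M(A),\infty)$, or $\rho_A=\infty$ (i.e. the inequality holds for all $y\in H^\pm_\infty$), in which case $M(A)<\infty$ is not needed. For $R,\delta\in(0,\infty]$ put $C_{R,\delta}=B_{H^0_\infty}(\infty,R)\oplus B_{H^+_\infty}(\theta,\delta)\oplus B_{H^-_\infty}(\theta,\delta)$. Then for every $r\in(0,\infty)$ there exist $R\ge R_1$, $\delta_r>0$, a continuous map $h^\infty:B_{H^0_\infty}(\infty,R)\to\bar B_{H^\pm_\infty}(\theta,\rho_A)$, which is the unique map into this set satisfying $(I-P^0_\infty)\nabla\mathcal L(z+h^\infty(z))=0$ for all $z\in B_{H^0_\infty}(\infty,R)$, an open set $V(R,r)$ in $H$ with $V(R,r)\subset\overline{C_{R,r+\rho_A}}$, and a homeomorphism $\Phi:C_{R,\delta_r}\to V(R,r)$ such that $$\mathcal L\circ\Phi(z+u^++u^-)=\|u^+\|^2-\|u^-\|^2+\mathcal L(z+h^\infty(z))$$ for all $z+u^++u^-\in C_{R,\delta_r}$. Moreover, if $\mathcal L$ is $C^2$ then $h^\infty$ is $C^1$ and the function $z\mapsto\mathcal L(z+h^\infty(z))$ on $B_{H^0_\infty}(\infty,R)$ is $C^2$.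
   Context: $\theta$ is the zero vector. For a normed space $E$: $B_E(\infty,R)=\{\|x\|>R\}$, $\bar B_E(\infty,R)=\{\|x\|\ge R\}$, and $B_E(\theta,r)$, $\bar B_E(\theta,r)$ are open and closed balls (the whole space if $r=\infty$). A neighborhood of infinity in $H$ is an (open) set containing some $B_H(\infty,R)$. A map $f$ is continuously directional differentiable if $Df(x)(u)=\lim_{t\to0}(f(x+tu)-f(x))/t$ exists for all $x,u$ and $x\mapsto Df(x)(u)$ is continuous for each $u$. $H^+_\infty$ and $H^-_\infty$ are the positive and negative definite (spectral) subspaces of $B(\infty)$, so $H^\pm_\infty=H^+_\infty\oplus H^-_\infty$. Under (b), $0$ is an isolated point of $\sigma(B(\infty))$, and $H^0_\infty$, $H^-_\infty$ are finite dimensional. *)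

theory Defs
  imports "HOL-Analysis.Analysis"
begin

section \<open>Bounded operators on a real Hilbert space\<close>

definition self_adjoint :: "('a::real_inner \<Rightarrow>\<^sub>L 'a) \<Rightarrow> bool" where
  "self_adjoint T \<longleftrightarrow> (\<forall>u v. inner (T u) v = inner u (T v))"

text \<open>Positive definite means bounded below. For a merely strictly positive form, 0 could be an
  accumulation point of the spectrum of a compact perturbation.\<close>
definition positive_definite :: "('a::real_inner \<Rightarrow>\<^sub>L 'a) \<Rightarrow> bool" where
  "positive_definite T \<longleftrightarrow> (\<exists>c>0. \<forall>u. inner (T u) u \<ge> c * (norm u)\<^sup>2)"

definition compact_operator :: "('a::real_normed_vector \<Rightarrow>\<^sub>L 'b::real_normed_vector) \<Rightarrow> bool" where
  "compact_operator T \<longleftrightarrow> (\<forall>S. bounded S \<longrightarrow> compact (closure (T ` S)))"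

text \<open>Only real spectral values; a self-adjoint operator has no others.\<close>
definition real_spectrum :: "('a::real_normed_vector \<Rightarrow>\<^sub>L 'a) \<Rightarrow> real set" where
  "real_spectrum T = {l. \<not> (\<exists>S. S o\<^sub>L (T - l *\<^sub>R id_blinfun) = id_blinfun
                              \<and> (T - l *\<^sub>R id_blinfun) o\<^sub>L S = id_blinfun)}"

definition op_kernel :: "('a::real_normed_vector \<Rightarrow>\<^sub>L 'b::real_normed_vector) \<Rightarrow> 'a set" where
  "op_kernel T = {u. T u = 0}"

text \<open>For self-adjoint \<open>T\<close> the spectral subspaces for \<open>(0,\<infinity>)\<close> and \<open>(-\<infinity>,0)\<close> are
  the largest closed \<open>T\<close>-invariant subspaces on which \<open>T\<close> is positive, respectively negative,
  definite. Here definiteness is the strict inequality for nonzero vectors; if 0 is isolated in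
  the spectrum, the form is then automatically bounded away from 0 on unit vectors.\<close>
definition positive_subspace :: "('a::real_inner \<Rightarrow>\<^sub>L 'a) \<Rightarrow> 'a set" where
  "positive_subspace T =
     \<Union>{S. subspace S \<and> closed S \<and> T ` S \<subseteq> S \<and> (\<forall>u\<in>S. u \<noteq> 0 \<longrightarrow> inner (T u) u > 0)}"

definition negative_subspace :: "('a::real_inner \<Rightarrow>\<^sub>L 'a) \<Rightarrow> 'a set" where
  "negative_subspace T =
     \<Union>{S. subspace S \<and> closed S \<and> T ` S \<subseteq> S \<and> (\<forall>u\<in>S. u \<noteq> 0 \<longrightarrow> inner (T u) u < 0)}"

definition orth_proj :: "'a::real_inner set \<Rightarrow> 'a \<Rightarrow> 'a" where
  "orth_proj S x = (THE y. y \<in> S \<and> (\<forall>s\<in>S. inner (x - y) s = 0))"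

text \<open>The operator norm of \<open>f\<close> restricted to the subspace \<open>S\<close>; compare \<^const>\<open>onorm\<close>.\<close>
definition onorm_on :: "'a::real_normed_vector set \<Rightarrow> ('a \<Rightarrow> 'b::real_normed_vector) \<Rightarrow> real" where
  "onorm_on S f = (SUP x\<in>S. norm (f x) / norm x)"

section \<open>Differentiability\<close>

definition cont_dir_differentiable_on ::
    "'a::real_normed_vector set \<Rightarrow> ('a \<Rightarrow> 'b::real_normed_vector) \<Rightarrow> ('a \<Rightarrow> 'a \<Rightarrow> 'b) \<Rightarrow> bool" where
  "cont_dir_differentiable_on S f Df \<longleftrightarrow>
     (\<forall>x\<in>S. \<forall>u. ((\<lambda>t::real. (f (x + t *\<^sub>R u) - f x) /\<^sub>R t) \<longlongrightarrow> Df x u) (at 0)) \<and>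
     (\<forall>u. continuous_on S (\<lambda>x. Df x u))"

text \<open>These are used for \<open>S\<close> relatively open in a closed subspace \<open>E\<close>. The derivative within
  \<open>S\<close> is determined only on \<open>E\<close>; an operator-norm continuous derivative with values in the
  bounded operators on \<open>E\<close> extends to the whole space by composing with the orthogonal
  projection onto \<open>E\<close>, so asking for derivatives defined on the whole space loses nothing.\<close>
definition C1_on :: "'a::real_normed_vector set \<Rightarrow> ('a \<Rightarrow> 'b::real_normed_vector) \<Rightarrow> bool" where
  "C1_on S f \<longleftrightarrow> (\<exists>f' :: 'a \<Rightarrow> 'a \<Rightarrow>\<^sub>L 'b.
     (\<forall>x\<in>S. (f has_derivative blinfun_apply (f' x)) (at x within S)) \<and> continuous_on S f')"

definition C2_on :: "'a::real_normed_vector set \<Rightarrow> ('a \<Rightarrow> 'b::real_normed_vector) \<Rightarrow> bool" where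
  "C2_on S f \<longleftrightarrow> (\<exists>f' :: 'a \<Rightarrow> 'a \<Rightarrow>\<^sub>L 'b.
     (\<forall>x\<in>S. (f has_derivative blinfun_apply (f' x)) (at x within S)) \<and> C1_on S f')"

section \<open>Neighbourhoods of infinity\<close>

definition ball_inf :: "'a::real_normed_vector set \<Rightarrow> real \<Rightarrow> 'a set" where
  "ball_inf E R = {x\<in>E. norm x > R}"

definition cball_inf :: "'a::real_normed_vector set \<Rightarrow> real \<Rightarrow> 'a set" where
  "cball_inf E R = {x\<in>E. norm x \<ge> R}"

definition ball_in :: "'a::real_normed_vector set \<Rightarrow> ereal \<Rightarrow> 'a set" where
  "ball_in E r = {x\<in>E. ereal (norm x) < r}"

definition cball_in :: "'a::real_normed_vector set \<Rightarrow> ereal \<Rightarrow> 'a set" where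
  "cball_in E r = {x\<in>E. ereal (norm x) \<le> r}"

definition C_set :: "'a::real_normed_vector set \<Rightarrow> 'a set \<Rightarrow> 'a set \<Rightarrow> real \<Rightarrow> ereal \<Rightarrow> 'a set" where
  "C_set H0 Hp Hm R d =
     {z + u + v | z u v. z \<in> ball_inf H0 R \<and> u \<in> ball_in Hp d \<and> v \<in> ball_in Hm d}"

text \<open>The limit exists in the extended reals, the supremum being antitone in \<open>R\<close>. It does not
  depend on the values of \<open>A\<close> off a neighbourhood of infinity.\<close>
definition M_inf :: "'a::real_inner set \<Rightarrow> ('a \<Rightarrow> 'a) \<Rightarrow> ereal" where
  "M_inf H0 A = Lim at_top (\<lambda>R::real. SUP z\<in>cball_inf H0 R. ereal (norm (A z - orth_proj H0 (A z))))"

end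

theory Submission
  imports Defs
begin

text \<open>
  Off the kernel \<open>H0\<close> of \<open>Binf\<close> the gradient \<open>A\<close> is a small perturbation of the linear isomorphism
  \<open>Binf\<close>: on each slice \<open>z + Hpm\<close> with \<open>z\<close> far out in \<open>H0\<close>, the mean value theorem turns the bound on
  \<open>B - Binf\<close> into the estimate that \<open>(1 - P0) A - Binf\<close> is Lipschitz with a constant \<open>\<theta> a\<close>, where
  \<open>a = 1 / C1\<close> is the lower bound of \<open>Binf\<close> on a nontrivial \<open>Hpm\<close> and \<open>\<theta> = 1 / \<kappa> < 1\<close>. Almost everything is drawn
  from this one estimate.

  The contraction principle (\<open>perturbed_zero_exists\<close>) gives the zero \<open>h z\<close> of \<open>(1 - P0) A\<close> on the
  slice. On the positive and negative spectral subspaces the quadratic form of \<open>Binf\<close> is bounded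
  below by \<open>a\<close> and above by \<open>- a\<close>, so \<open>L\<close> restricted to a slice is uniformly convex in the positive and
  uniformly concave in the negative directions, with the same constants on all slices. The normal
  form is therefore a Morse lemma with \<open>z\<close> as a parameter (\<open>parametrized_morse_lemma\<close>). It uses first
  derivatives only: for each \<open>u\<close> in the positive subspace let the ridge point be the maximum of \<open>L\<close>
  over the negative directions. The values of \<open>L\<close> on the ridge grow quadratically along rays in \<open>u\<close>,
  and off the ridge \<open>L\<close> falls quadratically along rays in the negative subspace; rescaling these rays
  by the square roots of the increments (\<open>radial_rescaling\<close>) produces the squared norms. The
  constants being uniform in \<open>z\<close>, one radius \<open>\<delta>\<close> serves all of them.

  If \<open>L\<close> is twice continuously differentiable, \<open>B\<close> is the operator-norm continuous derivative of
  \<open>A\<close>. The same monotonicity shows that the linearized equation is uniquely solvable, and its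
  solution operator is the derivative of \<open>h\<close>; since \<open>A (z + h z)\<close> lies in \<open>H0\<close>, that vector is also
  the gradient of the reduced function.

  The spectral subspaces are obtained from an operator \<open>R\<close> with \<open>R\<^sup>2 = Binf\<^sup>2\<close> that commutes with
  \<open>Binf\<close> and is positive: \<open>Binf = R\<close> and \<open>Binf = - R\<close> characterize the positive and the negative
  subspace (\<open>spectral_splitting\<close>). That \<open>Binf\<close> is bounded below on \<open>Hpm\<close> is where the decomposition
  into a positive definite and a compact part enters (\<open>compact_perturbation_bounded_below\<close>).
\<close>

section \<open>Closed subspaces of a Hilbert space\<close>

lemma cancel_norm:
  assumes "c * (norm x)\<^sup>2 \<le> M * norm x" "0 \<le> M"
  shows "c * norm x \<le> M"
  using assms by (cases "x = 0") (simp_all add: power2_eq_square)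

lemma Cauchy_if_dist_le:
  assumes f: "Cauchy f" and c: "c > 0" and le: "\<And>m n. c * dist (g m) (g n) \<le> dist (f m) (f n)"
  shows "Cauchy g"
proof (rule metric_CauchyI)
  fix e :: real assume "e > 0"
  then have "c * e > 0" using c by simp
  then obtain M where M: "\<And>m n. m \<ge> M \<Longrightarrow> n \<ge> M \<Longrightarrow> dist (f m) (f n) < c * e"
    using metric_CauchyD[OF f] by meson
  have "dist (g m) (g n) < e" if "m \<ge> M" "n \<ge> M" for m n
    using le_less_trans[OF le M[OF that]] c by simp
  then show "\<exists>M. \<forall>m\<ge>M. \<forall>n\<ge>M. dist (g m) (g n) < e" by blast
qed

lemma continuous_on_if_dist_le:
  fixes f :: "'a::metric_space \<Rightarrow> 'b::metric_space" and g :: "'a \<Rightarrow> 'c::metric_space"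
  assumes f: "continuous_on S f" and le: "\<And>x y. x \<in> S \<Longrightarrow> y \<in> S \<Longrightarrow> dist (g y) (g x) \<le> dist (f y) (f x)"
  shows "continuous_on S g"
  unfolding continuous_on_iff
proof (intro ballI allI impI)
  fix x and e :: real assume x: "x \<in> S" and "e > 0"
  then obtain d where "d > 0" "\<And>y. y \<in> S \<Longrightarrow> dist y x < d \<Longrightarrow> dist (f y) (f x) < e"
    using f unfolding continuous_on_iff by blast
  then show "\<exists>d>0. \<forall>y\<in>S. dist y x < d \<longrightarrow> dist (g y) (g x) < e"
    using le[OF x] by (intro exI[of _ d]) (auto intro: le_less_trans)
qed

lemma tendsto_if_norm_le:
  fixes f :: "'a::topological_space \<Rightarrow> 'b::real_normed_vector"
  assumes le: "\<And>y. y \<in> S \<Longrightarrow> c * norm (f y - l) \<le> norm (g y)" and c: "c > 0"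
    and g: "(g \<longlongrightarrow> 0) (at x within S)"
  shows "(f \<longlongrightarrow> l) (at x within S)"
proof -
  have "\<forall>\<^sub>F y in at x within S. norm (f y - l) \<le> norm (g y) / c"
    using le c by (auto simp: eventually_at_filter pos_le_divide_eq mult.commute)
  moreover have "((\<lambda>y. norm (g y) / c) \<longlongrightarrow> 0) (at x within S)"
    using tendsto_divide[OF tendsto_norm[OF g] tendsto_const, of c] c by simp
  ultimately show ?thesis by (rule LIM_zero_cancel[OF Lim_null_comparison])
qed

text \<open>A minimizing sequence is Cauchy.\<close>
lemma nearest_point_exists:
  fixes S :: "'a::{real_inner, complete_space} set"
  assumes "subspace S" "closed S"
  shows "\<exists>y\<in>S. \<forall>s\<in>S. norm (x - y) \<le> norm (x - s)"
proof -
  have ne: "S \<noteq> {}" using assms subspace_0 by blast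
  define d where "d = (INF s\<in>S. (norm (x - s))\<^sup>2)"
  have bdd: "bdd_below ((\<lambda>s. (norm (x - s))\<^sup>2) ` S)"
    by (intro bdd_belowI[of _ 0]) auto
  have d_le: "d \<le> (norm (x - s))\<^sup>2" if "s \<in> S" for s
    unfolding d_def by (rule cINF_lower[OF bdd that])
  have "\<exists>y\<in>S. (norm (x - y))\<^sup>2 < d + 1 / real (Suc n)" for n
  proof -
    have "d < d + 1 / real (Suc n)" by simp
    then show ?thesis unfolding d_def using cINF_less_iff[OF ne bdd] by blast
  qed
  then obtain y where y: "\<And>n. y n \<in> S" "\<And>n. (norm (x - y n))\<^sup>2 < d + 1 / real (Suc n)"
    by metis
  \<comment> \<open>By the parallelogram law, almost minimal points are close to each other, the midpoint being
    no better than the infimum.\<close>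
  have par: "(norm (y m - y n))\<^sup>2 \<le> 2 / real (Suc m) + 2 / real (Suc n)" for m n
  proof -
    have "(1/2) *\<^sub>R (y m + y n) \<in> S"
      using y(1) assms(1) by (simp add: subspace_add subspace_scale)
    from d_le[OF this] have "4 * d \<le> 4 * (norm (x - (1/2) *\<^sub>R (y m + y n)))\<^sup>2" by simp
    also have "\<dots> = 2 * (norm (x - y m))\<^sup>2 + 2 * (norm (x - y n))\<^sup>2 - (norm (y m - y n))\<^sup>2"
      by (simp add: power2_norm_eq_inner inner_diff_left inner_diff_right inner_add_left
          inner_add_right inner_commute algebra_simps)
    finally have "4 * d \<le> \<dots>" .
    moreover have "2 / real (Suc k) = 2 * (1 / real (Suc k))" for k by simp
    ultimately show ?thesis using y(2)[of m] y(2)[of n] by smt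
  qed
  have "Cauchy y"
  proof (rule metric_CauchyI)
    fix e :: real assume e: "e > 0"
    obtain N where N: "4 / e\<^sup>2 < real N" using reals_Archimedean2 by blast
    have "dist (y m) (y n) < e" if "m \<ge> N" "n \<ge> N" for m n
    proof -
      have "4 < e\<^sup>2 * real N" using N e by (simp add: field_simps)
      also have "\<dots> \<le> e\<^sup>2 * real (Suc N)" by (intro mult_left_mono) auto
      finally have "4 / real (Suc N) < e\<^sup>2" by (simp add: field_simps)
      moreover have "2 / real (Suc m) \<le> 2 / real (Suc N)" "2 / real (Suc n) \<le> 2 / real (Suc N)"
        using that by (auto intro!: divide_left_mono)
      ultimately have "(norm (y m - y n))\<^sup>2 < e\<^sup>2" using par[of m n] by linarith
      then show ?thesis using e by (simp add: dist_norm power2_less_imp_less)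
    qed
    then show "\<exists>M. \<forall>m\<ge>M. \<forall>n\<ge>M. dist (y m) (y n) < e" by blast
  qed
  then obtain l where l: "y \<longlonglongrightarrow> l" by (meson Cauchy_convergent_iff convergent_def)
  have "l \<in> S" using closed_sequentially[OF assms(2)] y(1) l by blast
  moreover have "(norm (x - l))\<^sup>2 \<le> d"
  proof (rule LIMSEQ_le)
    show "(\<lambda>n. (norm (x - y n))\<^sup>2) \<longlonglongrightarrow> (norm (x - l))\<^sup>2" by (intro tendsto_intros l)
    have "(\<lambda>n. d + 1 / real (Suc n)) \<longlonglongrightarrow> d + 0" by (intro tendsto_intros lim_1_over_n LIMSEQ_Suc)
    then show "(\<lambda>n. d + 1 / real (Suc n)) \<longlonglongrightarrow> d" by simp
  qed (use y(2) less_imp_le in blast)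
  ultimately show ?thesis using d_le by (metis norm_ge_zero order_trans power2_le_imp_le)
qed

lemma orthogonal_decomposition:
  fixes S :: "'a::{real_inner, complete_space} set"
  assumes "subspace S" "closed S"
  shows "\<exists>!y. y \<in> S \<and> (\<forall>s\<in>S. inner (x - y) s = 0)"
proof -
  obtain y where y: "y \<in> S" "\<And>s. s \<in> S \<Longrightarrow> norm (x - y) \<le> norm (x - s)"
    using nearest_point_exists[OF assms] by metis
  have "inner (x - y) s = 0" if s: "s \<in> S" for s
  proof (cases "s = 0")
    case False
    define t where "t = inner (x - y) s / inner s s"
    have "y + t *\<^sub>R s \<in> S" using y(1) s assms(1) by (simp add: subspace_add subspace_scale)
    from y(2)[OF this] have "(norm (x - y))\<^sup>2 \<le> (norm (x - y - t *\<^sub>R s))\<^sup>2"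
      by (simp add: algebra_simps power_mono)
    also have "\<dots> = (norm (x - y))\<^sup>2 - 2 * t * inner (x - y) s + t * t * inner s s"
      unfolding power2_norm_eq_inner by (simp add: inner_diff_left inner_diff_right inner_commute algebra_simps)
    also have "\<dots> = (norm (x - y))\<^sup>2 - (inner (x - y) s)\<^sup>2 / inner s s"
      using False by (simp add: t_def power2_eq_square field_simps)
    finally have "(inner (x - y) s)\<^sup>2 / inner s s \<le> 0" by simp
    moreover have "inner s s > 0" using False by simp
    ultimately have "(inner (x - y) s)\<^sup>2 \<le> 0" by (simp add: divide_le_0_iff)
    then show ?thesis by simp
  qed simp
  then have "y \<in> S \<and> (\<forall>s\<in>S. inner (x - y) s = 0)" using y(1) by blast
  moreover have "y' = y" if y': "y' \<in> S \<and> (\<forall>s\<in>S. inner (x - y') s = 0)" for y'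
  proof -
    have "y' - y \<in> S" using y' y(1) assms(1) subspace_diff by blast
    then have "inner (x - y) (y' - y) = 0" "inner (x - y') (y' - y) = 0"
      using \<open>y \<in> S \<and> _\<close> y' by auto
    then have "inner (y' - y) (y' - y) = 0" by (simp add: inner_diff_left)
    then show ?thesis by simp
  qed
  ultimately show ?thesis by blast
qed

context
  fixes S :: "'a::{real_inner, complete_space} set"
  assumes S: "subspace S" "closed S"
begin

lemma orth_proj_in: "orth_proj S x \<in> S"
  and orth_proj_orthogonal: "s \<in> S \<Longrightarrow> inner (x - orth_proj S x) s = 0"
  using theI'[OF orthogonal_decomposition[OF S, of x]] unfolding orth_proj_def by auto

lemma orth_proj_eqI:
  assumes "y \<in> S" "\<And>s. s \<in> S \<Longrightarrow> inner (x - y) s = 0"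
  shows "orth_proj S x = y"
  using orthogonal_decomposition[OF S, of x] assms orth_proj_in orth_proj_orthogonal by blast

lemma orth_proj_self: "x \<in> S \<Longrightarrow> orth_proj S x = x"
  by (rule orth_proj_eqI) auto

lemma orth_proj_residual: "x - orth_proj S x \<in> orthogonal_comp S"
  using orth_proj_orthogonal by (auto simp: orthogonal_comp_def orthogonal_def inner_commute)

lemma orth_proj_self_adjoint: "inner (orth_proj S x) y = inner x (orth_proj S y)"
proof -
  have "inner (x - orth_proj S x) (orth_proj S y) = 0" "inner (y - orth_proj S y) (orth_proj S x) = 0"
    by (auto intro: orth_proj_orthogonal orth_proj_in)
  then show ?thesis
    by (simp add: inner_diff_left inner_commute[of y] inner_commute[of "orth_proj S y"])
qed

lemma bounded_linear_orth_proj: "bounded_linear (orth_proj S)"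
proof (rule bounded_linear_intro[where K = 1])
  fix x y r
  show "orth_proj S (x + y) = orth_proj S x + orth_proj S y"
  proof (rule orth_proj_eqI)
    fix s assume "s \<in> S"
    then show "inner (x + y - (orth_proj S x + orth_proj S y)) s = 0"
      using orth_proj_orthogonal[of s x] orth_proj_orthogonal[of s y]
      by (simp add: inner_diff_left inner_add_left)
  qed (simp add: S subspace_add orth_proj_in)
  show "orth_proj S (r *\<^sub>R x) = r *\<^sub>R orth_proj S x"
  proof (rule orth_proj_eqI)
    fix s assume "s \<in> S"
    then show "inner (r *\<^sub>R x - r *\<^sub>R orth_proj S x) s = 0"
      using orth_proj_orthogonal[of s x] by (simp add: inner_diff_left)
  qed (simp add: S subspace_scale orth_proj_in)
  have "inner (x - orth_proj S x) (orth_proj S x) = 0"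
    by (intro orth_proj_orthogonal orth_proj_in)
  then have "(norm (orth_proj S x))\<^sup>2 = inner x (orth_proj S x)"
    by (simp add: power2_norm_eq_inner inner_diff_left)
  also have "\<dots> \<le> norm x * norm (orth_proj S x)" by (rule norm_cauchy_schwarz)
  finally show "norm (orth_proj S x) \<le> norm x * 1"
    by (cases "orth_proj S x = 0") (auto simp: power2_eq_square)
qed

end

lemma closed_orthogonal_comp: "closed (orthogonal_comp S)"
proof -
  have "orthogonal_comp S = (\<Inter>s\<in>S. {x. inner s x = 0})"
    by (auto simp: orthogonal_comp_def orthogonal_def)
  moreover have "closed {x. inner s x = 0}" for s :: 'a
    by (intro closed_Collect_eq continuous_intros)
  ultimately show ?thesis by auto
qed

section \<open>Self-adjoint operators\<close>

text \<open>Completeness of the operator norm needs completeness of the range only.\<close>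
lemma Cauchy_blinfun_convergent:
  fixes X :: "nat \<Rightarrow> 'a::real_normed_vector \<Rightarrow>\<^sub>L 'b::{real_normed_vector, complete_space}"
  assumes "Cauchy X"
  shows "\<exists>V. X \<longlonglongrightarrow> V"
proof -
  have "convergent (\<lambda>n. X n x)" for x
    using bounded_linear.Cauchy[OF bounded_linear_apply_blinfun assms] Cauchy_convergent_iff by blast
  then obtain v where v: "\<And>x. (\<lambda>n. X n x) \<longlonglongrightarrow> v x" unfolding convergent_def by metis
  obtain K where K: "\<And>n. norm (X n) \<le> K" using Cauchy_Bseq[OF assms] by (auto simp: Bseq_def)
  have bl: "bounded_linear v"
  proof (rule bounded_linear_intro[where K = K])
    fix x y r
    have "(\<lambda>n. X n x + X n y) \<longlonglongrightarrow> v x + v y" "(\<lambda>n. r *\<^sub>R X n x) \<longlonglongrightarrow> r *\<^sub>R v x"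
      by (intro tendsto_intros v)+
    then have "(\<lambda>n. X n (x + y)) \<longlonglongrightarrow> v x + v y" "(\<lambda>n. X n (r *\<^sub>R x)) \<longlonglongrightarrow> r *\<^sub>R v x"
      by (simp_all add: blinfun.bilinear_simps)
    then show "v (x + y) = v x + v y" "v (r *\<^sub>R x) = r *\<^sub>R v x"
      by (blast intro: LIMSEQ_unique v)+
    have "norm (X n x) \<le> norm x * K" for n
      using norm_blinfun[of "X n" x] mult_right_mono[OF K[of n] norm_ge_zero[of x]]
      by (simp add: mult.commute)
    then show "norm (v x) \<le> norm x * K"
      by (intro Lim_bounded[OF tendsto_norm[OF v]]) auto
  qed
  have "X \<longlonglongrightarrow> Blinfun v"
  proof (rule LIMSEQ_I)
    fix e :: real assume e: "e > 0"
    then obtain M where M: "\<And>m n. m \<ge> M \<Longrightarrow> n \<ge> M \<Longrightarrow> norm (X m - X n) < e/2"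
      using CauchyD[OF assms, of "e/2"] by auto
    have "norm (X n - Blinfun v) \<le> e/2" if n: "n \<ge> M" for n
    proof (rule norm_blinfun_bound)
      fix x
      have "norm (X n x - X m x) \<le> e/2 * norm x" if "m \<ge> M" for m
        using norm_blinfun[of "X n - X m" x] mult_right_mono[OF less_imp_le[OF M[OF n that]] norm_ge_zero[of x]]
        by (simp add: blinfun.bilinear_simps)
      moreover have "(\<lambda>m. norm (X n x - X m x)) \<longlonglongrightarrow> norm (X n x - v x)" by (intro tendsto_intros v)
      ultimately have "norm (X n x - v x) \<le> e/2 * norm x" by (meson Lim_bounded)
      then show "norm ((X n - Blinfun v) x) \<le> e/2 * norm x"
        by (simp add: blinfun.bilinear_simps bounded_linear_Blinfun_apply[OF bl])
    qed (use e in simp)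
    then show "\<exists>M. \<forall>n\<ge>M. norm (X n - Blinfun v) < e" using e by (intro exI[of _ M]) fastforce
  qed
  then show ?thesis ..
qed

text \<open>With \<open>X = 1 - T\<^sup>2/N\<^sup>2\<close>, which has norm below 1, the equation \<open>(1 - Y)\<^sup>2 = 1 - X\<close> is the
  fixed point equation \<open>Y = (X + Y\<^sup>2)/2\<close>, a contraction in the operator norm; then
  \<open>R = N (1 - Y)\<close>. Running the iteration inside the closed set of operators that are self-adjoint,
  commute with \<open>T\<close> and preserve the closed invariant subspaces of \<open>T\<close> passes these
  properties on to \<open>R\<close>, the absolute value of \<open>T\<close>.\<close>
lemma absolute_value_exists:
  fixes T :: "'a::{real_inner, complete_space} \<Rightarrow>\<^sub>L 'a"
  assumes sa: "self_adjoint T" and c: "c > 0" and below: "\<And>x. c * norm x \<le> norm (T x)"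
  obtains R :: "'a \<Rightarrow>\<^sub>L 'a" and r where
    "self_adjoint R" "\<And>x. R (R x) = T (T x)" "\<And>x. R (T x) = T (R x)"
    "r > 0" "\<And>x. inner (R x) x \<ge> r * (norm x)\<^sup>2"
    "\<And>S. subspace S \<Longrightarrow> closed S \<Longrightarrow> T ` S \<subseteq> S \<Longrightarrow> R ` S \<subseteq> S"
proof -
  define N where "N = norm T + c"
  have N: "N > 0" "c \<le> N" "norm T \<le> N" using c by (auto simp: N_def add_nonneg_pos)
  have TN: "norm (T x) \<le> N * norm x" for x
    using norm_blinfun[of T x] mult_right_mono[OF N(3) norm_ge_zero[of x]] by linarith
  define X where "X = id_blinfun - (1 / N\<^sup>2) *\<^sub>R (T o\<^sub>L T)"
  have X: "X x = x - (1 / N\<^sup>2) *\<^sub>R T (T x)" for x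
    by (simp add: X_def blinfun.bilinear_simps)
  define q where "q = sqrt (1 - c\<^sup>2 / N\<^sup>2)"
  have cN: "0 < c\<^sup>2 / N\<^sup>2" "c\<^sup>2 / N\<^sup>2 \<le> 1" using c N by (auto simp: power_mono)
  have q: "0 \<le> q" "q < 1" using cN by (auto simp: q_def)
  have normX: "norm X \<le> q"
  proof (rule norm_blinfun_bound[OF q(1)])
    fix x
    have i: "inner x (T (T x)) = inner (T x) (T x)" "inner (T (T x)) x = inner (T x) (T x)"
      using sa by (auto simp: self_adjoint_def)
    have "(norm (x - m *\<^sub>R T (T x)))\<^sup>2 = (norm x)\<^sup>2 - 2 * m * (norm (T x))\<^sup>2 + m * m * (norm (T (T x)))\<^sup>2"
      for m by (simp add: power2_norm_eq_inner inner_diff_left inner_diff_right i algebra_simps)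
    from this[of "1 / N\<^sup>2"]
    have "(norm (X x))\<^sup>2 = (norm x)\<^sup>2 - 2 * (norm (T x))\<^sup>2 / N\<^sup>2 + (norm (T (T x)))\<^sup>2 / (N\<^sup>2 * N\<^sup>2)"
      by (simp add: X)
    also have "(norm (T (T x)))\<^sup>2 / (N\<^sup>2 * N\<^sup>2) \<le> (N * norm (T x))\<^sup>2 / (N\<^sup>2 * N\<^sup>2)"
      by (intro divide_right_mono power_mono TN) auto
    also have "\<dots> = (norm (T x))\<^sup>2 / N\<^sup>2" using N by (simp add: power2_eq_square)
    finally have "(norm (X x))\<^sup>2 \<le> (norm x)\<^sup>2 - (norm (T x))\<^sup>2 / N\<^sup>2" by simp
    moreover have "(c * norm x)\<^sup>2 / N\<^sup>2 \<le> (norm (T x))\<^sup>2 / N\<^sup>2"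
      using below[of x] c by (intro divide_right_mono power_mono) auto
    ultimately have "(norm (X x))\<^sup>2 \<le> (1 - c\<^sup>2 / N\<^sup>2) * (norm x)\<^sup>2"
      by (simp add: power_mult_distrib algebra_simps)
    also have "\<dots> = (q * norm x)\<^sup>2" using cN by (simp add: q_def power_mult_distrib)
    finally show "norm (X x) \<le> q * norm x"
      using q by (auto intro: power2_le_imp_le)
  qed
  define F where "F = (\<lambda>Y::'a \<Rightarrow>\<^sub>L 'a. (1/2) *\<^sub>R (X + (Y o\<^sub>L Y)))"
  define \<Y> where "\<Y> = {Y. norm Y \<le> q \<and> self_adjoint Y \<and> (\<forall>x. Y (T x) = T (Y x)) \<and>
     (\<forall>S. subspace S \<longrightarrow> closed S \<longrightarrow> T ` S \<subseteq> S \<longrightarrow> Y ` S \<subseteq> S)}"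
  have F_app: "F Y x = (1/2) *\<^sub>R (X x + Y (Y x))" for Y x
    by (simp add: F_def blinfun.bilinear_simps)
  have "complete \<Y>"
  proof (rule completeI)
    fix f :: "nat \<Rightarrow> 'a \<Rightarrow>\<^sub>L 'a" assume f: "\<forall>n. f n \<in> \<Y>" "Cauchy f"
    then obtain Y where Y: "f \<longlonglongrightarrow> Y" using Cauchy_blinfun_convergent by blast
    have pt: "(\<lambda>n. f n x) \<longlonglongrightarrow> Y x" for x by (intro tendsto_intros Y)
    have "norm Y \<le> q"
      by (rule Lim_bounded[OF tendsto_norm[OF Y]]) (use f in \<open>auto simp: \<Y>_def\<close>)
    moreover have "self_adjoint Y" unfolding self_adjoint_def
    proof safe
      fix u v
      have "(\<lambda>n. inner (f n u) v) \<longlonglongrightarrow> inner (Y u) v" "(\<lambda>n. inner u (f n v)) \<longlonglongrightarrow> inner u (Y v)"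
        by (intro tendsto_intros pt)+
      moreover have "inner (f n u) v = inner u (f n v)" for n
        using f by (auto simp: \<Y>_def self_adjoint_def)
      ultimately show "inner (Y u) v = inner u (Y v)" by (simp add: LIMSEQ_unique)
    qed
    moreover have "Y (T x) = T (Y x)" for x
    proof -
      have "(\<lambda>n. f n (T x)) \<longlonglongrightarrow> Y (T x)" "(\<lambda>n. T (f n x)) \<longlonglongrightarrow> T (Y x)"
        by (intro tendsto_intros pt)+
      moreover have "f n (T x) = T (f n x)" for n
        using f by (auto simp: \<Y>_def)
      ultimately show ?thesis by (simp add: LIMSEQ_unique)
    qed
    moreover have "Y ` S \<subseteq> S" if "subspace S" "closed S" "T ` S \<subseteq> S" for S
    proof safe
      fix s assume "s \<in> S"
      moreover have "f n ` S \<subseteq> S" for n using f(1) that unfolding \<Y>_def by blast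
      ultimately have "f n s \<in> S" for n by blast
      then show "Y s \<in> S" by (rule closed_sequentially[OF that(2) _ pt])
    qed
    ultimately have "Y \<in> \<Y>" by (auto simp: \<Y>_def)
    then show "\<exists>l\<in>\<Y>. f \<longlonglongrightarrow> l" using Y by blast
  qed
  moreover have "\<Y> \<noteq> {}"
  proof -
    have "0 \<in> \<Y>" using q subspace_0 by (auto simp: \<Y>_def self_adjoint_def blinfun.bilinear_simps)
    then show ?thesis by blast
  qed
  moreover have "F ` \<Y> \<subseteq> \<Y>"
  proof safe
    fix Y assume Y: "Y \<in> \<Y>"
    then have Yq: "norm Y \<le> q" and Ysa: "inner (Y u) v = inner u (Y v)" and Yc: "Y (T u) = T (Y u)" for u v
      by (auto simp: \<Y>_def self_adjoint_def)
    have "norm (Y o\<^sub>L Y) \<le> norm Y * norm Y" by (rule norm_blinfun_compose)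
    also have "\<dots> \<le> q * 1" using Yq q by (intro mult_mono) auto
    finally have "norm (X + (Y o\<^sub>L Y)) \<le> q + q" using norm_triangle_ineq[of X "Y o\<^sub>L Y"] normX by linarith
    then have "norm (F Y) \<le> q" by (simp add: F_def)
    moreover have "self_adjoint (F Y)"
      using sa by (simp add: self_adjoint_def F_app X inner_diff_left inner_diff_right inner_add_left
          inner_add_right Ysa)
    moreover have "F Y (T x) = T (F Y x)" for x
      by (simp add: F_app X Yc blinfun.bilinear_simps)
    moreover have "F Y ` S \<subseteq> S" if S: "subspace S" "closed S" "T ` S \<subseteq> S" for S
    proof safe
      fix s assume s: "s \<in> S"
      have "Y ` S \<subseteq> S" using Y S unfolding \<Y>_def by blast
      then have "Y (Y s) \<in> S" "T (T s) \<in> S" using s S(3) by blast+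
      then show "F Y s \<in> S" unfolding F_app X using s S(1)
        by (intro subspace_scale subspace_add subspace_diff)
    qed
    ultimately show "F Y \<in> \<Y>" by (auto simp: \<Y>_def)
  qed
  moreover have "dist (F Y) (F Z) \<le> q * dist Y Z" if "Y \<in> \<Y>" "Z \<in> \<Y>" for Y Z
  proof -
    have nq: "norm Y \<le> q" "norm Z \<le> q" using that by (auto simp: \<Y>_def)
    have "F Y - F Z = (1/2) *\<^sub>R ((Y o\<^sub>L (Y - Z)) + ((Y - Z) o\<^sub>L Z))"
      by (intro blinfun_eqI) (simp add: F_app blinfun.bilinear_simps algebra_simps)
    then have "norm (F Y - F Z) \<le> (1/2) * (norm (Y o\<^sub>L (Y - Z)) + norm ((Y - Z) o\<^sub>L Z))"
      by (simp add: norm_triangle_ineq)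
    also have "\<dots> \<le> (1/2) * (norm Y * norm (Y - Z) + norm (Y - Z) * norm Z)"
      by (intro mult_left_mono add_mono norm_blinfun_compose) auto
    also have "\<dots> \<le> (1/2) * (q * norm (Y - Z) + norm (Y - Z) * q)"
      using nq q(1) by (intro mult_left_mono add_mono mult_mono) auto
    finally show ?thesis by (simp add: dist_norm)
  qed
  ultimately obtain Y where Y: "Y \<in> \<Y>" "F Y = Y"
    using Banach_fix[of \<Y> q F] q by blast
  define R where "R = N *\<^sub>R (id_blinfun - Y)"
  have R: "R x = N *\<^sub>R (x - Y x)" for x by (simp add: R_def blinfun.bilinear_simps)
  have Yp: "norm Y \<le> q" "\<And>u v. inner (Y u) v = inner u (Y v)" "\<And>x. Y (T x) = T (Y x)"
    "\<And>S. subspace S \<Longrightarrow> closed S \<Longrightarrow> T ` S \<subseteq> S \<Longrightarrow> Y ` S \<subseteq> S"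
    using Y(1) by (auto simp: \<Y>_def self_adjoint_def)
  show thesis
  proof (rule that[of R "N * (1 - q)"])
    show "self_adjoint R"
      by (simp add: self_adjoint_def R Yp(2) inner_diff_left inner_diff_right)
    show "R (R x) = T (T x)" for x
    proof -
      have "2 *\<^sub>R Y x = 2 *\<^sub>R F Y x" by (simp add: Y(2))
      also have "\<dots> = X x + Y (Y x)" by (simp add: F_app)
      finally have "Y (Y x) = 2 *\<^sub>R Y x - x + (1 / N\<^sup>2) *\<^sub>R T (T x)"
        by (simp add: X algebra_simps)
      then show ?thesis using N
        by (simp add: R blinfun.bilinear_simps scaleR_diff_right scaleR_add_right power2_eq_square
            scaleR_2 scaleR_add_left)
    qed
    show "R (T x) = T (R x)" for x by (simp add: R Yp(3) blinfun.bilinear_simps)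
    show "N * (1 - q) > 0" using N q by simp
    show "inner (R x) x \<ge> N * (1 - q) * (norm x)\<^sup>2" for x
    proof -
      have "inner (Y x) x \<le> norm (Y x) * norm x" by (rule norm_cauchy_schwarz)
      also have "\<dots> \<le> (norm Y * norm x) * norm x" by (intro mult_right_mono norm_blinfun) auto
      also have "\<dots> \<le> q * (norm x)\<^sup>2"
        using mult_right_mono[OF Yp(1), of "norm x * norm x"] by (simp add: power2_eq_square mult.assoc)
      finally have "(1 - q) * (norm x)\<^sup>2 \<le> inner (x - Y x) x"
        by (simp add: inner_diff_left power2_norm_eq_inner algebra_simps)
      then show ?thesis using N by (simp add: R mult.assoc)
    qed
    show "R ` S \<subseteq> S" if "subspace S" "closed S" "T ` S \<subseteq> S" for S
    proof safe
      fix s assume "s \<in> S"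
      then show "R s \<in> S" unfolding R using that Yp(4)[OF that]
        by (intro subspace_scale subspace_diff) auto
    qed
  qed
qed

section \<open>Positive and negative subspaces\<close>

text \<open>A self-adjoint operator for which 0 is at most an isolated point of the spectrum.\<close>
locale bounded_below_off_kernel =
  fixes T :: "'a::{real_inner, complete_space} \<Rightarrow>\<^sub>L 'a" and K :: "'a set" and a :: real
  assumes sa: "self_adjoint T"
    and K_def: "K = orthogonal_comp (op_kernel T)"
    and a_pos: "a > 0"
    and below: "\<And>y. y \<in> K \<Longrightarrow> a * norm y \<le> norm (T y)"
begin

lemma T_sym: "inner (T x) y = inner x (T y)"
  using sa by (simp add: self_adjoint_def)

lemma closed_kernel: "subspace (op_kernel T)" "closed (op_kernel T)"
proof -
  show "subspace (op_kernel T)"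
    by (auto simp: subspace_def op_kernel_def blinfun.bilinear_simps)
  have "closed {u. T u = 0}" by (intro closed_Collect_eq continuous_intros)
  then show "closed (op_kernel T)" by (simp add: op_kernel_def)
qed

lemma closed_K: "subspace K" "closed K"
  by (simp_all add: K_def subspace_orthogonal_comp closed_orthogonal_comp)

lemma K_iff: "x \<in> K \<longleftrightarrow> (\<forall>z. T z = 0 \<longrightarrow> inner z x = 0)"
  by (simp add: K_def orthogonal_comp_def orthogonal_def op_kernel_def)

lemma range_in_K: "T x \<in> K"
  by (auto simp: K_iff simp flip: T_sym)

lemma in_K_eq_0: "x \<in> K \<Longrightarrow> T x = 0 \<Longrightarrow> x = 0"
  by (auto simp: K_iff)

lemma maps_onto_K: "T ` K = K"
proof
  show "T ` K \<subseteq> K" using range_in_K by blast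
  have sub: "subspace (T ` K)"
    using closed_K(1) by (simp add: blinfun.bounded_linear_right bounded_linear.linear linear_subspace_image)
  have "closed (T ` K)"
  proof (rule complete_imp_closed, rule completeI)
    fix f assume f: "\<forall>n::nat. f n \<in> T ` K" "Cauchy f"
    then have "\<forall>n. \<exists>k. k \<in> K \<and> f n = T k" by blast
    from choice[OF this] obtain g where g: "\<And>n. g n \<in> K" "\<And>n. f n = T (g n)" by blast
    have gd: "a * dist (g m) (g n) \<le> dist (f m) (f n)" for m n
      using below[of "g m - g n"] g closed_K(1) by (simp add: dist_norm blinfun.bilinear_simps subspace_diff)
    have "Cauchy g" by (rule Cauchy_if_dist_le[OF f(2) a_pos gd])
    then obtain l where l: "g \<longlonglongrightarrow> l" by (meson Cauchy_convergent_iff convergent_def)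
    then have "l \<in> K" using closed_sequentially[OF closed_K(2)] g by blast
    moreover have "(\<lambda>n. T (g n)) \<longlonglongrightarrow> T l" by (intro tendsto_intros l)
    ultimately show "\<exists>l\<in>T ` K. f \<longlonglongrightarrow> l" by (auto simp: g(2)[abs_def])
  qed
  note D = sub this
  show "K \<subseteq> T ` K"
  proof
    fix y assume y: "y \<in> K"
    define e where "e = y - orth_proj (T ` K) y"
    have "orth_proj (T ` K) y \<in> K" using orth_proj_in[OF D, of y] range_in_K by auto
    then have "e \<in> K" using y closed_K(1) by (simp add: e_def subspace_diff)
    moreover have "inner e (T (T e)) = 0"
      unfolding e_def by (rule orth_proj_orthogonal[OF D]) (use range_in_K in auto)
    then have "inner (T e) (T e) = 0" by (simp only: T_sym)
    then have "T e = 0" by simp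
    ultimately have "e = 0" by (rule in_K_eq_0)
    then show "y \<in> T ` K" using orth_proj_in[OF D, of y] by (simp add: e_def)
  qed
qed

lemma preimage_in_K:
  assumes "y \<in> K"
  obtains x where "x \<in> K" "T x = y"
proof -
  have "y \<in> T ` K" using assms maps_onto_K by simp
  then show thesis using that by blast
qed

text \<open>Every closed invariant subspace is reducing, so the kernel of \<open>T\<close> projects onto it within the
  kernel; positivity excludes kernel vectors.\<close>
lemma definite_subspace_in_K:
  assumes S: "subspace S" "closed S" "T ` S \<subseteq> S" and inj: "\<And>u. u \<in> S \<Longrightarrow> T u = 0 \<Longrightarrow> u = 0"
  shows "S \<subseteq> K"
proof
  fix u assume u: "u \<in> S"
  have "inner z u = 0" if z: "T z = 0" for z
  proof -
    let ?p = "orth_proj S z"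
    have p: "?p \<in> S" by (rule orth_proj_in[OF S(1,2)])
    have "inner (T ?p) s = 0" if s: "s \<in> S" for s
    proof -
      have "inner (z - ?p) (T s) = 0" using S s by (intro orth_proj_orthogonal) auto
      moreover have "inner z (T s) = 0" using z by (simp flip: T_sym)
      ultimately show ?thesis by (simp add: inner_diff_left T_sym)
    qed
    then have "T ?p = 0" using p S(3) by (metis image_subset_iff inner_eq_zero_iff)
    then have "?p = 0" using inj p by blast
    then show ?thesis using orth_proj_orthogonal[OF S(1,2) u, of z] by simp
  qed
  then show "u \<in> K" by (simp add: K_iff)
qed

text \<open>The last clause replaces a functional calculus: \<open>R\<close> is a limit of polynomials in \<open>T\<close>, and all
  that matters of this is that \<open>R\<close> preserves the closed invariant subspaces.\<close>
definition absolute_value :: "('a \<Rightarrow>\<^sub>L 'a) \<Rightarrow> bool" where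
  "absolute_value R \<longleftrightarrow> self_adjoint R \<and>
     (\<forall>x\<in>K. R x \<in> K \<and> R (R x) = T (T x) \<and> R (T x) = T (R x)) \<and>
     (\<forall>x. x \<noteq> 0 \<longrightarrow> inner (R x) x > 0) \<and>
     (\<forall>S. subspace S \<longrightarrow> closed S \<longrightarrow> S \<subseteq> K \<longrightarrow> T ` S \<subseteq> S \<longrightarrow> R ` S \<subseteq> S)"

lemma absolute_valueD:
  assumes "absolute_value R"
  shows "self_adjoint R" "x \<in> K \<Longrightarrow> R x \<in> K" "x \<in> K \<Longrightarrow> R (R x) = T (T x)"
    "x \<in> K \<Longrightarrow> R (T x) = T (R x)" "x \<noteq> 0 \<Longrightarrow> inner (R x) x > 0"
    "subspace S \<Longrightarrow> closed S \<Longrightarrow> S \<subseteq> K \<Longrightarrow> T ` S \<subseteq> S \<Longrightarrow> R ` S \<subseteq> S"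
  using assms unfolding absolute_value_def by auto

text \<open>Adding the orthogonal projection onto the kernel makes \<open>T\<close> bounded below everywhere without
  changing it on \<open>K\<close>.\<close>
lemma absolute_value_on_K: "\<exists>R. absolute_value R"
proof -
  define P where "P = orth_proj (op_kernel T)"
  note P = bounded_linear_orth_proj[OF closed_kernel, folded P_def]
  define T' where "T' = T + Blinfun P"
  have T': "T' x = T x + P x" for x
    by (simp add: T'_def blinfun.bilinear_simps bounded_linear_Blinfun_apply[OF P])
  have P0: "T (P x) = 0" for x using orth_proj_in[OF closed_kernel] by (auto simp: P_def op_kernel_def)
  have PK: "x \<in> K \<Longrightarrow> P x = 0" for x
    unfolding P_def by (rule orth_proj_eqI[OF closed_kernel]) (auto simp: op_kernel_def K_iff inner_commute blinfun.bilinear_simps)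
  have KT': "T' x = T x" if "x \<in> K" for x using PK[OF that] by (simp add: T')
  have "self_adjoint T'"
    by (simp add: self_adjoint_def T' T_sym inner_add_left inner_add_right P_def orth_proj_self_adjoint[OF closed_kernel])
  moreover have "min a 1 > 0" using a_pos by simp
  moreover have "min a 1 * norm x \<le> norm (T' x)" for x
  proof -
    define k where "k = x - P x"
    have k: "k \<in> K" unfolding k_def P_def K_def by (rule orth_proj_residual[OF closed_kernel])
    have kp: "inner k (P x) = 0" "inner (P x) k = 0" "inner (T k) (P x) = 0" "inner (P x) (T k) = 0"
      using k range_in_K[of k] P0[of x] by (auto simp: K_iff inner_commute)
    have "(norm (T' x))\<^sup>2 = (norm (T k))\<^sup>2 + (norm (P x))\<^sup>2"
      using kp by (simp add: T' k_def blinfun.bilinear_simps P0 power2_norm_eq_inner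
          inner_add_left inner_add_right)
    moreover have "(min a 1 * norm x)\<^sup>2 = (min a 1 * norm k)\<^sup>2 + (min a 1 * norm (P x))\<^sup>2"
    proof -
      have "x = k + P x" by (simp add: k_def)
      then have "(norm x)\<^sup>2 = (norm k)\<^sup>2 + (norm (P x))\<^sup>2"
        using kp by (metis norm_add_Pythagorean orthogonal_def)
      then show ?thesis by (simp add: power_mult_distrib algebra_simps)
    qed
    moreover have "min a 1 * norm k \<le> norm (T k)"
      using below[OF k] mult_right_mono[of "min a 1" a "norm k"] by simp
    moreover have "min a 1 * norm (P x) \<le> norm (P x)"
      using mult_right_mono[of "min a 1" 1 "norm (P x)"] by simp
    ultimately have "(min a 1 * norm x)\<^sup>2 \<le> (norm (T' x))\<^sup>2"
      using a_pos by (auto intro!: add_mono power_mono)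
    then show ?thesis by (rule power2_le_imp_le) simp
  qed
  ultimately obtain R r where R: "self_adjoint R" "\<And>x. R (R x) = T' (T' x)" "\<And>x. R (T' x) = T' (R x)"
    "r > 0" "\<And>x. inner (R x) x \<ge> r * (norm x)\<^sup>2"
    "\<And>S. subspace S \<Longrightarrow> closed S \<Longrightarrow> T' ` S \<subseteq> S \<Longrightarrow> R ` S \<subseteq> S"
    by (rule absolute_value_exists) blast
  have inv: "R ` S \<subseteq> S" if "subspace S" "closed S" "S \<subseteq> K" "T ` S \<subseteq> S" for S
    using that by (intro R(6)) (auto simp: KT' subset_iff)
  have RK: "R x \<in> K" if "x \<in> K" for x using inv[OF closed_K] range_in_K that by blast
  have "0 < inner (R x) x" if "x \<noteq> 0" for x
  proof -
    have "0 < r * (norm x)\<^sup>2" using R(4) that by simp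
    also have "\<dots> \<le> inner (R x) x" by (rule R(5))
    finally show ?thesis .
  qed
  moreover have "R (R x) = T (T x)" "R (T x) = T (R x)" if "x \<in> K" for x
    using R(2,3)[of x] KT' that RK range_in_K by auto
  ultimately have "absolute_value R"
    unfolding absolute_value_def using R(1) RK inv by simp
  then show ?thesis ..
qed

text \<open>Testing positivity with \<open>u - a T\<^sup>-\<^sup>1 u\<close> turns the lower bound \<open>a\<close> for the norm of \<open>T\<close> into the
  same lower bound for its quadratic form.\<close>
lemma coercive_if_positive:
  assumes S: "subspace S" "S \<subseteq> K" "T ` S = S" and pos: "\<And>u. u \<in> S \<Longrightarrow> inner (T u) u \<ge> 0"
    and u: "u \<in> S"
  shows "inner (T u) u \<ge> a * (norm u)\<^sup>2"
proof -
  have "u \<in> T ` S" using u S(3) by simp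
  then obtain v where v: "v \<in> S" "T v = u" by blast
  have "u - a *\<^sub>R v \<in> S" using u v S(1) by (simp add: subspace_diff subspace_scale)
  note pos[OF this]
  then have "0 \<le> inner (T u) u - 2 * a * inner u u + a * (a * inner u v)"
  proof -
    have "inner (T u) v = inner u u" by (simp add: T_sym v(2))
    then show ?thesis using \<open>0 \<le> inner (T (u - a *\<^sub>R v)) (u - a *\<^sub>R v)\<close>
      by (simp add: blinfun.diff_right blinfun.scaleR_right v(2) inner_diff_left inner_diff_right algebra_simps)
  qed
  moreover have "a * inner u v \<le> inner u u"
  proof -
    have "a * norm v \<le> norm u" using below[of v] v S(2) by auto
    have "a * inner u v \<le> a * (norm u * norm v)"
      using a_pos norm_cauchy_schwarz by (intro mult_left_mono) auto
    also have "\<dots> = norm u * (a * norm v)" by simp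
    also have "\<dots> \<le> norm u * norm u" by (intro mult_left_mono) (auto intro: \<open>a * norm v \<le> norm u\<close>)
    finally show ?thesis by (simp add: dot_square_norm power2_eq_square)
  qed
  then have "a * (a * inner u v) \<le> a * inner u u" using a_pos by (intro mult_left_mono) auto
  ultimately show ?thesis by (simp add: power2_norm_eq_inner)
qed

text \<open>If \<open>T\<close> is positive on a closed invariant subspace \<open>S\<close>, then \<open>R - T\<close> maps \<open>S\<close> into the part of \<open>S\<close>
  where \<open>T = - R\<close>; there \<open>T\<close> is negative, so this part is trivial and \<open>T = R\<close> on \<open>S\<close>.\<close>
lemma positive_subspace_characterization:
  assumes "absolute_value R"
  shows "positive_subspace T = {x\<in>K. R x = T x}" (is "_ = ?Hp")
    and "subspace (positive_subspace T)" "closed (positive_subspace T)"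
    and "\<And>u. u \<in> positive_subspace T \<Longrightarrow> T u \<in> positive_subspace T"
    and "\<And>u. u \<in> positive_subspace T \<Longrightarrow> inner (T u) u \<ge> 0"
proof -
  note R = absolute_valueD[OF assms]
  have sub: "subspace ?Hp" using closed_K(1) by (auto simp: subspace_def blinfun.bilinear_simps)
  have "closed (K \<inter> {x. R x = T x})"
    by (intro closed_Int closed_K closed_Collect_eq continuous_intros)
  moreover have "?Hp = K \<inter> {x. R x = T x}" by auto
  ultimately have cl: "closed ?Hp" by simp
  have inv: "T ` ?Hp \<subseteq> ?Hp"
  proof (rule image_subsetI)
    fix x assume "x \<in> ?Hp"
    then have "R (T x) = T (T x)" using R(4)[of x] by simp
    then show "T x \<in> ?Hp" using range_in_K by simp
  qed
  have pos: "\<forall>u\<in>?Hp. u \<noteq> 0 \<longrightarrow> inner (T u) u > 0"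
  proof safe
    fix u assume "R u = T u" "u \<noteq> 0"
    then show "inner (T u) u > 0" using R(5)[of u] by simp
  qed
  have max: "S \<subseteq> ?Hp" if S: "subspace S" "closed S" "T ` S \<subseteq> S" "\<forall>u\<in>S. u \<noteq> 0 \<longrightarrow> inner (T u) u > 0" for S
  proof
    have inj: "u = 0" if "u \<in> S" "T u = 0" for u
    proof (rule ccontr)
      assume "u \<noteq> 0"
      then have "0 < inner (T u) u" using S(4) that(1) by blast
      then show False using that(2) by simp
    qed
    have SK: "S \<subseteq> K" by (rule definite_subspace_in_K[OF S(1-3) inj])
    fix u assume u: "u \<in> S"
    have RS: "R ` S \<subseteq> S" by (rule R(6)[OF S(1,2) SK S(3)])
    define w where "w = R u - T u"
    have w: "w \<in> S" unfolding w_def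
      using RS S(3) u by (intro subspace_diff[OF S(1)]) (auto simp: image_subset_iff)
    have uK: "u \<in> K" using u SK by blast
    have "R w = - T w"
      using R(3,4)[OF uK] by (simp add: w_def blinfun.bilinear_simps)
    have "w = 0"
    proof (rule ccontr)
      assume "w \<noteq> 0"
      then have "inner (T w) w > 0" "inner (R w) w > 0" using S(4) w R(5) by blast+
      then show False using \<open>R w = - T w\<close> by simp
    qed
    then show "u \<in> ?Hp" using uK by (simp add: w_def)
  qed
  then show eq: "positive_subspace T = ?Hp"
    unfolding positive_subspace_def
  proof (intro equalityI Union_least Union_upper)
    show "S \<subseteq> ?Hp" if "S \<in> {S. subspace S \<and> closed S \<and> T ` S \<subseteq> S \<and> (\<forall>u\<in>S. u \<noteq> 0 \<longrightarrow> inner (T u) u > 0)}" for S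
      using that max[of S] by simp
    show "?Hp \<in> {S. subspace S \<and> closed S \<and> T ` S \<subseteq> S \<and> (\<forall>u\<in>S. u \<noteq> 0 \<longrightarrow> inner (T u) u > 0)}"
      using sub cl inv pos by simp
  qed
  show "subspace (positive_subspace T)" "closed (positive_subspace T)"
    and "\<And>u. u \<in> positive_subspace T \<Longrightarrow> T u \<in> positive_subspace T"
    and "\<And>u. u \<in> positive_subspace T \<Longrightarrow> inner (T u) u \<ge> 0"
    unfolding eq
  proof -
    show "subspace ?Hp" by (rule sub)
    show "closed ?Hp" by (rule cl)
    show "T u \<in> ?Hp" if "u \<in> ?Hp" for u using inv that by blast
    show "inner (T u) u \<ge> 0" if "u \<in> ?Hp" for u
      using pos that by (cases "u = 0") (auto simp: less_imp_le)
  qed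
qed

end

lemma negative_subspace_eq: "negative_subspace T = positive_subspace (- T)"
proof -
  have "(- y \<in> S) = (y \<in> S)" if "subspace S" for S and y :: 'a
    using subspace_neg[OF that, of y] subspace_neg[OF that, of "- y"] by auto
  then have "((\<lambda>x. - T x) ` S \<subseteq> S) = (T ` S \<subseteq> S)" if "subspace S" for S
    using that by (simp add: image_subset_iff)
  then show ?thesis unfolding negative_subspace_def positive_subspace_def
    by (intro arg_cong[where f = Union] Collect_cong) (auto simp: uminus_blinfun.rep_eq)
qed

context bounded_below_off_kernel
begin

lemma uminus_bounded_below: "bounded_below_off_kernel (- T) K a"
proof
  have "op_kernel (- T) = op_kernel T" by (simp add: op_kernel_def uminus_blinfun.rep_eq)
  then show "K = orthogonal_comp (op_kernel (- T))" by (simp add: K_def)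
qed (use sa a_pos below in \<open>auto simp: self_adjoint_def uminus_blinfun.rep_eq\<close>)

lemma onto_summand:
  assumes E: "subspace E" "E \<subseteq> K" and TE: "\<And>u. u \<in> E \<Longrightarrow> T u \<in> E" and TF: "\<And>v. v \<in> F \<Longrightarrow> T v \<in> F"
    and dec: "\<And>y. y \<in> K \<Longrightarrow> \<exists>u\<in>E. \<exists>v\<in>F. y = u + v" and disj: "\<And>x. x \<in> E \<Longrightarrow> x \<in> F \<Longrightarrow> x = 0"
  shows "T ` E = E"
proof
  show "E \<subseteq> T ` E"
  proof
    fix u assume u: "u \<in> E"
    then obtain k where k: "k \<in> K" "T k = u" using preimage_in_K E(2) by blast
    obtain p m where pm: "p \<in> E" "m \<in> F" "k = p + m" using dec[OF k(1)] by blast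
    have "T m = u - T p" by (simp add: k(2)[symmetric] pm(3) blinfun.bilinear_simps)
    then have "T m \<in> E" using E(1) u TE[OF pm(1)] by (simp add: subspace_diff)
    then have "T m = 0" using disj TF[OF pm(2)] by blast
    then show "u \<in> T ` E" using pm k(2) by (auto simp: blinfun.bilinear_simps)
  qed
qed (use TE in blast)

text \<open>\<open>R + T\<close> maps \<open>K\<close> into the positive and \<open>R - T\<close> into the negative subspace, and their sum \<open>2 R\<close> is
  onto \<open>K\<close>.\<close>
theorem spectral_splitting:
  defines "Hp \<equiv> positive_subspace T" and "Hm \<equiv> negative_subspace T"
  shows "subspace Hp" "closed Hp" "subspace Hm" "closed Hm" "Hp \<subseteq> K" "Hm \<subseteq> K"
    and "\<And>u v. u \<in> Hp \<Longrightarrow> v \<in> Hm \<Longrightarrow> inner u v = 0"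
    and "\<And>y. y \<in> K \<Longrightarrow> \<exists>u\<in>Hp. \<exists>v\<in>Hm. y = u + v"
    and "T ` Hp = Hp" "T ` Hm = Hm"
    and "\<And>u. u \<in> Hp \<Longrightarrow> inner (T u) u \<ge> a * (norm u)\<^sup>2"
    and "\<And>v. v \<in> Hm \<Longrightarrow> inner (T v) v \<le> - a * (norm v)\<^sup>2"
proof -
  obtain R where absR: "absolute_value R" using absolute_value_on_K ..
  note R = absolute_valueD[OF absR]
  interpret m: bounded_below_off_kernel "- T" K a by (rule uminus_bounded_below)
  note Hp = positive_subspace_characterization[OF absR, folded Hp_def]
  have Hm_eq: "Hm = positive_subspace (- T)" by (simp add: Hm_def negative_subspace_eq)
  have neg_inv: "T ` S \<subseteq> S" if S: "subspace S" "(- T) ` S \<subseteq> S" for S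
  proof safe
    fix x assume "x \<in> S"
    then have "- T x \<in> S" using S(2) by (auto simp: uminus_blinfun.rep_eq)
    then show "T x \<in> S" using subspace_neg[OF S(1)] by fastforce
  qed
  have "R ` S \<subseteq> S" if "subspace S" "closed S" "S \<subseteq> K" "(- T) ` S \<subseteq> S" for S
    using that by (intro R(6) neg_inv)
  moreover have "R (R x) = (- T) ((- T) x)" "R ((- T) x) = (- T) (R x)" if "x \<in> K" for x
    using R(3,4)[OF that] by (auto simp: uminus_blinfun.rep_eq blinfun.bilinear_simps)
  ultimately have "m.absolute_value R"
    unfolding m.absolute_value_def using R(1,2,5) by simp
  note Hm = m.positive_subspace_characterization[OF this, folded Hm_eq, unfolded uminus_blinfun.rep_eq]
  show Hps: "subspace Hp" "closed Hp" and Hms: "subspace Hm" "closed Hm"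
    and HpK: "Hp \<subseteq> K" and HmK: "Hm \<subseteq> K"
    using Hp Hm by auto
  have TpHp: "T u \<in> Hp" if "u \<in> Hp" for u using Hp(4) that .
  have TmHm: "T v \<in> Hm" if "v \<in> Hm" for v
    using subspace_neg[OF Hms(1) Hm(4)[OF that]] by simp
  have disj: "x = 0" if "x \<in> Hp" "x \<in> Hm" for x
  proof -
    have p: "R x = T x" and m: "R x = - T x" using that Hp(1) Hm(1) by auto
    have "inner (R x) x = inner (T x) x" by (simp only: p)
    moreover have "inner (R x) x = - inner (T x) x" by (simp only: m inner_minus_left)
    ultimately have "inner (R x) x = 0" by linarith
    then show ?thesis using R(5)[of x] by force
  qed
  show dec: "\<exists>u\<in>Hp. \<exists>v\<in>Hm. y = u + v" if y: "y \<in> K" for y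
  proof -
    obtain x1 where x1: "x1 \<in> K" "T x1 = y" using preimage_in_K[OF y] .
    obtain x2 where x2: "x2 \<in> K" "T x2 = x1" using preimage_in_K[OF x1(1)] .
    define x where "x = R x2"
    have x: "x \<in> K" "R x = y" using x2 x1 R(2,3)[of x2] by (auto simp: x_def)
    let ?u = "(1/2) *\<^sub>R (R x + T x)" and ?v = "(1/2) *\<^sub>R (R x - T x)"
    have "?u \<in> K" "?v \<in> K" using R(2) range_in_K x(1) closed_K(1)
      by (auto intro: subspace_scale subspace_add subspace_diff)
    moreover have "R ?u = T ?u" "R ?v = - T ?v"
      using R(3,4)[OF x(1)] by (simp_all add: blinfun.bilinear_simps algebra_simps)
    ultimately have "?u \<in> Hp" "?v \<in> Hm" using Hp(1) Hm(1) by auto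
    moreover have "y = ?u + ?v" using x(2) by (simp add: algebra_simps flip: scaleR_2)
    ultimately show ?thesis by blast
  qed
  show Tp: "T ` Hp = Hp"
    by (rule onto_summand[OF Hps(1) HpK TpHp TmHm dec disj])
  show Tm: "T ` Hm = Hm"
  proof (rule onto_summand[OF Hms(1) HmK TmHm TpHp])
    show "\<exists>u\<in>Hm. \<exists>v\<in>Hp. y = u + v" if "y \<in> K" for y
      using dec[OF that] add.commute by blast
  qed (rule disj | assumption)+
  show "inner u v = 0" if uv: "u \<in> Hp" "v \<in> Hm" for u v
  proof -
    have "u \<in> T ` Hp" using uv(1) Tp by simp
    then obtain w where w: "w \<in> Hp" "T w = u" by blast
    have "R w = u" "R v = - T v" using w uv(2) Hp(1) Hm(1) by auto
    then have "inner u v = inner w (- T v)" using R(1) by (metis self_adjoint_def)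
    also have "\<dots> = - inner u v" using T_sym[of w v] w(2) by simp
    finally show ?thesis by simp
  qed
  show "inner (T u) u \<ge> a * (norm u)\<^sup>2" if "u \<in> Hp" for u
    using coercive_if_positive[OF Hps(1) HpK Tp Hp(5) that] by simp
  show "inner (T v) v \<le> - a * (norm v)\<^sup>2" if "v \<in> Hm" for v
  proof -
    have "(- T) ` Hm = Hm"
    proof -
      have "(- T) ` Hm = uminus ` T ` Hm" by (auto simp: uminus_blinfun.rep_eq)
      also have "\<dots> = Hm"
      proof
        show "uminus ` T ` Hm \<subseteq> Hm" using subspace_neg[OF Hms(1)] unfolding Tm by blast
        show "Hm \<subseteq> uminus ` T ` Hm"
        proof
          fix x assume "x \<in> Hm"
          then have "- x \<in> Hm" by (rule subspace_neg[OF Hms(1)])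
          then show "x \<in> uminus ` T ` Hm" unfolding Tm by (intro image_eqI[of _ _ "- x"]) auto
        qed
      qed
      finally show ?thesis .
    qed
    from m.coercive_if_positive[OF Hms(1) HmK this _ that] Hm(5)
    show ?thesis by (simp add: uminus_blinfun.rep_eq)
  qed
qed

end

section \<open>Zeros of small perturbations of an isomorphism\<close>

text \<open>A zero of \<open>N\<close> is a fixed point of \<open>y - T\<^sup>-\<^sup>1 (N y)\<close>, which contracts with factor \<open>\<theta>\<close>.\<close>
lemma perturbed_zero_exists:
  fixes T :: "'a::{real_inner, complete_space} \<Rightarrow>\<^sub>L 'a" and N :: "'a \<Rightarrow> 'a"
  assumes E: "subspace E" "closed E" "T ` E = E"
    and below: "\<And>y. y \<in> E \<Longrightarrow> a * norm y \<le> norm (T y)"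
    and a: "a > 0" and \<theta>: "0 \<le> \<theta>" "\<theta> < 1" and s: "0 \<le> s"
    and N: "\<And>y. y \<in> E \<Longrightarrow> N y \<in> E"
    and lip: "\<And>x y. x \<in> E \<Longrightarrow> y \<in> E \<Longrightarrow> norm x \<le> s \<Longrightarrow> norm y \<le> s \<Longrightarrow>
      norm (N x - N y - T (x - y)) \<le> \<theta> * a * norm (x - y)"
    and small: "norm (N 0) \<le> (1 - \<theta>) * a * s"
  shows "\<exists>y\<in>E. norm y \<le> s \<and> N y = 0"
proof -
  define U where "U = inv_into E T"
  have U: "U k \<in> E" "T (U k) = k" if "k \<in> E" for k
  proof -
    have "k \<in> T ` E" using that E(3) by simp
    then show "U k \<in> E" "T (U k) = k" unfolding U_def by (rule inv_into_into, rule f_inv_into_f)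
  qed
  define S where "S = E \<inter> cball 0 s"
  define f where "f = (\<lambda>y. y - U (N y))"
  have S_iff: "y \<in> S \<longleftrightarrow> y \<in> E \<and> norm y \<le> s" for y by (auto simp: S_def)
  have fE: "f y \<in> E" if "y \<in> E" for y
    unfolding f_def by (intro subspace_diff[OF E(1)] U(1) N that)
  have Tf: "T (f y) = T y - N y" if "y \<in> E" for y
    using U(2)[OF N[OF that]] by (simp add: f_def blinfun.bilinear_simps)
  have "complete S" unfolding S_def
    by (intro complete_closed_subset[OF _ subset_UNIV complete_UNIV] closed_Int E closed_cball)
  moreover have "0 \<in> S" using E(1) s by (simp add: S_iff subspace_0)
  then have "S \<noteq> {}" by blast
  moreover have "f ` S \<subseteq> S"
  proof (rule image_subsetI)
    fix y assume y: "y \<in> S"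
    then have yE: "y \<in> E" and ys: "norm y \<le> s" by (auto simp: S_iff)
    have *: "norm (N y - N 0 - T (y - 0)) \<le> \<theta> * a * norm (y - 0)"
      using yE ys \<open>0 \<in> S\<close> by (intro lip) (auto simp: S_iff)
    have "a * norm (f y) \<le> norm (T (f y))" by (rule below[OF fE[OF yE]])
    also have "\<dots> = norm ((N y - N 0 - T (y - 0)) + N 0)"
      using norm_minus_commute[of "T y" "N y"] by (simp add: Tf[OF yE])
    also have "\<dots> \<le> \<theta> * a * norm (y - 0) + (1 - \<theta>) * a * s"
      by (rule norm_triangle_le[OF add_mono[OF * small]])
    also have "\<dots> \<le> \<theta> * a * s + (1 - \<theta>) * a * s"
      using ys \<theta> a by (intro add_right_mono mult_left_mono) auto
    also have "\<dots> = a * s" by (simp add: algebra_simps)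
    finally show "f y \<in> S" using fE[OF yE] a by (simp add: S_iff)
  qed
  moreover have "dist (f x) (f y) \<le> \<theta> * dist x y" if "x \<in> S" "y \<in> S" for x y
  proof -
    have xy: "x \<in> E" "y \<in> E" "norm x \<le> s" "norm y \<le> s" using that by (auto simp: S_iff)
    have "a * norm (f x - f y) \<le> norm (T (f x - f y))"
      using fE xy E(1) by (intro below subspace_diff)
    also have "T (f x - f y) = - (N x - N y - T (x - y))"
      by (simp add: blinfun.bilinear_simps Tf xy)
    also have "norm \<dots> \<le> \<theta> * a * norm (x - y)" unfolding norm_minus_cancel by (rule lip[OF xy])
    finally have "a * norm (f x - f y) \<le> a * (\<theta> * norm (x - y))" by (simp add: ac_simps)
    then show ?thesis using a by (simp add: dist_norm)
  qed
  ultimately obtain y where "y \<in> S" "f y = y"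
    using Banach_fix[of S \<theta> f] \<theta> by blast
  then have "y \<in> E" "norm y \<le> s" "T y = T y - N y" using Tf[of y] by (auto simp: S_iff)
  then show ?thesis by auto
qed

section \<open>Radial rescaling\<close>

text \<open>Along each ray in the direction of \<open>P\<close> the function grows at least quadratically, so rescaling
  the ray by \<open>sqrt f\<close> is invertible. The growth being uniform, the inverse is
  defined on a tube whose radius does not depend on the base point, and it depends continuously on
  base point and direction.\<close>
lemma radial_rescaling:
  fixes P :: "'a::real_normed_vector \<Rightarrow>\<^sub>L 'a" and f :: "'a \<Rightarrow> real" and c \<eta> :: real
  assumes PP: "\<And>x. P (P x) = P x" and c: "c > 0"
    and X: "\<And>x e. x \<in> X \<Longrightarrow> x + P e \<in> X"
  defines "D \<equiv> {x\<in>X. norm (P x) < \<eta>}" and "D' \<equiv> {x\<in>X. norm (P x) < sqrt c * \<eta>}"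
  assumes cont: "continuous_on D f"
    and f0: "\<And>x. x \<in> X \<Longrightarrow> P x = 0 \<Longrightarrow> f x = 0"
    and growth: "\<And>x e s t. x \<in> X \<Longrightarrow> P x = 0 \<Longrightarrow> P e = e \<Longrightarrow> 0 \<le> s \<Longrightarrow> s \<le> t \<Longrightarrow> t * norm e < \<eta> \<Longrightarrow>
      c * (t\<^sup>2 - s\<^sup>2) * (norm e)\<^sup>2 \<le> f (x + t *\<^sub>R e) - f (x + s *\<^sub>R e)"
  shows "\<exists>\<psi> \<sigma>. continuous_on D \<psi> \<and> continuous_on D' \<sigma> \<and>
    (\<forall>x\<in>D'. \<sigma> x \<in> D \<and> f (\<sigma> x) = (norm (P x))\<^sup>2 \<and> \<sigma> x - P (\<sigma> x) = x - P x \<and> \<psi> (\<sigma> x) = x) \<and>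
    (\<forall>x\<in>D. \<psi> x \<in> X \<and> \<psi> x - P (\<psi> x) = x - P x \<and> (\<psi> x \<in> D' \<longrightarrow> \<sigma> (\<psi> x) = x))"
proof -
  \<comment> \<open>The base point of \<open>x\<close>, and the ray from it through \<open>x\<close>, which passes \<open>x\<close> at time 1.\<close>
  define bs where "bs x = x - P x" for x
  define pt where "pt x t = bs x + t *\<^sub>R P x" for x t
  have P_bs: "P (bs x) = 0" for x by (simp add: bs_def blinfun.bilinear_simps PP)
  have P_pt: "P (pt x t) = t *\<^sub>R P x" for x t by (simp add: pt_def P_bs blinfun.bilinear_simps PP)
  have bs_pt: "bs (pt x t) = bs x" for x t by (simp add: bs_def[of "pt x t"] P_pt) (simp add: pt_def)
  have pt_1: "pt x 1 = x" for x by (simp add: pt_def bs_def)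
  have bsX: "bs x \<in> X" if "x \<in> X" for x
    using X[OF that, of "- x"] by (simp add: bs_def blinfun.bilinear_simps)
  have ptX: "pt x t \<in> X" if "x \<in> X" for x t
    using X[OF bsX[OF that], of "t *\<^sub>R x"] by (simp add: pt_def blinfun.bilinear_simps)
  have ptD: "pt x t \<in> D" if "x \<in> X" "\<bar>t\<bar> * norm (P x) < \<eta>" for x t
    using ptX[OF that(1)] that(2) by (simp add: D_def P_pt)
  have f_bs: "f (bs x) = 0" if "x \<in> X" for x using f0[OF bsX[OF that] P_bs] .
  have grow: "c * (t\<^sup>2 - s\<^sup>2) * (norm (P x))\<^sup>2 \<le> f (pt x t) - f (pt x s)"
    if "x \<in> X" "0 \<le> s" "s \<le> t" "t * norm (P x) < \<eta>" for x s t
    unfolding pt_def by (rule growth[OF bsX[OF that(1)] P_bs PP that(2-4)])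
  have grow': "c * \<bar>t\<^sup>2 - s\<^sup>2\<bar> * (norm (P x))\<^sup>2 \<le> \<bar>f (pt x t) - f (pt x s)\<bar>"
    if "x \<in> X" "0 \<le> s" "0 \<le> t" "s * norm (P x) < \<eta>" "t * norm (P x) < \<eta>" for x s t
  proof (cases "s \<le> t")
    case True
    then have "s\<^sup>2 \<le> t\<^sup>2" using that by (intro power_mono)
    then show ?thesis using grow[OF that(1,2) True that(5)] by simp
  next
    case False
    then have "t\<^sup>2 \<le> s\<^sup>2" using that by (intro power_mono) auto
    then show ?thesis using grow[OF that(1,3) _ that(4)] False by simp
  qed
  have f_ge: "c * (norm (P x))\<^sup>2 \<le> f x" if "x \<in> D" for x
    using grow[of x 0 1] that f_bs[of x] by (simp add: D_def pt_1 pt_def[of x 0])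
  have f_nonneg: "0 \<le> f x" if "x \<in> D" for x
    using f_ge[OF that] c by (meson less_imp_le mult_nonneg_nonneg order_trans zero_le_power2)
  define \<psi> where "\<psi> x = pt x (sqrt (f x) / norm (P x))" for x
  have norm_P\<psi>: "norm (P (\<psi> x)) = sqrt (f x)" if "x \<in> D" for x
  proof (cases "P x = 0")
    case True
    then have "f x = 0" using f0 that by (simp add: D_def)
    then show ?thesis by (simp add: \<psi>_def P_pt True)
  next
    case False
    then show ?thesis using f_nonneg[OF that] by (simp add: \<psi>_def P_pt)
  qed
  \<comment> \<open>At time \<open>1 / sqrt c\<close> the growth of \<open>f\<close> alone has brought it up to the prescribed value.\<close>
  define T0 where "T0 = 1 / sqrt c"
  have T0: "T0 > 0" "c * T0\<^sup>2 = 1" "T0 * (sqrt c * \<eta>) = \<eta>"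
    using c by (auto simp: T0_def power_divide)
  have T0D: "T0 * norm (P x) < \<eta>" if "x \<in> D'" for x
  proof -
    have "T0 * norm (P x) < T0 * (sqrt c * \<eta>)" using that T0(1) by (simp add: D'_def)
    then show ?thesis by (simp only: T0(3))
  qed
  have ex_\<tau>: "\<exists>t. 0 \<le> t \<and> t \<le> T0 \<and> f (pt x t) = (norm (P x))\<^sup>2" if x: "x \<in> D'" for x
  proof -
    have xX: "x \<in> X" using x by (simp add: D'_def)
    have inD: "pt x t \<in> D" if "t \<in> {0..T0}" for t
    proof (rule ptD[OF xX])
      have "t * norm (P x) \<le> T0 * norm (P x)" using that by (intro mult_right_mono) auto
      then show "\<bar>t\<bar> * norm (P x) < \<eta>" using T0D[OF x] that by simp
    qed
    have "continuous_on {0..T0} (\<lambda>t. f (pt x t))"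
    proof (rule continuous_on_compose2[OF cont])
      show "continuous_on {0..T0} (\<lambda>t. pt x t)" unfolding pt_def by (intro continuous_intros)
    qed (use inD in blast)
    moreover have "f (pt x 0) \<le> (norm (P x))\<^sup>2" using f_bs[OF xX] by (simp add: pt_def)
    moreover have "(norm (P x))\<^sup>2 \<le> f (pt x T0)"
      using grow[OF xX, of 0 T0] T0 T0D[OF x] f_bs[OF xX] by (simp add: pt_def[of x 0])
    ultimately show ?thesis using IVT'[of "\<lambda>t. f (pt x t)" 0 _ T0] T0(1) by auto
  qed
  define \<tau> where "\<tau> x = (SOME t. 0 \<le> t \<and> t \<le> T0 \<and> f (pt x t) = (norm (P x))\<^sup>2)" for x
  have \<tau>: "0 \<le> \<tau> x" "\<tau> x \<le> T0" "f (pt x (\<tau> x)) = (norm (P x))\<^sup>2" if "x \<in> D'" for x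
    using someI_ex[OF ex_\<tau>[OF that]] unfolding \<tau>_def by auto
  have \<tau>_lt: "t * norm (P x) < \<eta>" if "x \<in> D'" "t \<le> T0" for x t
    using mult_right_mono[OF that(2), of "norm (P x)"] T0D[OF that(1)] by simp
  define \<sigma> where "\<sigma> x = pt x (\<tau> x)" for x
  have D'X: "x \<in> X" if "x \<in> D'" for x using that by (simp add: D'_def)
  have \<sigma>D: "\<sigma> x \<in> D" if "x \<in> D'" for x
    unfolding \<sigma>_def using ptD[OF D'X[OF that], of "\<tau> x"] \<tau>[OF that] \<tau>_lt[OF that] by simp
  have f\<sigma>: "f (\<sigma> x) = (norm (P x))\<^sup>2" if "x \<in> D'" for x
    unfolding \<sigma>_def by (rule \<tau>(3)[OF that])
  have \<psi>\<sigma>: "\<psi> (\<sigma> x) = x" if x: "x \<in> D'" for x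
  proof (cases "P x = 0")
    case True
    then show ?thesis by (simp add: \<psi>_def \<sigma>_def pt_def bs_def P_pt blinfun.bilinear_simps)
  next
    case False
    have "\<tau> x \<noteq> 0"
    proof
      assume "\<tau> x = 0"
      then have "f (bs x) = (norm (P x))\<^sup>2" using \<tau>(3)[OF x] by (simp add: pt_def)
      then show False using f_bs[OF D'X[OF x]] False by simp
    qed
    then have "\<tau> x > 0" using \<tau>(1)[OF x] by simp
    then show ?thesis
      using False by (simp add: \<psi>_def f\<sigma>[OF x]) (simp add: \<sigma>_def pt_def[of "pt x _"] bs_pt P_pt, simp add: bs_def)
  qed
  have \<sigma>\<psi>: "\<sigma> (\<psi> x) = x" if x: "x \<in> D" and y: "\<psi> x \<in> D'" for x
  proof (cases "P x = 0")
    case True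
    then show ?thesis by (simp add: \<psi>_def \<sigma>_def pt_def bs_def P_pt blinfun.bilinear_simps)
  next
    case False
    define s where "s = \<tau> (\<psi> x) * (sqrt (f x) / norm (P x))"
    have "P (\<psi> x) = (sqrt (f x) / norm (P x)) *\<^sub>R P x" "bs (\<psi> x) = bs x"
      by (simp_all add: \<psi>_def P_pt bs_pt)
    then have s: "\<sigma> (\<psi> x) = pt x s" by (simp add: \<sigma>_def pt_def s_def)
    have "pt x s \<in> D" using \<sigma>D[OF y] s by simp
    then have "norm (s *\<^sub>R P x) < \<eta>" by (simp add: D_def P_pt)
    moreover have s0: "s \<ge> 0" using \<tau>(1)[OF y] f_nonneg[OF x] by (simp add: s_def)
    ultimately have "c * \<bar>1\<^sup>2 - s\<^sup>2\<bar> * (norm (P x))\<^sup>2 \<le> \<bar>f (pt x 1) - f (pt x s)\<bar>"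
      using x by (intro grow') (auto simp: D_def)
    also have "\<dots> = 0"
      using f\<sigma>[OF y] f_nonneg[OF x] by (simp add: s norm_P\<psi>[OF x] pt_1)
    finally have "(c * (norm (P x))\<^sup>2) * \<bar>1 - s\<^sup>2\<bar> \<le> (c * (norm (P x))\<^sup>2) * 0" by (simp add: ac_simps)
    moreover have "c * (norm (P x))\<^sup>2 > 0" using c False by simp
    ultimately have "\<bar>1 - s\<^sup>2\<bar> \<le> 0" by (rule mult_left_le_imp_le)
    then have "s = 1" using s0 by (simp add: power2_eq_1_iff)
    then show ?thesis by (simp add: s pt_1)
  qed
  have cont_bs: "(bs \<longlongrightarrow> bs x) (at x within S)" for x S
    unfolding bs_def by (intro tendsto_intros)
  have small: "((\<lambda>x. bs x + g x *\<^sub>R P x) \<longlongrightarrow> y) (at y within S)"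
    if "P y = 0" "((\<lambda>x. norm (g x *\<^sub>R P x)) \<longlongrightarrow> 0) (at y within S)" for g y S
  proof -
    have "((\<lambda>x. bs x + g x *\<^sub>R P x) \<longlongrightarrow> bs y + 0) (at y within S)"
      by (rule tendsto_add[OF cont_bs tendsto_norm_zero_cancel[OF that(2)]])
    then show ?thesis using that(1) by (simp add: bs_def)
  qed
  have cont_\<psi>: "continuous_on D \<psi>"
    unfolding continuous_on_def
  proof
    fix x assume x: "x \<in> D"
    have lim_f: "(f \<longlongrightarrow> f x) (at x within D)" using cont x by (simp add: continuous_on_def)
    show "(\<psi> \<longlongrightarrow> \<psi> x) (at x within D)"
    proof (cases "P x = 0")
      case False
      then show ?thesis unfolding \<psi>_def pt_def
        by (intro tendsto_intros cont_bs lim_f) auto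
    next
      case True
      then have fx: "f x = 0" using f0 x by (simp add: D_def)
      have "((\<lambda>y. sqrt (f y)) \<longlongrightarrow> 0) (at x within D)"
        using tendsto_real_sqrt[OF lim_f] by (simp add: fx)
      then have "((\<lambda>y. norm ((sqrt (f y) / norm (P y)) *\<^sub>R P y)) \<longlongrightarrow> 0) (at x within D)"
      proof (rule Lim_transform_eventually)
        show "\<forall>\<^sub>F y in at x within D. sqrt (f y) = norm ((sqrt (f y) / norm (P y)) *\<^sub>R P y)"
          unfolding eventually_at_topological using norm_P\<psi> by (auto simp: \<psi>_def P_pt)
      qed
      from small[OF True this] show ?thesis
        by (simp add: \<psi>_def[abs_def] pt_def) (simp add: True bs_def)
    qed
  qed
  have cont_\<sigma>: "continuous_on D' \<sigma>"
    unfolding continuous_on_def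
  proof
    fix x assume x: "x \<in> D'"
    have lim_P: "((\<lambda>y. norm (P y)) \<longlongrightarrow> norm (P x)) (at x within D')" by (intro tendsto_intros)
    show "(\<sigma> \<longlongrightarrow> \<sigma> x) (at x within D')"
    proof (cases "P x = 0")
      case True
      have "((\<lambda>y. norm (\<tau> y *\<^sub>R P y)) \<longlongrightarrow> 0) (at x within D')"
      proof (rule tendsto_sandwich)
        show "\<forall>\<^sub>F y in at x within D'. 0 \<le> norm (\<tau> y *\<^sub>R P y)" by simp
        show "\<forall>\<^sub>F y in at x within D'. norm (\<tau> y *\<^sub>R P y) \<le> T0 * norm (P y)"
          unfolding eventually_at_topological using \<tau> by (auto intro!: mult_right_mono)
        show "((\<lambda>y. T0 * norm (P y)) \<longlongrightarrow> 0) (at x within D')"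
          using tendsto_mult_left[OF lim_P, of T0] by (simp add: True)
      qed simp
      from small[OF True this] show ?thesis
        by (simp add: \<sigma>_def[abs_def] pt_def) (simp add: True bs_def)
    next
      case False
      let ?t = "\<tau> x"
      have xt: "0 \<le> ?t" "?t \<le> T0" using \<tau>[OF x] by auto
      \<comment> \<open>The scaling factor of \<open>x\<close>, used at a nearby \<open>y\<close>, nearly solves the equation that
        determines the factor of \<open>y\<close>; by the growth of \<open>f\<close> the two factors are then close.\<close>
      have near: "c * \<bar>(\<tau> y)\<^sup>2 - ?t\<^sup>2\<bar> * (norm (P y))\<^sup>2 \<le> \<bar>(norm (P y))\<^sup>2 - f (pt y ?t)\<bar>" if y: "y \<in> D'" for y
        using grow'[OF D'X[OF y] xt(1) \<tau>(1)[OF y] \<tau>_lt[OF y xt(2)] \<tau>_lt[OF y \<tau>(2)[OF y]]]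
        by (simp add: \<tau>(3)[OF y])
      have inD: "pt y ?t \<in> D" if "y \<in> D'" for y
        using ptD[OF D'X[OF that], of ?t] xt \<tau>_lt[OF that xt(2)] by simp
      have "continuous_on D' (\<lambda>y. f (pt y ?t))"
      proof (rule continuous_on_compose2[OF cont])
        show "continuous_on D' (\<lambda>y. pt y ?t)" unfolding pt_def bs_def by (intro continuous_intros)
      qed (use inD in blast)
      then have lim_f: "((\<lambda>y. f (pt y ?t)) \<longlongrightarrow> f (pt x ?t)) (at x within D')"
        using x by (simp add: continuous_on_def)
      have "((\<lambda>y. \<bar>(norm (P y))\<^sup>2 - f (pt y ?t)\<bar> / (c * (norm (P y))\<^sup>2)) \<longlongrightarrow>
             \<bar>(norm (P x))\<^sup>2 - f (pt x ?t)\<bar> / (c * (norm (P x))\<^sup>2)) (at x within D')"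
        using False c by (intro tendsto_intros lim_f lim_P) auto
      then have lim0: "((\<lambda>y. \<bar>(norm (P y))\<^sup>2 - f (pt y ?t)\<bar> / (c * (norm (P y))\<^sup>2)) \<longlongrightarrow> 0) (at x within D')"
        by (simp add: \<tau>(3)[OF x])
      have "\<forall>\<^sub>F y in at x within D'. 0 < norm (P y)"
        using order_tendstoD(1)[OF lim_P, of 0] False by simp
      moreover have "\<forall>\<^sub>F y in at x within D'. y \<in> D'"
        by (simp add: eventually_at_filter)
      ultimately have "\<forall>\<^sub>F y in at x within D'. norm ((\<tau> y)\<^sup>2 - ?t\<^sup>2) \<le> \<bar>(norm (P y))\<^sup>2 - f (pt y ?t)\<bar> / (c * (norm (P y))\<^sup>2)"
      proof eventually_elim
        case (elim y)
        then show ?case using near[of y] c by (simp add: pos_le_divide_eq ac_simps)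
      qed
      then have "((\<lambda>y. (\<tau> y)\<^sup>2 - ?t\<^sup>2) \<longlongrightarrow> 0) (at x within D')"
        by (rule Lim_null_comparison[OF _ lim0])
      then have "((\<lambda>y. (\<tau> y)\<^sup>2) \<longlongrightarrow> ?t\<^sup>2) (at x within D')" by (rule LIM_zero_cancel)
      then have "((\<lambda>y. sqrt ((\<tau> y)\<^sup>2)) \<longlongrightarrow> sqrt (?t\<^sup>2)) (at x within D')" by (rule tendsto_real_sqrt)
      then have "((\<lambda>y. sqrt ((\<tau> y)\<^sup>2)) \<longlongrightarrow> ?t) (at x within D')" using xt by simp
      then have "(\<tau> \<longlongrightarrow> ?t) (at x within D')"
        by (rule Lim_transform_eventually) (use \<tau> in \<open>auto simp: eventually_at_topological\<close>)
      then show ?thesis unfolding \<sigma>_def pt_def by (intro tendsto_intros cont_bs)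
    qed
  qed
  have "\<sigma> x - P (\<sigma> x) = x - P x" "\<psi> x - P (\<psi> x) = x - P x" for x
    using bs_pt by (simp_all add: \<sigma>_def \<psi>_def bs_def)
  moreover have "\<psi> x \<in> X" if "x \<in> D" for x
    using that ptX by (simp add: \<psi>_def D_def)
  ultimately show ?thesis
    using cont_\<psi> cont_\<sigma> \<sigma>D f\<sigma> \<psi>\<sigma> \<sigma>\<psi> by (intro exI[of _ \<psi>] exI[of _ \<sigma>]) simp
qed

section \<open>A Morse lemma with parameters\<close>

text \<open>Three mutually orthogonal projections with sum 1, and an operator that is positive definite on
  the range of the second and negative definite on that of the third. Their being projections
  follows from \<open>P_sum\<close> and \<open>orth\<close>.\<close>
locale hilbert_splitting =
  fixes T P0 Pp Pm :: "'a::{real_inner, complete_space} \<Rightarrow>\<^sub>L 'a" and a :: real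
  assumes P_sum: "\<And>x. P0 x + Pp x + Pm x = x"
    and orth: "\<And>x y. inner (P0 x) (Pp y) = 0" "\<And>x y. inner (P0 x) (Pm y) = 0"
      "\<And>x y. inner (Pp x) (Pm y) = 0"
    and a: "a > 0"
    and pos: "\<And>x. inner (T (Pp x)) (Pp x) \<ge> a * (norm (Pp x))\<^sup>2"
    and neg: "\<And>x. inner (T (Pm x)) (Pm x) \<le> - a * (norm (Pm x))\<^sup>2"
    and onto_p: "T ` {u. Pp u = u} = {u. Pp u = u}"
    and onto_m: "T ` {v. Pm v = v} = {v. Pm v = v}"
begin

lemma orth': "inner (Pp x) (P0 y) = 0" "inner (Pm x) (P0 y) = 0" "inner (Pm x) (Pp y) = 0"
  using orth by (metis inner_commute)+

lemma P_P [simp]: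
  "P0 (P0 x) = P0 x" "P0 (Pp x) = 0" "P0 (Pm x) = 0"
  "Pp (P0 x) = 0" "Pp (Pp x) = Pp x" "Pp (Pm x) = 0"
  "Pm (P0 x) = 0" "Pm (Pp x) = 0" "Pm (Pm x) = Pm x"
proof -
  have zero: "P0 y = 0" if "\<And>v. inner (P0 v) y = 0" for y
    using arg_cong[OF P_sum[of y], of "\<lambda>z. inner (P0 y) z"] that[of y]
    by (simp add: inner_add_right orth)
  have zerop: "Pp y = 0" if "\<And>v. inner (Pp v) y = 0" for y
    using arg_cong[OF P_sum[of y], of "\<lambda>z. inner (Pp y) z"] that[of y]
    by (simp add: inner_add_right orth orth')
  have zerom: "Pm y = 0" if "\<And>v. inner (Pm v) y = 0" for y
    using arg_cong[OF P_sum[of y], of "\<lambda>z. inner (Pm y) z"] that[of y]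
    by (simp add: inner_add_right orth')
  show z: "P0 (Pp x) = 0" "P0 (Pm x) = 0" "Pp (P0 x) = 0" "Pp (Pm x) = 0" "Pm (P0 x) = 0" "Pm (Pp x) = 0"
    by (intro zero zerop zerom orth orth')+
  show "P0 (P0 x) = P0 x" "Pp (Pp x) = Pp x" "Pm (Pm x) = Pm x"
    using P_sum[of "P0 x"] P_sum[of "Pp x"] P_sum[of "Pm x"] by (simp_all add: z)
qed

lemma P_self_adjoint:
  "inner (Pp x) y = inner x (Pp y)" "inner (Pm x) y = inner x (Pm y)"
proof -
  have "inner (Pp x) y = inner (Pp x) (P0 y + Pp y + Pm y)" by (simp only: P_sum)
  also have "\<dots> = inner (P0 x + Pp x + Pm x) (Pp y)" by (simp add: inner_add_left inner_add_right orth orth')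
  finally show "inner (Pp x) y = inner x (Pp y)" by (simp only: P_sum)
  have "inner (Pm x) y = inner (Pm x) (P0 y + Pp y + Pm y)" by (simp only: P_sum)
  also have "\<dots> = inner (P0 x + Pp x + Pm x) (Pm y)" by (simp add: inner_add_left inner_add_right orth orth')
  finally show "inner (Pm x) y = inner x (Pm y)" by (simp only: P_sum)
qed

lemma K_sum: "P0 k = 0 \<Longrightarrow> Pp k + Pm k = k"
  using P_sum[of k] by simp

lemma norm_Pythagoras:
  assumes "P0 k = 0"
  shows "(norm k)\<^sup>2 = (norm (Pp k))\<^sup>2 + (norm (Pm k))\<^sup>2" "norm (Pp k - Pm k) = norm k"
proof -
  have "(norm (Pp k + Pm k))\<^sup>2 = (norm (Pp k))\<^sup>2 + (norm (Pm k))\<^sup>2"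
    "(norm (Pp k - Pm k))\<^sup>2 = (norm (Pp k))\<^sup>2 + (norm (Pm k))\<^sup>2"
    unfolding power2_norm_eq_inner
    by (simp_all add: inner_add_left inner_add_right inner_diff_left inner_diff_right orth orth')
  then show *: "(norm k)\<^sup>2 = (norm (Pp k))\<^sup>2 + (norm (Pm k))\<^sup>2"
    and "norm (Pp k - Pm k) = norm k"
    unfolding K_sum[OF assms] by (auto intro: power2_eq_imp_eq)
qed

lemma T_parts: "Pp (T (Pp x)) = T (Pp x)" "Pm (T (Pm x)) = T (Pm x)"
proof -
  have "T (Pp x) \<in> T ` {u. Pp u = u}" "T (Pm x) \<in> T ` {u. Pm u = u}"
    by (intro imageI, simp)+
  then have "T (Pp x) \<in> {u. Pp u = u}" "T (Pm x) \<in> {u. Pm u = u}"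
    unfolding onto_p onto_m .
  then show "Pp (T (Pp x)) = T (Pp x)" "Pm (T (Pm x)) = T (Pm x)" by auto
qed

text \<open>Pairing with \<open>Pp k - Pm k\<close> makes the indefinite form definite.\<close>
lemma T_definite:
  assumes "P0 k = 0"
  shows "inner (T k) (Pp k - Pm k) \<ge> a * (norm k)\<^sup>2"
proof -
  have "inner (T (Pp k)) (Pm k) = 0" "inner (T (Pm k)) (Pp k) = 0"
    using orth(3)[of "T (Pp k)" k] orth'(3)[of "T (Pm k)" k] by (simp_all add: T_parts)
  then have "inner (T (Pp k + Pm k)) (Pp k - Pm k) = inner (T (Pp k)) (Pp k) - inner (T (Pm k)) (Pm k)"
    by (simp add: blinfun.bilinear_simps inner_add_left inner_diff_right)
  then have "inner (T k) (Pp k - Pm k) = inner (T (Pp k)) (Pp k) - inner (T (Pm k)) (Pm k)"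
    unfolding K_sum[OF assms] .
  then show ?thesis using pos[of k] neg[of k] by (simp add: norm_Pythagoras(1)[OF assms] algebra_simps)
qed

lemma T_below:
  assumes "P0 k = 0"
  shows "a * norm k \<le> norm (T k)"
  using order_trans[OF T_definite[OF assms] norm_cauchy_schwarz]
  unfolding norm_Pythagoras(2)[OF assms] by (rule cancel_norm) simp

lemma T_P0: "P0 k = 0 \<Longrightarrow> P0 (T k) = 0"
proof -
  assume "P0 k = 0"
  from K_sum[OF this] have "T k = T (Pp k) + T (Pm k)" by (simp flip: blinfun.add_right)
  also have "\<dots> = Pp (T (Pp k)) + Pm (T (Pm k))" by (simp only: T_parts)
  finally show "P0 (T k) = 0" by (simp add: blinfun.bilinear_simps)
qed

lemma subspace_K: "subspace {y. P0 y = 0}" "closed {y. P0 y = 0}"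
  by (auto simp: subspace_def blinfun.bilinear_simps intro!: closed_Collect_eq continuous_intros)

lemma onto_K: "T ` {y. P0 y = 0} = {y. P0 y = 0}"
proof (intro subset_antisym subsetI)
  fix y assume "y \<in> {y. P0 y = 0}"
  then have y: "P0 y = 0" by simp
  have "Pp y \<in> T ` {u. Pp u = u}" "Pm y \<in> T ` {u. Pm u = u}" by (simp_all add: onto_p onto_m)
  then obtain u v where uv: "Pp u = u" "Pm v = v" "Pp y = T u" "Pm y = T v" by auto
  have "P0 (Pp u + Pm v) = 0" by (simp add: blinfun.bilinear_simps)
  then have "P0 (u + v) = 0" by (simp only: uv)
  moreover have "y = T (u + v)" by (simp add: K_sum[OF y] blinfun.add_right flip: uv(3,4))
  ultimately show "y \<in> T ` {y. P0 y = 0}" by blast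
qed (auto simp: T_P0)

end

lemma second_order_growth:
  fixes g g' :: "real \<Rightarrow> real"
  assumes "\<And>t. 0 \<le> t \<Longrightarrow> t \<le> 1 \<Longrightarrow> (g has_real_derivative g' t) (at t)"
    and "\<And>t. 0 \<le> t \<Longrightarrow> t \<le> 1 \<Longrightarrow> g' 0 + c * t \<le> g' t"
  shows "g 0 + g' 0 + c / 2 \<le> g 1"
proof -
  define k where "k t = g t - g' 0 * t - c / 2 * t\<^sup>2" for t
  have "k 0 \<le> k 1"
  proof (rule DERIV_nonneg_imp_nondecreasing[of 0 1 k])
    fix t :: real assume t: "0 \<le> t" "t \<le> 1"
    have "(k has_real_derivative g' t - g' 0 - c * t) (at t)"
      unfolding k_def by (auto intro!: derivative_eq_intros assms(1)[OF t])
    then show "\<exists>y. (k has_real_derivative y) (at t) \<and> 0 \<le> y" using assms(2)[OF t] by force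
  qed simp
  then show ?thesis by (simp add: k_def)
qed

text \<open>A family of functions \<open>L\<close> on the slices \<open>P0 x = z\<close> near their critical points \<open>w z\<close>. The
  gradient \<open>A\<close> differs from the linear map \<open>T\<close> by a map with Lipschitz constant below the
  lower bound \<open>a\<close> of \<open>T\<close>, so on each slice \<open>L\<close> is uniformly convex in the positive and uniformly
  concave in the negative directions.\<close>
locale saddle_family = hilbert_splitting +
  fixes Z U :: "'a::{real_inner, complete_space} set" and w A :: "'a \<Rightarrow> 'a" and L :: "'a \<Rightarrow> real" and \<theta> \<eta> :: real
  assumes \<theta>: "0 \<le> \<theta>" "\<theta> < 1" and \<eta>: "\<eta> > 0"
    and Z_open: "open {x. P0 x \<in> Z}"
    and w_cont: "continuous_on Z w" and w_P0: "\<And>z. z \<in> Z \<Longrightarrow> P0 (w z) = z"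
    and U_def: "U = {x. P0 x \<in> Z \<and> norm (x - w (P0 x)) < \<eta>}"
    and grad: "\<And>x. x \<in> U \<Longrightarrow> GDERIV L x :> A x"
    and A_cont: "continuous_on U A"
    and A_near_T: "\<And>x y k. x \<in> U \<Longrightarrow> y \<in> U \<Longrightarrow> P0 x = P0 y \<Longrightarrow> P0 k = 0 \<Longrightarrow>
      \<bar>inner (A x - A y - T (x - y)) k\<bar> \<le> \<theta> * a * norm (x - y) * norm k"
    and critical: "\<And>z k. z \<in> Z \<Longrightarrow> P0 k = 0 \<Longrightarrow> inner (A (w z)) k = 0"
begin

definition c where "c = (1 - \<theta>) * a"

lemma c_pos: "c > 0" using \<theta> a by (simp add: c_def)

lemma w_in_U: "z \<in> Z \<Longrightarrow> w z \<in> U"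
  using \<eta> w_P0 by (simp add: U_def)

text \<open>Reflecting the negative directions makes the gradient strongly monotone. On purely positive or
  purely negative increments this is uniform convexity or concavity.\<close>
lemma gradient_monotone:
  assumes "x \<in> U" "x + d \<in> U" "P0 d = 0"
  shows "inner (A (x + d) - A x) (Pp d - Pm d) \<ge> c * (norm d)\<^sup>2"
proof -
  have "P0 (x + d) = P0 x" "P0 (Pp d - Pm d) = 0" using assms(3) by (simp_all add: blinfun.bilinear_simps)
  from A_near_T[OF assms(2,1) this]
  have "\<bar>inner (A (x + d) - A x - T d) (Pp d - Pm d)\<bar> \<le> \<theta> * a * (norm d)\<^sup>2"
    by (simp add: norm_Pythagoras(2)[OF assms(3)] power2_eq_square mult.assoc)
  moreover have "inner (A (x + d) - A x) (Pp d - Pm d) =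
      inner (A (x + d) - A x - T d) (Pp d - Pm d) + inner (T d) (Pp d - Pm d)"
    by (simp add: inner_diff_left)
  ultimately show ?thesis using T_definite[OF assms(3)] by (simp add: c_def algebra_simps abs_le_iff)
qed

lemma segment_in_U:
  assumes "x \<in> U" "x + e \<in> U" "P0 e = 0" "0 \<le> t" "t \<le> 1"
  shows "x + t *\<^sub>R e \<in> U"
proof -
  have "x \<in> ball (w (P0 x)) \<eta>" "x + e \<in> ball (w (P0 x)) \<eta>"
    using assms by (auto simp: U_def dist_norm norm_minus_commute blinfun.bilinear_simps)
  from convexD_alt[OF convex_ball this assms(4,5)] have "x + t *\<^sub>R e \<in> ball (w (P0 x)) \<eta>"
    by (simp add: algebra_simps)
  then show ?thesis using assms(1,3)
    by (simp add: U_def dist_norm norm_minus_commute blinfun.bilinear_simps)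
qed

lemma L_deriv_line:
  assumes "x + t *\<^sub>R e \<in> U"
  shows "((\<lambda>t. L (x + t *\<^sub>R e)) has_real_derivative inner (A (x + t *\<^sub>R e)) e) (at t)"
proof -
  have "((\<lambda>t. x + t *\<^sub>R e) has_derivative (\<lambda>h. h *\<^sub>R e)) (at t)"
    by (auto intro!: derivative_eq_intros)
  moreover have "(L has_derivative (\<lambda>h. inner h (A (x + t *\<^sub>R e)))) (at (x + t *\<^sub>R e))"
    using grad[OF assms] by (simp add: gderiv_def)
  ultimately have "((\<lambda>t. L (x + t *\<^sub>R e)) has_derivative (\<lambda>h. inner (h *\<^sub>R e) (A (x + t *\<^sub>R e)))) (at t)"
    by (rule has_derivative_compose)
  then show ?thesis by (simp add: has_field_derivative_def inner_commute mult.commute[of _ "inner _ _"])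
qed

lemma definite_direction:
  assumes "x \<in> U" "x + e \<in> U" "P0 e = 0" and \<epsilon>: "Pp e - Pm e = \<epsilon> *\<^sub>R e"
  shows "\<epsilon> * L x + \<epsilon> * inner (A x) e + c / 2 * (norm e)\<^sup>2 \<le> \<epsilon> * L (x + e)"
proof -
  have in_U: "x + t *\<^sub>R e \<in> U" if "0 \<le> t" "t \<le> 1" for t
    by (rule segment_in_U[OF assms(1-3) that])
  have "\<epsilon> * L (x + 0 *\<^sub>R e) + \<epsilon> * inner (A (x + 0 *\<^sub>R e)) e + c * (norm e)\<^sup>2 / 2 \<le> \<epsilon> * L (x + 1 *\<^sub>R e)"
  proof (rule second_order_growth)
    fix t :: real assume t: "0 \<le> t" "t \<le> 1"
    show "((\<lambda>t. \<epsilon> * L (x + t *\<^sub>R e)) has_real_derivative \<epsilon> * inner (A (x + t *\<^sub>R e)) e) (at t)"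
      by (rule DERIV_cmult[OF L_deriv_line[OF in_U[OF t]]])
    have "Pp (t *\<^sub>R e) - Pm (t *\<^sub>R e) = t *\<^sub>R (\<epsilon> *\<^sub>R e)"
      by (simp add: blinfun.scaleR_right \<epsilon> flip: scaleR_diff_right)
    then have "c * (norm (t *\<^sub>R e))\<^sup>2 \<le> inner (A (x + t *\<^sub>R e) - A x) (t *\<^sub>R (\<epsilon> *\<^sub>R e))"
      using gradient_monotone[OF assms(1) in_U[OF t]] assms(3) by (simp add: blinfun.scaleR_right)
    then have "t * (c * t * (norm e)\<^sup>2) \<le> t * (\<epsilon> * inner (A (x + t *\<^sub>R e) - A x) e)"
      by (simp add: power_mult_distrib power2_eq_square ac_simps)
    then have "t = 0 \<or> c * t * (norm e)\<^sup>2 \<le> \<epsilon> * inner (A (x + t *\<^sub>R e) - A x) e"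
      using t(1) by (cases "t = 0") simp_all
    then show "\<epsilon> * inner (A (x + 0 *\<^sub>R e)) e + c * (norm e)\<^sup>2 * t \<le> \<epsilon> * inner (A (x + t *\<^sub>R e)) e"
      by (auto simp: inner_diff_left algebra_simps)
  qed
  then show ?thesis by simp
qed

lemma convex_direction:
  assumes "x \<in> U" "x + e \<in> U" "Pp e = e"
  shows "L x + inner (A x) e + c / 2 * (norm e)\<^sup>2 \<le> L (x + e)"
proof -
  have "P0 e = 0" "Pm e = 0" using assms(3) P_P by metis+
  then show ?thesis using definite_direction[of x e 1] assms by simp
qed

lemma concave_direction:
  assumes "x \<in> U" "x + e \<in> U" "Pm e = e"
  shows "L (x + e) \<le> L x + inner (A x) e - c / 2 * (norm e)\<^sup>2"
proof -
  have "P0 e = 0" "Pp e = 0" using assms(3) P_P by metis+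
  then show ?thesis using definite_direction[of x e "- 1"] assms by simp
qed

lemma L_cont: "continuous_on U L"
  using grad by (auto intro!: continuous_at_imp_continuous_on has_derivative_continuous simp: gderiv_def)

subsection \<open>The ridge\<close>

text \<open>Small enough that the ridge over the ball of radius \<open>\<eta>1\<close> stays within distance \<open>\<eta> / 2\<close> of the
  critical point; the other half of \<open>\<eta>\<close> is left for the negative directions.\<close>
definition \<eta>1 where "\<eta>1 = (1 - \<theta>) * \<eta> / 2"

definition D1 where "D1 = {x. P0 x \<in> Z \<and> norm (Pp x) < \<eta>1}"

definition base where "base x = w (P0 x) + Pp x"

lemma \<eta>1: "\<eta>1 > 0" "\<eta>1 / (1 - \<theta>) = \<eta> / 2"
  using \<theta> \<eta> by (simp_all add: \<eta>1_def field_simps)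

lemma norm_budget:
  assumes "x \<in> D1" "norm v \<le> \<theta> / (1 - \<theta>) * norm (Pp x)"
  shows "norm (Pp x) + norm v < \<eta> / 2"
proof -
  have "norm (Pp x) + norm v \<le> norm (Pp x) + \<theta> / (1 - \<theta>) * norm (Pp x)" using assms(2) by simp
  also have "\<dots> = norm (Pp x) / (1 - \<theta>)" using \<theta> by (simp add: field_simps)
  also have "\<dots> < \<eta>1 / (1 - \<theta>)" using assms(1) \<theta> by (simp add: D1_def divide_strict_right_mono)
  finally show ?thesis by (simp add: \<eta>1)
qed

lemma base_in_U:
  assumes "P0 x \<in> Z" "P0 v = 0" "norm (Pp x) + norm v < \<eta>"
  shows "base x + v \<in> U"
  using assms norm_triangle_ineq[of "Pp x" v] by (simp add: U_def base_def blinfun.bilinear_simps w_P0 add.assoc)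

text \<open>Over the negative subspace the gradient component is again a small perturbation of \<open>T\<close>. At the
  critical point it vanishes, and moving away by \<open>Pp x\<close> changes it by \<open>\<theta> a norm (Pp x)\<close> at most, since
  \<open>T (Pp x)\<close> has no negative component.\<close>
lemma ridge_exists:
  assumes x: "x \<in> D1"
  shows "\<exists>v. Pm v = v \<and> norm v \<le> \<theta> / (1 - \<theta>) * norm (Pp x) \<and> Pm (A (base x + v)) = 0"
proof -
  let ?s = "\<theta> / (1 - \<theta>) * norm (Pp x)" and ?E = "{v. Pm v = v}"
  have xZ: "P0 x \<in> Z" using x by (simp add: D1_def)
  have E: "subspace ?E" "closed ?E"
    by (auto simp: subspace_def blinfun.bilinear_simps intro!: closed_Collect_eq continuous_intros)
  have s: "?s \<ge> 0" using \<theta> by simp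
  have P0E: "P0 v = 0" if "Pm v = v" for v using that P_P by metis
  have in_U: "base x + v \<in> U" if "Pm v = v" "norm v \<le> ?s" for v
    using base_in_U[OF xZ P0E[OF that(1)]] norm_budget[OF x that(2)] \<eta> by simp
  have "\<exists>v\<in>?E. norm v \<le> ?s \<and> Pm (A (base x + v)) = 0"
  proof (rule perturbed_zero_exists[OF E onto_m _ a \<theta> s])
    show "a * norm y \<le> norm (T y)" if "y \<in> ?E" for y using that T_below P0E by simp
    show "norm (Pm (A (base x + u)) - Pm (A (base x + v)) - T (u - v)) \<le> \<theta> * a * norm (u - v)"
      if "u \<in> ?E" "v \<in> ?E" "norm u \<le> ?s" "norm v \<le> ?s" for u v
    proof -
      have uv: "Pm u = u" "Pm v = v" using that by auto
      have "Pm (T (u - v)) = T (u - v)" using T_parts(2)[of "u - v"] uv by (simp add: blinfun.bilinear_simps)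
      let ?y = "A (base x + u) - A (base x + v) - T (u - v)"
      have d: "Pm (A (base x + u)) - Pm (A (base x + v)) - T (u - v) = Pm ?y"
        using \<open>Pm (T (u - v)) = _\<close> by (simp add: blinfun.bilinear_simps)
      have "(norm (Pm ?y))\<^sup>2 = inner ?y (Pm ?y)" by (simp add: power2_norm_eq_inner P_self_adjoint)
      also have "\<dots> \<le> \<theta> * a * norm (u - v) * norm (Pm ?y)"
        using A_near_T[OF in_U[OF uv(1) that(3)] in_U[OF uv(2) that(4)], of "Pm ?y"]
        by (simp add: blinfun.bilinear_simps P0E uv)
      finally show ?thesis unfolding d using \<theta> a cancel_norm[of 1 "Pm ?y"] by simp
    qed
    show "norm (Pm (A (base x + 0))) \<le> (1 - \<theta>) * a * ?s"
    proof -
      let ?d = "Pm (A (base x))"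
      have b: "base x \<in> U" using in_U[of 0] s by (simp add: blinfun.bilinear_simps)
      have "inner (T (Pp x)) ?d = 0" using orth(3)[of "T (Pp x)" "A (base x)"] by (simp add: T_parts)
      then have "(norm ?d)\<^sup>2 = inner (A (base x) - A (w (P0 x)) - T (base x - w (P0 x))) ?d"
        using critical[OF xZ, of ?d]
        by (simp add: inner_diff_left base_def power2_norm_eq_inner P_self_adjoint)
      also have "\<dots> \<le> \<theta> * a * norm (base x - w (P0 x)) * norm ?d"
        using A_near_T[OF b w_in_U[OF xZ], of ?d] by (simp add: base_def blinfun.bilinear_simps)
      also have "\<dots> = \<theta> * a * norm (Pp x) * norm ?d" by (simp add: base_def)
      finally have "norm ?d \<le> \<theta> * a * norm (Pp x)" using \<theta> a cancel_norm[of 1 ?d] by simp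
      then show ?thesis using \<theta> by (simp add: ac_simps)
    qed
  qed simp
  then show ?thesis by auto
qed

text \<open>The choice is made in terms of \<open>P0 x\<close> and \<open>Pp x\<close> alone, so that the ridge point is independent of
  \<open>Pm x\<close>.\<close>
definition \<phi> where "\<phi> x = (\<lambda>z u. SOME v. Pm v = v \<and> norm v \<le> \<theta> / (1 - \<theta>) * norm u \<and>
  Pm (A (w z + u + v)) = 0) (P0 x) (Pp x)"

lemma \<phi>_cong: "P0 x = P0 y \<Longrightarrow> Pp x = Pp y \<Longrightarrow> \<phi> x = \<phi> y"
  by (simp add: \<phi>_def)

lemma \<phi>:
  assumes "x \<in> D1"
  shows "Pm (\<phi> x) = \<phi> x" "norm (\<phi> x) \<le> \<theta> / (1 - \<theta>) * norm (Pp x)" "Pm (A (base x + \<phi> x)) = 0"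
    and "P0 (\<phi> x) = 0" "Pp (\<phi> x) = 0"
proof -
  show 1: "Pm (\<phi> x) = \<phi> x" and "norm (\<phi> x) \<le> \<theta> / (1 - \<theta>) * norm (Pp x)" "Pm (A (base x + \<phi> x)) = 0"
    using someI_ex[OF ridge_exists[OF assms]] unfolding \<phi>_def base_def by auto
  show "P0 (\<phi> x) = 0" "Pp (\<phi> x) = 0" using 1 P_P by metis+
qed

lemma base_cont: "continuous_on D1 base"
  unfolding base_def[abs_def]
  by (intro continuous_intros continuous_on_compose2[OF w_cont]) (auto simp: D1_def)

text \<open>By monotonicity the distance of \<open>\<phi> y\<close> from \<open>\<phi> x\<close> is controlled by the residual that \<open>\<phi> x\<close> leaves
  in the equation at \<open>y\<close>, and this residual is continuous in \<open>y\<close>.\<close>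
lemma \<phi>_cont: "continuous_on D1 \<phi>"
  unfolding continuous_on_def
proof
  fix x assume x: "x \<in> D1"
  let ?g = "\<lambda>y. Pm (A (base y + \<phi> x))"
  have small: "norm (\<phi> y) < \<eta> / 2" "norm (Pp y) < \<eta> / 2" if "y \<in> D1" for y
    using norm_budget[OF that \<phi>(2)[OF that]] norm_ge_zero[of "Pp y"] norm_ge_zero[of "\<phi> y"] by linarith+
  have in_U: "base y + \<phi> x \<in> U" if "y \<in> D1" for y
    using small[OF that] small[OF x] that by (intro base_in_U) (auto simp: D1_def \<phi>[OF x])
  have "continuous_on D1 ?g"
    by (intro continuous_intros continuous_on_compose2[OF A_cont] base_cont) (use in_U in blast)
  then have lim: "(?g \<longlongrightarrow> ?g x) (at x within D1)" using x by (simp add: continuous_on_def)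
  have "c * norm (\<phi> y - \<phi> x) \<le> norm (?g y)" if y: "y \<in> D1" for y
  proof -
    let ?d = "\<phi> y - \<phi> x"
    have d: "Pm ?d = ?d" "Pp ?d = 0" "P0 ?d = 0"
      using \<phi>[OF x] \<phi>[OF y] by (simp_all add: blinfun.bilinear_simps)
    have eq: "base y + \<phi> x + ?d = base y + \<phi> y" by simp
    have yU: "base y + \<phi> y \<in> U"
      using small[OF y] y by (intro base_in_U) (auto simp: D1_def \<phi>[OF y])
    have "inner (A (base y + \<phi> y)) ?d = inner (Pm (A (base y + \<phi> y))) ?d"
      by (simp add: P_self_adjoint d)
    then have 0: "inner (A (base y + \<phi> y)) ?d = 0" by (simp add: \<phi>[OF y])
    have "c * (norm ?d)\<^sup>2 \<le> inner (A (base y + \<phi> x)) ?d"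
      using gradient_monotone[of "base y + \<phi> x" ?d] in_U[OF y] yU d 0 unfolding eq
      by (simp add: inner_diff_left inner_diff_right)
    also have "\<dots> = inner (?g y) ?d" by (simp add: P_self_adjoint d)
    also have "\<dots> \<le> norm (?g y) * norm ?d" by (rule norm_cauchy_schwarz)
    finally show ?thesis by (rule cancel_norm) simp
  qed
  then show "(\<phi> \<longlongrightarrow> \<phi> x) (at x within D1)"
    by (rule tendsto_if_norm_le[OF _ c_pos]) (use lim \<phi>(3)[OF x] in simp_all)
qed

definition ridge where "ridge x = base x + \<phi> x"

lemma ridge_cong: "P0 x = P0 y \<Longrightarrow> Pp x = Pp y \<Longrightarrow> ridge x = ridge y"
  by (simp add: ridge_def base_def cong: \<phi>_cong)

lemma ridge_cont: "continuous_on D1 ridge"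
  unfolding ridge_def[abs_def] by (intro continuous_intros base_cont \<phi>_cont)

lemma ridge_near:
  assumes "x \<in> D1" "P0 v = 0" "norm v < \<eta> / 2"
  shows "ridge x + v \<in> U"
proof -
  have "norm (Pp x) + norm (\<phi> x + v) < \<eta>"
    using norm_budget[OF assms(1) \<phi>(2)[OF assms(1)]] assms(3) norm_triangle_ineq[of "\<phi> x" v] by linarith
  then show ?thesis using base_in_U[of x "\<phi> x + v"] assms \<phi>[OF assms(1)]
    by (simp add: ridge_def add.assoc D1_def blinfun.bilinear_simps)
qed

lemma ridge_in_U: "x \<in> D1 \<Longrightarrow> ridge x \<in> U"
  using ridge_near[of x 0] \<eta> by (simp add: blinfun.bilinear_simps)

lemma ridge_critical: "x \<in> D1 \<Longrightarrow> Pm v = v \<Longrightarrow> inner (A (ridge x)) v = 0"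
  using P_self_adjoint(2)[of "A (ridge x)" v] \<phi>(3)[of x] by (simp add: ridge_def)

lemma ridge_maximal:
  assumes "x \<in> D1" "base x + v \<in> U" "Pm v = v"
  shows "L (base x + v) \<le> L (ridge x)"
proof -
  let ?e = "v - \<phi> x"
  have e: "Pm ?e = ?e" using assms(3) \<phi>[OF assms(1)] by (simp add: blinfun.bilinear_simps)
  have eq: "ridge x + ?e = base x + v" by (simp add: ridge_def)
  have "L (ridge x + ?e) \<le> L (ridge x) + inner (A (ridge x)) ?e - c / 2 * (norm ?e)\<^sup>2"
    using concave_direction[OF ridge_in_U[OF assms(1)] _ e] assms(2) unfolding eq by blast
  also have "\<dots> = L (ridge x) - c / 2 * (norm ?e)\<^sup>2" using ridge_critical[OF assms(1) e] by simp
  also have "\<dots> \<le> L (ridge x)" using c_pos by simp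
  finally show ?thesis by (simp only: eq)
qed

subsection \<open>Radial growth along and across the ridge\<close>

text \<open>The point over \<open>x + s e\<close> is moved by \<open>(t - s) e\<close> with its negative component \<open>v\<close> kept. The
  convexity in the direction \<open>e\<close> gives the growth up to there, and passing to the ridge only adds to
  it. The slope at the start is bounded by monotonicity between it and the critical point.\<close>
lemma growth_along_ridge:
  assumes x: "P0 x \<in> Z" "Pp x = 0" and e: "Pp e = e" and st: "0 \<le> s" "s \<le> t" "t * norm e < \<eta>1"
  shows "c / 2 * (t\<^sup>2 - s\<^sup>2) * (norm e)\<^sup>2 \<le> L (ridge (x + t *\<^sub>R e)) - L (ridge (x + s *\<^sub>R e))"
proof -
  have e': "P0 e = 0" "Pm e = 0" using e P_P by metis+
  have "s * norm e \<le> t * norm e" using st by (intro mult_right_mono) auto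
  then have inD: "x + t *\<^sub>R e \<in> D1" "x + s *\<^sub>R e \<in> D1"
    using x e e' st by (auto simp: D1_def blinfun.bilinear_simps)
  have PX: "P0 (x + r *\<^sub>R e) = P0 x" "Pp (x + r *\<^sub>R e) = r *\<^sub>R e" for r
    using x e e' by (simp_all add: blinfun.bilinear_simps)
  define q where "q = ridge (x + s *\<^sub>R e)"
  define v where "v = \<phi> (x + s *\<^sub>R e)"
  have v: "Pm v = v" "P0 v = 0" "Pp v = 0" using \<phi>[OF inD(2)] by (simp_all add: v_def)
  have q: "q = w (P0 x) + s *\<^sub>R e + v" by (simp add: q_def v_def ridge_def base_def PX)
  have qU: "q \<in> U" unfolding q_def by (rule ridge_in_U[OF inD(2)])
  have q': "base (x + t *\<^sub>R e) + v = q + (t - s) *\<^sub>R e"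
    by (simp add: base_def PX q algebra_simps)
  have v_small: "norm v < \<eta> / 2" "norm (t *\<^sub>R e) < \<eta> / 2"
    using norm_budget[OF inD(2) \<phi>(2)[OF inD(2)]] norm_budget[OF inD(1) \<phi>(2)[OF inD(1)]] unfolding v_def PX
    by (smt (verit) norm_ge_zero)+
  have q'U: "q + (t - s) *\<^sub>R e \<in> U"
    unfolding q'[symmetric] using inD(1) v v_small by (intro base_in_U) (auto simp: D1_def PX)
  have slope: "c * s * (norm e)\<^sup>2 \<le> inner (A q) e"
  proof (cases "s = 0")
    case True
    then have "v = 0" using \<phi>(2)[OF inD(2)] x(2) by (simp add: v_def PX)
    then show ?thesis using True critical[OF x(1) e'(1)] by (simp add: q)
  next
    case False
    let ?d = "s *\<^sub>R e + v"
    have d: "P0 ?d = 0" "Pp ?d = s *\<^sub>R e" "Pm ?d = v" using e e' v by (simp_all add: blinfun.bilinear_simps)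
    have "c * (norm ?d)\<^sup>2 \<le> inner (A q - A (w (P0 x))) (s *\<^sub>R e - v)"
      using gradient_monotone[OF w_in_U[OF x(1)] _ d(1)] qU d by (simp add: q add.assoc)
    also have "\<dots> = s * inner (A q) e"
      using ridge_critical[OF inD(2) v(1)] critical[OF x(1) e'(1)] critical[OF x(1) v(2)]
      by (simp add: inner_diff_left inner_diff_right q_def)
    finally have "c * (norm ?d)\<^sup>2 \<le> s * inner (A q) e" .
    moreover have "(s * norm e)\<^sup>2 \<le> (norm ?d)\<^sup>2"
      using norm_Pythagoras(1)[OF d(1)] d st(1) by (simp add: power_mult_distrib)
    then have "c * (s * norm e)\<^sup>2 \<le> c * (norm ?d)\<^sup>2" using c_pos by simp
    ultimately have "s * (c * s * (norm e)\<^sup>2) \<le> s * inner (A q) e"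
      by (simp add: power_mult_distrib power2_eq_square ac_simps)
    then show ?thesis using False st(1) by simp
  qed
  have "L q + inner (A q) ((t - s) *\<^sub>R e) + c / 2 * (norm ((t - s) *\<^sub>R e))\<^sup>2 \<le> L (q + (t - s) *\<^sub>R e)"
    by (rule convex_direction[OF qU q'U]) (simp add: e blinfun.bilinear_simps)
  also have "\<dots> \<le> L (ridge (x + t *\<^sub>R e))"
    using ridge_maximal[OF inD(1) _ v(1)] q'U unfolding q' by blast
  finally have "L q + (t - s) * inner (A q) e + c / 2 * (t - s)\<^sup>2 * (norm e)\<^sup>2 \<le> L (ridge (x + t *\<^sub>R e))"
    by (simp add: power_mult_distrib)
  moreover have "(t - s) * (c * s * (norm e)\<^sup>2) \<le> (t - s) * inner (A q) e"
    using slope st by (intro mult_left_mono) auto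
  moreover have "c / 2 * (t\<^sup>2 - s\<^sup>2) * (norm e)\<^sup>2 = (t - s) * (c * s * (norm e)\<^sup>2) + c / 2 * (t - s)\<^sup>2 * (norm e)\<^sup>2"
    by (simp add: power2_eq_square algebra_simps)
  ultimately show ?thesis unfolding q_def by linarith
qed

text \<open>The ridge point is a critical point of \<open>L\<close> in the negative directions, in which \<open>L\<close> is uniformly
  concave.\<close>
lemma growth_across_ridge:
  assumes x: "x \<in> D1" and e: "Pm e = e" and st: "0 \<le> s" "s \<le> t" "t * norm e < \<eta> / 2"
  shows "c / 2 * (t\<^sup>2 - s\<^sup>2) * (norm e)\<^sup>2 \<le> L (ridge x + s *\<^sub>R e) - L (ridge x + t *\<^sub>R e)"
proof -
  have e': "P0 e = 0" "Pp e = 0" using e P_P by metis+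
  have "s * norm e \<le> t * norm e" using st by (intro mult_right_mono) auto
  then have inU: "ridge x + s *\<^sub>R e \<in> U" "ridge x + t *\<^sub>R e \<in> U"
    using x e' st by (auto intro!: ridge_near simp: blinfun.bilinear_simps)
  define q where "q = ridge x + s *\<^sub>R e"
  have q': "ridge x + t *\<^sub>R e = q + (t - s) *\<^sub>R e" by (simp add: q_def algebra_simps)
  have slope: "inner (A q) e \<le> - (c * s * (norm e)\<^sup>2)"
  proof (cases "s = 0")
    case True
    then show ?thesis using ridge_critical[OF x e] by (simp add: q_def)
  next
    case False
    have "c * (norm (s *\<^sub>R e))\<^sup>2 \<le> inner (A q - A (ridge x)) (- (s *\<^sub>R e))"
      using gradient_monotone[OF ridge_in_U[OF x], of "s *\<^sub>R e"] inU(1) e e'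
      by (simp add: q_def blinfun.bilinear_simps)
    also have "\<dots> = s * - inner (A q) e"
      using ridge_critical[OF x e] by (simp add: inner_diff_left)
    finally have "s * (c * s * (norm e)\<^sup>2) \<le> s * - inner (A q) e"
      by (simp add: power_mult_distrib power2_eq_square ac_simps)
    then have "c * s * (norm e)\<^sup>2 \<le> - inner (A q) e"
      by (rule mult_left_le_imp_le) (use False st(1) in simp)
    then show ?thesis by simp
  qed
  have "L (q + (t - s) *\<^sub>R e) \<le> L q + inner (A q) ((t - s) *\<^sub>R e) - c / 2 * (norm ((t - s) *\<^sub>R e))\<^sup>2"
    using inU unfolding q' q_def[symmetric]
    by (intro concave_direction) (simp_all add: e blinfun.bilinear_simps)
  then have "L (q + (t - s) *\<^sub>R e) \<le> L q + (t - s) * inner (A q) e - c / 2 * (t - s)\<^sup>2 * (norm e)\<^sup>2"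
    by (simp add: power_mult_distrib)
  moreover have "(t - s) * inner (A q) e \<le> (t - s) * - (c * s * (norm e)\<^sup>2)"
    using slope st by (intro mult_left_mono) auto
  moreover have "c / 2 * (t\<^sup>2 - s\<^sup>2) * (norm e)\<^sup>2 = (t - s) * (c * s * (norm e)\<^sup>2) + c / 2 * (t - s)\<^sup>2 * (norm e)\<^sup>2"
    by (simp add: power2_eq_square algebra_simps)
  ultimately show ?thesis unfolding q' q_def[symmetric] by linarith
qed


subsection \<open>The normal form\<close>

text \<open>Rescaling along the ridge, then across it, and finally a shear that moves the base points to
  the ridge.\<close>
theorem parametrized_morse_lemma:
  "\<exists>\<delta>>0. \<exists>W \<Phi> \<Psi>. open W \<and> W \<subseteq> U \<and>
     homeomorphism {x. P0 x \<in> Z \<and> norm (Pp x) < \<delta> \<and> norm (Pm x) < \<delta>} W \<Phi> \<Psi> \<and>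
     (\<forall>x. P0 x \<in> Z \<longrightarrow> norm (Pp x) < \<delta> \<longrightarrow> norm (Pm x) < \<delta> \<longrightarrow>
        L (\<Phi> x) = (norm (Pp x))\<^sup>2 - (norm (Pm x))\<^sup>2 + L (w (P0 x)))"
proof -
  \<comment> \<open>The increments of \<open>L\<close> along and across the ridge, to be turned into squared norms.\<close>
  define f1 where "f1 x = L (ridge x) - L (w (P0 x))" for x
  define f2 where "f2 x = L (ridge x) - L (ridge x + Pm x)" for x
  define r where "r = sqrt (c / 2)"
  have r: "r > 0" using c_pos by (simp add: r_def)
  define D2 where "D2 = {x\<in>D1. norm (Pm x) < \<eta> / 2}"
  define E1 where "E1 = {x\<in>{x. P0 x \<in> Z}. norm (Pp x) < r * \<eta>1}"
  define E2 where "E2 = {x\<in>D1. norm (Pm x) < r * (\<eta> / 2)}"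
  have D1_eq: "{x\<in>{x. P0 x \<in> Z}. norm (Pp x) < \<eta>1} = D1" by (auto simp: D1_def)
  have cont_Lw: "continuous_on D1 (\<lambda>x. L (w (P0 x)))"
    by (intro continuous_on_compose2[OF L_cont] continuous_on_compose2[OF w_cont] continuous_intros)
      (auto simp: D1_def w_in_U)
  have cont_Lr: "continuous_on D1 (\<lambda>x. L (ridge x))"
    by (intro continuous_on_compose2[OF L_cont ridge_cont]) (use ridge_in_U in blast)
  have ridge_0: "ridge x = w (P0 x)" if "P0 x \<in> Z" "Pp x = 0" for x
  proof -
    have x: "x \<in> D1" using that \<eta>1 by (simp add: D1_def)
    then have "\<phi> x = 0" using \<phi>(2)[OF x] that(2) by simp
    then show ?thesis using that(2) by (simp add: ridge_def base_def)
  qed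
  have "\<exists>\<psi> \<sigma>. continuous_on D1 \<psi> \<and> continuous_on E1 \<sigma> \<and>
    (\<forall>x\<in>E1. \<sigma> x \<in> D1 \<and> f1 (\<sigma> x) = (norm (Pp x))\<^sup>2 \<and> \<sigma> x - Pp (\<sigma> x) = x - Pp x \<and> \<psi> (\<sigma> x) = x) \<and>
    (\<forall>x\<in>D1. \<psi> x \<in> {x. P0 x \<in> Z} \<and> \<psi> x - Pp (\<psi> x) = x - Pp x \<and> (\<psi> x \<in> E1 \<longrightarrow> \<sigma> (\<psi> x) = x))"
    unfolding E1_def r_def D1_eq[symmetric]
  proof (rule radial_rescaling)
    show "continuous_on {x\<in>{x. P0 x \<in> Z}. norm (Pp x) < \<eta>1} f1"
      unfolding D1_eq f1_def[abs_def] by (intro continuous_intros cont_Lr cont_Lw)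
    show "f1 x = 0" if "x \<in> {x. P0 x \<in> Z}" "Pp x = 0" for x
      using ridge_0 that by (simp add: f1_def)
    show "c / 2 * (t\<^sup>2 - s\<^sup>2) * (norm e)\<^sup>2 \<le> f1 (x + t *\<^sub>R e) - f1 (x + s *\<^sub>R e)"
      if "x \<in> {x. P0 x \<in> Z}" "Pp x = 0" "Pp e = e" "0 \<le> s" "s \<le> t" "t * norm e < \<eta>1" for x e s t
    proof -
      have "P0 e = 0" using that(3) P_P by metis
      then show ?thesis using growth_along_ridge[OF _ that(2-6)] that(1)
        by (simp add: f1_def blinfun.bilinear_simps)
    qed
  qed (use c_pos in \<open>simp_all add: blinfun.bilinear_simps\<close>)
  then obtain \<psi>1 \<sigma>1 where \<psi>1_cont: "continuous_on D1 \<psi>1" and \<sigma>1_cont: "continuous_on E1 \<sigma>1"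
    and \<sigma>1: "\<And>x. x \<in> E1 \<Longrightarrow> \<sigma>1 x \<in> D1 \<and> f1 (\<sigma>1 x) = (norm (Pp x))\<^sup>2 \<and> \<sigma>1 x - Pp (\<sigma>1 x) = x - Pp x \<and> \<psi>1 (\<sigma>1 x) = x"
    and \<psi>1: "\<And>x. x \<in> D1 \<Longrightarrow> P0 (\<psi>1 x) \<in> Z \<and> \<psi>1 x - Pp (\<psi>1 x) = x - Pp x \<and> (\<psi>1 x \<in> E1 \<longrightarrow> \<sigma>1 (\<psi>1 x) = x)"
    by blast
  have "\<exists>\<psi> \<sigma>. continuous_on D2 \<psi> \<and> continuous_on E2 \<sigma> \<and>
    (\<forall>x\<in>E2. \<sigma> x \<in> D2 \<and> f2 (\<sigma> x) = (norm (Pm x))\<^sup>2 \<and> \<sigma> x - Pm (\<sigma> x) = x - Pm x \<and> \<psi> (\<sigma> x) = x) \<and>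
    (\<forall>x\<in>D2. \<psi> x \<in> D1 \<and> \<psi> x - Pm (\<psi> x) = x - Pm x \<and> (\<psi> x \<in> E2 \<longrightarrow> \<sigma> (\<psi> x) = x))"
    unfolding E2_def D2_def r_def
  proof (rule radial_rescaling)
    show "continuous_on {x\<in>D1. norm (Pm x) < \<eta> / 2} f2"
      unfolding f2_def[abs_def]
    proof (intro continuous_on_diff continuous_on_compose2[OF L_cont])
      show "continuous_on {x\<in>D1. norm (Pm x) < \<eta> / 2} ridge"
        by (rule continuous_on_subset[OF ridge_cont]) auto
      then show "continuous_on {x\<in>D1. norm (Pm x) < \<eta> / 2} (\<lambda>x. ridge x + Pm x)"
        by (intro continuous_intros)
    qed (auto intro: ridge_in_U ridge_near)
    show "f2 x = 0" if "x \<in> D1" "Pm x = 0" for x using that by (simp add: f2_def)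
    show "c / 2 * (t\<^sup>2 - s\<^sup>2) * (norm e)\<^sup>2 \<le> f2 (x + t *\<^sub>R e) - f2 (x + s *\<^sub>R e)"
      if "x \<in> D1" "Pm x = 0" "Pm e = e" "0 \<le> s" "s \<le> t" "t * norm e < \<eta> / 2" for x e s t
    proof -
      have "P0 e = 0" "Pp e = 0" using that(3) P_P by metis+
      then have "ridge (x + r *\<^sub>R e) = ridge x" for r
        by (intro ridge_cong) (simp_all add: blinfun.bilinear_simps)
      then show ?thesis using growth_across_ridge[OF that(1,3-6)] that(2,3)
        by (simp add: f2_def blinfun.bilinear_simps)
    qed
  qed (use c_pos in \<open>simp_all add: blinfun.bilinear_simps D1_def\<close>)
  then obtain \<psi>2 \<sigma>2 where \<psi>2_cont: "continuous_on D2 \<psi>2" and \<sigma>2_cont: "continuous_on E2 \<sigma>2"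
    and \<sigma>2: "\<And>x. x \<in> E2 \<Longrightarrow> \<sigma>2 x \<in> D2 \<and> f2 (\<sigma>2 x) = (norm (Pm x))\<^sup>2 \<and> \<sigma>2 x - Pm (\<sigma>2 x) = x - Pm x \<and> \<psi>2 (\<sigma>2 x) = x"
    and \<psi>2: "\<And>x. x \<in> D2 \<Longrightarrow> \<psi>2 x \<in> D1 \<and> \<psi>2 x - Pm (\<psi>2 x) = x - Pm x \<and> (\<psi>2 x \<in> E2 \<longrightarrow> \<sigma>2 (\<psi>2 x) = x)"
    by blast
  have parts_p: "P0 y = P0 x" "Pm y = Pm x" if "y - Pp y = x - Pp x" for x y
    using arg_cong[OF that, of P0] arg_cong[OF that, of Pm] by (simp_all add: blinfun.bilinear_simps)
  have parts_m: "P0 y = P0 x" "Pp y = Pp x" if "y - Pm y = x - Pm x" for x y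
    using arg_cong[OF that, of P0] arg_cong[OF that, of Pp] by (simp_all add: blinfun.bilinear_simps)

  \<comment> \<open>The shear \<open>S\<close> has the inverse \<open>S'\<close> on \<open>D3\<close>; \<open>off x\<close> is the displacement of \<open>x\<close> from the critical
    point of its slice and \<open>p x\<close> the point whose ridge point lies on the same negative fibre.\<close>
  define S where "S x = ridge x + Pm x" for x
  define off where "off x = x - w (P0 x)" for x
  define p where "p x = P0 x + Pp (off x)" for x
  define S' where "S' x = p x + (Pm (off x) - \<phi> (p x))" for x
  define D3' where "D3' = {x. P0 x \<in> Z} \<inter> p -` D1"
  define D3 where "D3 = D3' \<inter> (\<lambda>x. Pm (off x) - \<phi> (p x)) -` ball 0 (\<eta> / 2)"
  have S_cont: "continuous_on D2 S"
    unfolding S_def[abs_def] by (intro continuous_intros continuous_on_subset[OF ridge_cont]) (auto simp: D2_def)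
  have off_cont: "continuous_on {x. P0 x \<in> Z} off"
    unfolding off_def[abs_def] by (intro continuous_intros continuous_on_compose2[OF w_cont]) auto
  have p_cont: "continuous_on {x. P0 x \<in> Z} p"
    unfolding p_def[abs_def] by (intro continuous_intros off_cont)
  have "D1 = {x. P0 x \<in> Z} \<inter> {x. norm (Pp x) < \<eta>1}" by (auto simp: D1_def)
  then have D1_open: "open D1"
    by (simp only:) (intro open_Int Z_open open_Collect_less continuous_intros)
  have D3'_open: "open D3'"
    unfolding D3'_def by (rule continuous_open_preimage[OF p_cont Z_open D1_open])
  have \<phi>p_cont: "continuous_on D3' (\<lambda>x. \<phi> (p x))"
    by (rule continuous_on_compose2[OF \<phi>_cont continuous_on_subset[OF p_cont]]) (auto simp: D3'_def)
  have off_cont': "continuous_on D3' off" and p_cont': "continuous_on D3' p"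
    by (rule continuous_on_subset[OF off_cont], force simp: D3'_def, rule continuous_on_subset[OF p_cont], force simp: D3'_def)
  have D3_open: "open D3"
    unfolding D3_def
    by (rule continuous_open_preimage[OF _ D3'_open open_ball])
      (intro continuous_intros \<phi>p_cont off_cont')
  have "continuous_on D3' S'"
    unfolding S'_def[abs_def] by (intro continuous_intros \<phi>p_cont off_cont' p_cont')
  then have S'_cont: "continuous_on D3 S'" by (rule continuous_on_subset) (auto simp: D3_def)
  have D3D: "p x \<in> D1" "P0 x \<in> Z" "norm (Pm (off x) - \<phi> (p x)) < \<eta> / 2" if "x \<in> D3" for x
    using that by (auto simp: D3_def D3'_def)
  have P_p: "P0 (p x) = P0 x" "Pp (p x) = Pp (off x)" "Pm (p x) = 0" for x
    by (simp_all add: p_def blinfun.bilinear_simps)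
  have P_S': "P0 (S' x) = P0 x" "Pp (S' x) = Pp (off x)" "Pm (S' x) = Pm (off x) - \<phi> (p x)"
    if "x \<in> D3" for x
    using \<phi>[OF D3D(1)[OF that]] by (simp_all add: S'_def P_p blinfun.bilinear_simps)
  have S'_in: "S' x \<in> D2" if "x \<in> D3" for x
    using D3D[OF that] by (simp add: D2_def D1_def P_S'[OF that] P_p)
  have SS': "S (S' x) = x" if "x \<in> D3" for x
  proof -
    have r: "ridge (S' x) = ridge (p x)" by (rule ridge_cong) (simp_all add: P_S'[OF that] P_p)
    have "P0 (off x) = 0" using D3D(2)[OF that] by (simp add: off_def blinfun.bilinear_simps w_P0)
    then have "Pp (off x) + Pm (off x) = off x" by (rule K_sum)
    then show ?thesis
      by (simp add: S_def r P_S'[OF that]) (simp add: ridge_def base_def P_p off_def algebra_simps)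
  qed
  have S_U: "S x \<in> U" if "x \<in> D2" for x
    using that by (auto simp: D2_def S_def intro: ridge_near)
  have off_S: "off (S x) = Pp x + \<phi> x + Pm x" and P0_S: "P0 (S x) = P0 x" if "x \<in> D2" for x
  proof -
    have x: "x \<in> D1" "P0 x \<in> Z" using that by (auto simp: D2_def D1_def)
    show "P0 (S x) = P0 x"
      using \<phi>[OF x(1)] x(2) by (simp add: S_def ridge_def base_def blinfun.bilinear_simps w_P0)
    then show "off (S x) = Pp x + \<phi> x + Pm x" by (simp add: off_def S_def ridge_def base_def)
  qed
  have p_S: "p (S x) = P0 x + Pp x" and Pm_off_S: "Pm (off (S x)) = \<phi> x + Pm x" if "x \<in> D2" for x
    using off_S[OF that] P0_S[OF that] \<phi>[of x] that by (auto simp: p_def D2_def blinfun.bilinear_simps)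
  have \<phi>_p_S: "\<phi> (p (S x)) = \<phi> x" if "x \<in> D2" for x
    by (rule \<phi>_cong) (simp_all add: p_S[OF that] blinfun.bilinear_simps)
  have S'S: "S' (S x) = x" if "x \<in> D2" for x
    using P_sum[of x] \<phi>_p_S[OF that] by (simp add: S'_def p_S[OF that] Pm_off_S[OF that])
  have S_in: "S x \<in> D3" if "x \<in> D2" for x
  proof -
    have "P0 (S x) \<in> Z" "p (S x) \<in> D1"
      using that by (simp_all add: P0_S p_S) (simp_all add: D2_def D1_def blinfun.bilinear_simps)
    moreover have "norm (Pm (off (S x)) - \<phi> (p (S x))) < \<eta> / 2"
      unfolding \<phi>_p_S[OF that] Pm_off_S[OF that] using that by (simp add: D2_def)
    ultimately show ?thesis by (simp add: D3_def D3'_def)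
  qed

  \<comment> \<open>The image of the normal form is described through the inverse \<open>\<Psi>\<close>, which is defined and
    continuous on the open set \<open>D3\<close>; this makes it open.\<close>
  define \<delta> where "\<delta> = min (r * \<eta>1) (r * (\<eta> / 2))"
  define C where "C = {x. P0 x \<in> Z \<and> norm (Pp x) < \<delta> \<and> norm (Pm x) < \<delta>}"
  define \<Phi> where "\<Phi> x = S (\<sigma>2 (\<sigma>1 x))" for x
  define \<Psi> where "\<Psi> x = \<psi>1 (\<psi>2 (S' x))" for x
  define W where "W = D3 \<inter> \<Psi> -` C"
  have \<delta>: "\<delta> > 0" using r \<eta>1 \<eta> by (simp add: \<delta>_def)
  have C_open: "open C"
  proof -
    have "C = {x. P0 x \<in> Z} \<inter> {x. norm (Pp x) < \<delta>} \<inter> {x. norm (Pm x) < \<delta>}" by (auto simp: C_def)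
    then show ?thesis
      by (simp only:) (intro open_Int Z_open open_Collect_less continuous_intros)
  qed
  have CE1: "x \<in> E1" if "x \<in> C" for x using that by (auto simp: C_def E1_def \<delta>_def)
  have \<sigma>1E2: "\<sigma>1 x \<in> E2" if "x \<in> C" for x
    using \<sigma>1[OF CE1[OF that]] parts_p[of "\<sigma>1 x" x] that by (auto simp: E2_def C_def \<delta>_def)
  have \<Psi>_cont: "continuous_on D3 \<Psi>"
    unfolding \<Psi>_def[abs_def]
    by (intro continuous_on_compose2[OF \<psi>1_cont] continuous_on_compose2[OF \<psi>2_cont S'_cont])
      (use S'_in \<psi>2 in blast)+
  have \<Phi>_cont: "continuous_on C \<Phi>"
    unfolding \<Phi>_def[abs_def]
    by (intro continuous_on_compose2[OF S_cont] continuous_on_compose2[OF \<sigma>2_cont] continuous_on_subset[OF \<sigma>1_cont])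
      (use CE1 \<sigma>1E2 \<sigma>2 in blast)+
  have \<Psi>\<Phi>: "\<Psi> (\<Phi> x) = x" and \<Phi>D3: "\<Phi> x \<in> D3" if "x \<in> C" for x
  proof -
    have "\<sigma>2 (\<sigma>1 x) \<in> D2" using \<sigma>2[OF \<sigma>1E2[OF that]] by blast
    then show "\<Phi> x \<in> D3" "\<Psi> (\<Phi> x) = x"
      using \<sigma>1[OF CE1[OF that]] \<sigma>2[OF \<sigma>1E2[OF that]] by (simp_all add: \<Phi>_def \<Psi>_def S_in S'S)
  qed
  have \<Phi>\<Psi>: "\<Phi> (\<Psi> x) = x" if "x \<in> W" for x
  proof -
    have x: "x \<in> D3" "\<Psi> x \<in> C" using that by (auto simp: W_def)
    define y where "y = \<psi>2 (S' x)"
    have y: "y \<in> D1" "y \<in> E2 \<Longrightarrow> \<sigma>2 y = S' x" using \<psi>2[OF S'_in[OF x(1)]] by (auto simp: y_def)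
    have yC: "\<psi>1 y \<in> C" using x(2) by (simp add: y_def \<Psi>_def)
    have "Pm (\<psi>1 y) = Pm y" using \<psi>1[OF y(1)] parts_p by blast
    then have "y \<in> E2" using yC y(1) by (auto simp: C_def E2_def \<delta>_def)
    moreover have "\<sigma>1 (\<psi>1 y) = y" using \<psi>1[OF y(1)] CE1[OF yC] by blast
    ultimately show ?thesis using y(2) SS'[OF x(1)] by (simp add: \<Phi>_def \<Psi>_def flip: y_def)
  qed
  have "homeomorphism C W \<Phi> \<Psi>"
  proof (rule homeomorphismI)
    show "continuous_on W \<Psi>" by (rule continuous_on_subset[OF \<Psi>_cont]) (auto simp: W_def)
    show "\<Phi> ` C \<subseteq> W" using \<Phi>D3 \<Psi>\<Phi> by (auto simp: W_def)
    show "\<Psi> ` W \<subseteq> C" by (auto simp: W_def)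
  qed (use \<Phi>_cont \<Psi>\<Phi> \<Phi>\<Psi> in auto)
  moreover have "open W" unfolding W_def by (rule continuous_open_preimage[OF \<Psi>_cont D3_open C_open])
  moreover have "W \<subseteq> U"
  proof
    fix x assume "x \<in> W"
    then have "x \<in> D3" by (simp add: W_def)
    then show "x \<in> U" using S_U[OF S'_in] SS' by metis
  qed
  moreover have "L (\<Phi> x) = (norm (Pp x))\<^sup>2 - (norm (Pm x))\<^sup>2 + L (w (P0 x))" if "x \<in> C" for x
  proof -
    let ?y = "\<sigma>1 x" and ?y2 = "\<sigma>2 (\<sigma>1 x)"
    have y: "f1 ?y = (norm (Pp x))\<^sup>2" "P0 ?y = P0 x" "Pm ?y = Pm x"
      using \<sigma>1[OF CE1[OF that]] parts_p by blast+
    have y2: "f2 ?y2 = (norm (Pm ?y))\<^sup>2" "P0 ?y2 = P0 ?y" "Pp ?y2 = Pp ?y"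
      using \<sigma>2[OF \<sigma>1E2[OF that]] parts_m by blast+
    have "ridge ?y2 = ridge ?y" by (rule ridge_cong[OF y2(2,3)])
    then show ?thesis using y(1) y2(1) by (simp add: \<Phi>_def S_def f1_def f2_def y)
  qed
  ultimately show ?thesis using \<delta> unfolding C_def by blast
qed

end

section \<open>Reduction to the kernel near infinity\<close>

text \<open>The function \<open>rad\<close> is an a priori bound for the solution on each slice; the margin \<open>\<eta>\<close>, uniform in
  the slice, leaves room around the solution inside the ball of radius \<open>\<rho>\<close> where the bound on \<open>B\<close>
  holds. For infinite \<open>\<rho>\<close> the bound may vary without restriction with the slice.\<close>
locale splitting_at_infinity = hilbert_splitting +
  fixes V :: "'a::{real_inner, complete_space} set" and L :: "'a \<Rightarrow> real" and A :: "'a \<Rightarrow> 'a"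
    and B :: "'a \<Rightarrow> 'a \<Rightarrow>\<^sub>L 'a" and R \<theta> \<eta> :: real and \<rho> :: ereal and rad :: "'a \<Rightarrow> real"
  assumes \<theta>: "0 \<le> \<theta>" "\<theta> < 1" and \<eta>: "\<eta> > 0"
    and V: "open V" "\<And>x. norm x > R \<Longrightarrow> x \<in> V"
    and grad: "\<And>x. x \<in> V \<Longrightarrow> GDERIV L x :> A x"
    and A_cont: "continuous_on V A"
    and A_dir: "\<And>x u. x \<in> V \<Longrightarrow> ((\<lambda>t. (A (x + t *\<^sub>R u) - A x) /\<^sub>R t) \<longlongrightarrow> B x u) (at 0)"
    and B_near: "\<And>z y u k. P0 z = z \<Longrightarrow> norm z > R \<Longrightarrow> P0 y = 0 \<Longrightarrow> ereal (norm y) < \<rho> \<Longrightarrow>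
      P0 u = 0 \<Longrightarrow> P0 k = 0 \<Longrightarrow> \<bar>inner (B (z + y) u - T u) k\<bar> \<le> \<theta> * a * norm u * norm k"
    and rad: "\<And>z. P0 z = z \<Longrightarrow> norm z > R \<Longrightarrow>
      0 \<le> rad z \<and> ereal (rad z + \<eta>) \<le> \<rho> \<and> norm (A z - P0 (A z)) \<le> (1 - \<theta>) * a * rad z"
begin

definition Z where "Z = {z. P0 z = z \<and> norm z > R}"

definition c where "c = (1 - \<theta>) * a"

lemma c_pos: "c > 0" using \<theta> a by (simp add: c_def)

lemma Z_iff: "P0 x \<in> Z \<longleftrightarrow> norm (P0 x) > R" by (simp add: Z_def)

lemma inner_kernel: "P0 z = z \<Longrightarrow> P0 y = 0 \<Longrightarrow> inner z y = 0"
proof -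
  assume z: "P0 z = z" and y: "P0 y = 0"
  have "inner (P0 z) (Pp y + Pm y) = 0" by (simp add: inner_add_right orth)
  then show "inner z y = 0" by (simp only: z K_sum[OF y])
qed

lemma norm_kernel_le: "P0 z = z \<Longrightarrow> P0 y = 0 \<Longrightarrow> norm z \<le> norm (z + y)"
proof -
  assume "P0 z = z" "P0 y = 0"
  then have "(norm (z + y))\<^sup>2 = (norm z)\<^sup>2 + (norm y)\<^sup>2"
    using norm_add_Pythagorean[of z y] inner_kernel by (simp add: orthogonal_def)
  then show ?thesis by (auto intro: power2_le_imp_le[OF _ norm_ge_zero])
qed

lemma inner_residual:
  assumes "P0 k = 0"
  shows "inner (x - P0 x) k = inner x k"
  using inner_kernel[of "P0 x" k] assms by (simp add: inner_diff_left)

lemma in_V: "z \<in> Z \<Longrightarrow> P0 y = 0 \<Longrightarrow> z + y \<in> V"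
  using norm_kernel_le[of z y] V(2)[of "z + y"] by (simp add: Z_def)

text \<open>The mean value theorem for the real function \<open>G\<close>; directional differentiability of \<open>A\<close> suffices,
  because only one segment is involved.\<close>
lemma A_near_T:
  assumes z: "z \<in> Z" and x: "P0 x = 0" "ereal (norm x) < \<rho>" and y: "P0 y = 0" "ereal (norm y) < \<rho>"
    and k: "P0 k = 0"
  shows "\<bar>inner (A (z + x) - A (z + y) - T (x - y)) k\<bar> \<le> \<theta> * a * norm (x - y) * norm k"
proof -
  define d where "d = x - y"
  define p where "p t = y + t *\<^sub>R d" for t
  define G where "G t = inner (A (z + p t) - t *\<^sub>R T d) k" for t
  have P0d: "P0 d = 0" using x y by (simp add: d_def blinfun.bilinear_simps)
  have P0p: "P0 (p t) = 0" for t using P0d y by (simp add: p_def blinfun.bilinear_simps)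
  have G: "(G has_real_derivative inner (B (z + p t) d - T d) k) (at t)" for t
    unfolding DERIV_def
  proof (rule Lim_transform_eventually)
    let ?x = "z + p t"
    show "((\<lambda>h. inner ((A (?x + h *\<^sub>R d) - A ?x) /\<^sub>R h - T d) k) \<longlongrightarrow> inner (B ?x d - T d) k) (at 0)"
      by (intro tendsto_intros A_dir in_V z P0p)
    have "inner ((A (?x + h *\<^sub>R d) - A ?x) /\<^sub>R h - T d) k = (G (t + h) - G t) / h" if "h \<noteq> 0" for h
    proof -
      have "p (t + h) = p t + h *\<^sub>R d" by (simp add: p_def algebra_simps)
      then show ?thesis using that
        by (simp add: G_def inner_diff_left inner_add_left scaleR_add_left add.assoc) (simp add: field_simps)
    qed
    then show "\<forall>\<^sub>F h in at 0. inner ((A (?x + h *\<^sub>R d) - A ?x) /\<^sub>R h - T d) k = (G (t + h) - G t) / h"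
      by (simp add: eventually_at_filter)
  qed
  have "\<exists>t. 0 < t \<and> t < 1 \<and> G 1 - G 0 = (1 - 0) * inner (B (z + p t) d - T d) k"
    by (rule MVT2) (use G in auto)
  then obtain t where t: "0 < t" "t < 1" "G 1 - G 0 = inner (B (z + p t) d - T d) k" by auto
  have "norm (p t) \<le> max (norm x) (norm y)"
  proof -
    have "p t = (1 - t) *\<^sub>R y + t *\<^sub>R x" by (simp add: p_def d_def algebra_simps)
    then have "norm (p t) \<le> (1 - t) * norm y + t * norm x"
      using norm_triangle_ineq[of "(1 - t) *\<^sub>R y" "t *\<^sub>R x"] t by simp
    also have "\<dots> \<le> (1 - t) * max (norm x) (norm y) + t * max (norm x) (norm y)"
      using t by (intro add_mono mult_left_mono) auto
    finally show ?thesis by (simp add: algebra_simps)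
  qed
  then have "ereal (norm (p t)) \<le> max (ereal (norm x)) (ereal (norm y))"
    by (simp add: max_def split: if_splits)
  also have "\<dots> < \<rho>" using x y by simp
  finally have "\<bar>inner (B (z + p t) d - T d) k\<bar> \<le> \<theta> * a * norm d * norm k"
    using z by (intro B_near P0p P0d k) (auto simp: Z_def)
  moreover have "G 1 - G 0 = inner (A (z + x) - A (z + y) - T (x - y)) k"
    by (simp add: G_def p_def d_def inner_diff_left)
  ultimately show ?thesis using t(3) by (simp add: d_def)
qed

lemma monotone_open:
  assumes z: "z \<in> Z" and x: "P0 x = 0" "ereal (norm x) < \<rho>" and y: "P0 y = 0" "ereal (norm y) < \<rho>"
  shows "c * (norm (x - y))\<^sup>2 \<le> inner (A (z + x) - A (z + y)) (Pp (x - y) - Pm (x - y))"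
proof -
  let ?d = "x - y"
  have d: "P0 ?d = 0" using x y by (simp add: blinfun.bilinear_simps)
  have "\<bar>inner (A (z + x) - A (z + y) - T ?d) (Pp ?d - Pm ?d)\<bar> \<le> \<theta> * a * norm ?d * norm (Pp ?d - Pm ?d)"
    by (intro A_near_T z x y) (simp add: blinfun.bilinear_simps)
  then have "\<bar>inner (A (z + x) - A (z + y) - T ?d) (Pp ?d - Pm ?d)\<bar> \<le> \<theta> * a * (norm ?d)\<^sup>2"
    unfolding norm_Pythagoras(2)[OF d] by (simp add: power2_eq_square ac_simps)
  then show ?thesis using T_definite[OF d]
    by (simp add: inner_diff_left c_def algebra_simps abs_le_iff)
qed

text \<open>Shrinking both points towards the centre extends the estimate to the closed ball.\<close>
lemma monotone_closed:
  assumes z: "z \<in> Z" and x: "P0 x = 0" "ereal (norm x) \<le> \<rho>" and y: "P0 y = 0" "ereal (norm y) \<le> \<rho>"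
  shows "c * (norm (x - y))\<^sup>2 \<le> inner (A (z + x) - A (z + y)) (Pp (x - y) - Pm (x - y))"
proof -
  have \<rho>: "0 < \<rho>"
  proof -
    have "0 \<le> rad z" "ereal (rad z + \<eta>) \<le> \<rho>" using rad[of z] z by (auto simp: Z_def)
    then have "0 < ereal (rad z + \<eta>)" using \<eta> by simp
    then show ?thesis using \<open>ereal (rad z + \<eta>) \<le> \<rho>\<close> by (rule less_le_trans)
  qed
  have shrink: "ereal (norm (t *\<^sub>R v)) < \<rho>" if "0 < t" "t < 1" "ereal (norm v) \<le> \<rho>" for t v
  proof (cases "v = 0")
    case False
    then have "norm (t *\<^sub>R v) < norm v" using that by simp
    then have "ereal (norm (t *\<^sub>R v)) < ereal (norm v)" by simp
    then show ?thesis using that(3) by (rule less_le_trans)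
  qed (use \<rho> in \<open>simp add: zero_ereal_def\<close>)
  let ?l = "\<lambda>t. c * (norm (t *\<^sub>R x - t *\<^sub>R y))\<^sup>2"
  let ?r = "\<lambda>t. inner (A (z + t *\<^sub>R x) - A (z + t *\<^sub>R y)) (Pp (t *\<^sub>R x - t *\<^sub>R y) - Pm (t *\<^sub>R x - t *\<^sub>R y))"
  have A_lim: "((\<lambda>t. A (z + t *\<^sub>R v)) \<longlongrightarrow> A (z + 1 *\<^sub>R v)) (at_left 1)" if "P0 v = 0" for v
  proof (rule isCont_tendsto_compose[of _ A])
    show "isCont A (z + 1 *\<^sub>R v)"
      using A_cont V(1) in_V[OF z that] by (simp add: continuous_on_eq_continuous_at)
  qed (intro tendsto_intros)
  have "(?l \<longlongrightarrow> ?l 1) (at_left 1)" "(?r \<longlongrightarrow> ?r 1) (at_left 1)"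
    by (intro tendsto_intros A_lim x y)+
  moreover have "\<forall>\<^sub>F t in at_left 1. ?l t \<le> ?r t"
  proof -
    have "\<forall>\<^sub>F t in at_left (1::real). t \<in> {0<..<1}" by (rule eventually_at_leftI[of 0]) auto
    then show ?thesis
    proof eventually_elim
      case (elim t)
      then show ?case using x y shrink
        by (intro monotone_open z) (auto simp: blinfun.bilinear_simps)
    qed
  qed
  ultimately have "?l 1 \<le> ?r 1" by (intro tendsto_le[of "at_left (1::real)"]) auto
  then show ?thesis by simp
qed

text \<open>A point is as close to the zero as its residual is small: this yields uniqueness of \<open>h\<close> and,
  with the zero at a neighbouring slice as the other point, its continuity.\<close>
lemma zero_estimate:
  assumes z: "z \<in> Z" and x: "P0 x = 0" "ereal (norm x) \<le> \<rho>" and y: "P0 y = 0" "ereal (norm y) \<le> \<rho>"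
    and zero: "A (z + x) - P0 (A (z + x)) = 0"
  shows "c * norm (x - y) \<le> norm (A (z + y) - P0 (A (z + y)))"
proof -
  let ?k = "Pp (x - y) - Pm (x - y)" and ?Q = "A (z + y) - P0 (A (z + y))"
  have d: "P0 (x - y) = 0" using x y by (simp add: blinfun.bilinear_simps)
  have k: "P0 ?k = 0" by (simp add: blinfun.bilinear_simps)
  have "inner (A (z + x)) ?k = 0" using inner_residual[OF k, of "A (z + x)"] zero by simp
  then have "c * (norm (x - y))\<^sup>2 \<le> - inner (A (z + y)) ?k"
    using monotone_closed[OF z x y] by (simp add: inner_diff_left)
  also have "\<dots> = inner ?Q (- ?k)" by (simp only: inner_residual[OF k] inner_minus_right)
  also have "\<dots> \<le> norm ?Q * norm (- ?k)" by (rule norm_cauchy_schwarz)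
  also have "norm (- ?k) = norm (x - y)" unfolding norm_minus_cancel by (rule norm_Pythagoras(2)[OF d])
  finally show ?thesis by (rule cancel_norm) simp
qed

lemma h_exists:
  assumes z: "z \<in> Z"
  shows "\<exists>y. P0 y = 0 \<and> norm y \<le> rad z \<and> A (z + y) - P0 (A (z + y)) = 0"
proof -
  let ?K = "{y. P0 y = 0}"
  have r: "0 \<le> rad z" "ereal (rad z + \<eta>) \<le> \<rho>" "norm (A z - P0 (A z)) \<le> (1 - \<theta>) * a * rad z"
    using rad[of z] z by (auto simp: Z_def)
  have lt: "ereal (norm y) < \<rho>" if "norm y \<le> rad z" for y
  proof -
    have "ereal (norm y) < ereal (rad z + \<eta>)" using that \<eta> by simp
    then show ?thesis using r(2) by (rule less_le_trans)
  qed
  have "\<exists>y\<in>?K. norm y \<le> rad z \<and> A (z + y) - P0 (A (z + y)) = 0"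
  proof (rule perturbed_zero_exists[OF subspace_K onto_K _ a \<theta> r(1)])
    show "a * norm y \<le> norm (T y)" if "y \<in> ?K" for y using that T_below by simp
    show "norm (A (z + x) - P0 (A (z + x)) - (A (z + y) - P0 (A (z + y))) - T (x - y)) \<le> \<theta> * a * norm (x - y)"
      if "x \<in> ?K" "y \<in> ?K" "norm x \<le> rad z" "norm y \<le> rad z" for x y
    proof -
      have xy: "P0 x = 0" "P0 y = 0" "P0 (x - y) = 0" using that by (auto simp: blinfun.bilinear_simps)
      let ?y = "A (z + x) - A (z + y) - T (x - y)"
      let ?d = "?y - P0 ?y"
      have eq: "A (z + x) - P0 (A (z + x)) - (A (z + y) - P0 (A (z + y))) - T (x - y) = ?d"
        using T_P0[OF xy(3)] by (simp add: blinfun.diff_right)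
      have d: "P0 ?d = 0" by (simp add: blinfun.diff_right)
      have "(norm ?d)\<^sup>2 = inner ?y ?d" using inner_residual[OF d, of ?y] by (simp add: power2_norm_eq_inner)
      also have "\<dots> \<le> \<theta> * a * norm (x - y) * norm ?d"
        using A_near_T[OF z xy(1) lt[OF that(3)] xy(2) lt[OF that(4)] d] by simp
      finally show ?thesis unfolding eq using \<theta> a cancel_norm[of 1 ?d] by simp
    qed
    show "norm (A (z + 0) - P0 (A (z + 0))) \<le> (1 - \<theta>) * a * rad z" using r(3) by simp
  qed (simp add: blinfun.bilinear_simps)
  then show ?thesis by auto
qed

definition h where "h z = (SOME y. P0 y = 0 \<and> norm y \<le> rad z \<and> A (z + y) - P0 (A (z + y)) = 0)"

lemma h:
  assumes "z \<in> Z"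
  shows "P0 (h z) = 0" "norm (h z) \<le> rad z" "A (z + h z) - P0 (A (z + h z)) = 0"
  using someI_ex[OF h_exists[OF assms]] unfolding h_def by auto

lemma h_rad: "z \<in> Z \<Longrightarrow> ereal (norm (h z) + \<eta>) \<le> \<rho>"
  using h(2)[of z] rad[of z] by (auto simp: Z_def intro: order_trans[of _ "ereal (rad z + \<eta>)"])

lemma h_lt: "z \<in> Z \<Longrightarrow> ereal (norm (h z)) < \<rho>"
  using h_rad[of z] \<eta> by (auto intro: less_le_trans[of _ "ereal (norm (h z) + \<eta>)"])

lemma h_unique:
  assumes "z \<in> Z" "P0 y = 0" "ereal (norm y) \<le> \<rho>" "A (z + y) - P0 (A (z + y)) = 0"
  shows "y = h z"
  using zero_estimate[OF assms(1) h(1)[OF assms(1)] less_imp_le[OF h_lt[OF assms(1)]] assms(2,3) h(3)[OF assms(1)]]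
    assms(4) c_pos by (simp add: mult_le_0_iff)

lemma critical: "z \<in> Z \<Longrightarrow> P0 k = 0 \<Longrightarrow> inner (A (z + h z)) k = 0"
  using inner_residual[of k "A (z + h z)"] h(3)[of z] by simp

lemma h_cont: "continuous_on Z h"
  unfolding continuous_on_def
proof
  fix z assume z: "z \<in> Z"
  let ?g = "\<lambda>y. A (y + h z) - P0 (A (y + h z))"
  have "continuous_on Z ?g"
    by (intro continuous_intros continuous_on_compose2[OF A_cont]) (use in_V h[OF z] in auto)
  then have lim: "(?g \<longlongrightarrow> ?g z) (at z within Z)" using z by (simp add: continuous_on_def)
  have "c * norm (h y - h z) \<le> norm (?g y)" if y: "y \<in> Z" for y
    by (rule zero_estimate[OF y h(1)[OF y] less_imp_le[OF h_lt[OF y]] h(1)[OF z] less_imp_le[OF h_lt[OF z]] h(3)[OF y]])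
  then show "(h \<longlongrightarrow> h z) (at z within Z)"
    by (rule tendsto_if_norm_le[OF _ c_pos]) (use lim h(3)[OF z] in simp_all)
qed

definition U where "U = {x. P0 x \<in> Z \<and> norm (x - (P0 x + h (P0 x))) < \<eta>}"

lemma U_slice:
  assumes "x \<in> U"
  shows "P0 x \<in> Z" "P0 (x - P0 x) = 0" "ereal (norm (x - P0 x)) < \<rho>" "x \<in> V"
proof -
  show z: "P0 x \<in> Z" using assms by (simp add: U_def)
  show p: "P0 (x - P0 x) = 0" by (simp add: blinfun.bilinear_simps)
  have "norm (x - P0 x) \<le> norm (h (P0 x)) + norm (x - (P0 x + h (P0 x)))"
    using norm_triangle_sub[of "x - P0 x" "h (P0 x)"] by (simp add: diff_diff_eq)
  then have "ereal (norm (x - P0 x)) < ereal (norm (h (P0 x)) + \<eta>)" using assms by (simp add: U_def)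
  then show "ereal (norm (x - P0 x)) < \<rho>" using h_rad[OF z] by (rule less_le_trans)
  show "x \<in> V" using in_V[OF z p] by simp
qed

sublocale saddle: saddle_family T P0 Pp Pm a Z U "\<lambda>z. z + h z" A L \<theta> \<eta>
proof
  have "{x. P0 x \<in> Z} = {x. R < norm (P0 x)}" by (simp add: Z_iff)
  also have "open \<dots>" by (intro open_Collect_less continuous_intros)
  finally show "open {x. P0 x \<in> Z}" .
  show "continuous_on Z (\<lambda>z. z + h z)" by (intro continuous_intros h_cont)
  show "P0 (z + h z) = z" if "z \<in> Z" for z using that h(1)[OF that] by (simp add: Z_def blinfun.bilinear_simps)
  show "continuous_on U A" by (rule continuous_on_subset[OF A_cont]) (use U_slice in blast)
  show "\<bar>inner (A x - A y - T (x - y)) k\<bar> \<le> \<theta> * a * norm (x - y) * norm k"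
    if "x \<in> U" "y \<in> U" "P0 x = P0 y" "P0 k = 0" for x y k
    using A_near_T[OF U_slice(1)[OF that(1)] U_slice(2,3)[OF that(1)] _ _ that(4), of "y - P0 x"]
      U_slice(2,3)[OF that(2)] that(3) by simp
  show "U = {x. P0 x \<in> Z \<and> norm (x - (P0 x + h (P0 x))) < \<eta>}" by (rule U_def)
  show "GDERIV L x :> A x" if "x \<in> U" for x by (rule grad[OF U_slice(4)[OF that]])
qed (fact \<theta> \<eta> critical)+

subsection \<open>Smooth dependence\<close>

text \<open>At the solutions the operators \<open>B\<close> inherit the lower bound of \<open>T\<close>, tested against the reflected
  vector. The bound is uniform in the slice.\<close>
lemma B_definite:
  assumes z: "z \<in> Z" and u: "P0 u = 0"
  shows "c * (norm u)\<^sup>2 \<le> inner (B (z + h z) u) (Pp u - Pm u)"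
proof -
  have "\<bar>inner (B (z + h z) u - T u) (Pp u - Pm u)\<bar> \<le> \<theta> * a * norm u * norm (Pp u - Pm u)"
    using z h[OF z] h_lt[OF z] by (intro B_near u) (auto simp: Z_def blinfun.bilinear_simps)
  then have "\<bar>inner (B (z + h z) u - T u) (Pp u - Pm u)\<bar> \<le> \<theta> * a * (norm u)\<^sup>2"
    unfolding norm_Pythagoras(2)[OF u] by (simp add: power2_eq_square ac_simps)
  then show ?thesis using T_definite[OF u]
    by (simp add: inner_diff_left c_def algebra_simps abs_le_iff)
qed

lemma B_estimate:
  assumes z: "z \<in> Z" and u: "P0 u = 0"
    and y: "\<And>k. P0 k = 0 \<Longrightarrow> inner (B (z + h z) u) k = inner y k"
  shows "c * norm u \<le> norm y"
proof -
  have "P0 (Pp u - Pm u) = 0" by (simp add: blinfun.bilinear_simps)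
  then have "c * (norm u)\<^sup>2 \<le> inner y (Pp u - Pm u)" using B_definite[OF z u] y by simp
  also have "\<dots> \<le> norm y * norm (Pp u - Pm u)" by (rule norm_cauchy_schwarz)
  finally show ?thesis unfolding norm_Pythagoras(2)[OF u] by (rule cancel_norm) simp
qed

lemma linearized_exists:
  assumes z: "z \<in> Z"
  shows "\<exists>y. P0 y = 0 \<and> (\<forall>k. P0 k = 0 \<longrightarrow> inner (B (z + h z) (P0 u + y)) k = 0)"
proof -
  let ?K = "{y. P0 y = 0}" and ?B = "B (z + h z)"
  define N where "N y = ?B (P0 u + y) - P0 (?B (P0 u + y))" for y
  have "\<exists>y\<in>?K. norm y \<le> norm (N 0) / c \<and> N y = 0"
  proof (rule perturbed_zero_exists[OF subspace_K onto_K _ a \<theta>])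
    show "a * norm y \<le> norm (T y)" if "y \<in> ?K" for y using that T_below by simp
    show "N y \<in> ?K" for y by (simp add: N_def blinfun.bilinear_simps)
    show "norm (N 0) \<le> (1 - \<theta>) * a * (norm (N 0) / c)" using c_pos by (simp flip: c_def)
    show "norm (N x - N y - T (x - y)) \<le> \<theta> * a * norm (x - y)" if "x \<in> ?K" "y \<in> ?K" for x y
    proof -
      let ?v = "x - y"
      have v: "P0 ?v = 0" using that by (simp add: blinfun.bilinear_simps)
      let ?y = "?B ?v - T ?v"
      let ?d = "?y - P0 ?y"
      have eq: "N x - N y - T ?v = ?d"
        using T_P0[OF v] by (simp add: N_def blinfun.bilinear_simps)
      have d: "P0 ?d = 0" by (simp add: blinfun.diff_right)
      have "(norm ?d)\<^sup>2 = inner ?y ?d" using inner_residual[OF d, of ?y] by (simp add: power2_norm_eq_inner)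
      also have "\<dots> \<le> \<bar>inner ?y ?d\<bar>" by simp
      also have "\<dots> \<le> \<theta> * a * norm ?v * norm ?d"
        using z h[OF z] h_lt[OF z] by (intro B_near v d) (auto simp: Z_def)
      finally show ?thesis unfolding eq using \<theta> a cancel_norm[of 1 ?d] by simp
    qed
  qed (use c_pos in simp)
  then obtain y where y: "P0 y = 0" "N y = 0" by auto
  then show ?thesis using inner_residual[of _ "?B (P0 u + y)"] by (intro exI[of _ y]) (auto simp: N_def)
qed

text \<open>The derivative of \<open>h\<close> in the direction \<open>P0 u\<close>, as the solution of the equation that results from
  differentiating \<open>(1 - P0) A (z + h z) = 0\<close>.\<close>
definition lin where "lin z u = (SOME y. P0 y = 0 \<and> (\<forall>k. P0 k = 0 \<longrightarrow> inner (B (z + h z) (P0 u + y)) k = 0))"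

lemma lin:
  assumes "z \<in> Z"
  shows "P0 (lin z u) = 0" "P0 k = 0 \<Longrightarrow> inner (B (z + h z) (P0 u + lin z u)) k = 0"
  using someI_ex[OF linearized_exists[OF assms, of u]] unfolding lin_def by auto

lemma lin_unique:
  assumes z: "z \<in> Z" and y: "P0 y = 0" "\<And>k. P0 k = 0 \<Longrightarrow> inner (B (z + h z) (P0 u + y)) k = 0"
  shows "lin z u = y"
proof -
  have "c * norm (lin z u - y) \<le> norm (0::'a)"
  proof (rule B_estimate[OF z])
    show "P0 (lin z u - y) = 0" using lin(1)[OF z] y(1) by (simp add: blinfun.diff_right)
    show "inner (B (z + h z) (lin z u - y)) k = inner 0 k" if "P0 k = 0" for k
      using lin(2)[OF z that, of u] y(2)[OF that]
      by (simp add: blinfun.diff_right blinfun.add_right inner_diff_left inner_add_left)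
  qed
  then show ?thesis using c_pos by (simp add: mult_le_0_iff)
qed

lemma norm_P0_le: "norm (P0 x) \<le> norm x"
  using norm_kernel_le[of "P0 x" "x - P0 x"] by (simp add: blinfun.bilinear_simps)

lemma bounded_linear_lin:
  assumes z: "z \<in> Z"
  shows "bounded_linear (lin z)"
proof (rule bounded_linear_intro[where K = "norm (B (z + h z)) / c"])
  note l = lin[OF z]
  show "lin z (x + y) = lin z x + lin z y" for x y
  proof (rule lin_unique[OF z])
    fix k assume k: "P0 k = 0"
    show "inner (B (z + h z) (P0 (x + y) + (lin z x + lin z y))) k = 0"
      using l(2)[OF k, of x] l(2)[OF k, of y] by (simp add: blinfun.bilinear_simps inner_add_left)
  qed (simp add: l blinfun.bilinear_simps)
  show "lin z (r *\<^sub>R x) = r *\<^sub>R lin z x" for r x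
  proof (rule lin_unique[OF z])
    fix k assume k: "P0 k = 0"
    have "r * inner (B (z + h z) (P0 x + lin z x)) k = 0" using l(2)[OF k, of x] by simp
    then show "inner (B (z + h z) (P0 (r *\<^sub>R x) + r *\<^sub>R lin z x)) k = 0"
      by (simp add: blinfun.bilinear_simps inner_add_left distrib_left)
  qed (simp add: l blinfun.bilinear_simps)
  show "norm (lin z x) \<le> norm x * (norm (B (z + h z)) / c)" for x
  proof -
    have "c * norm (lin z x) \<le> norm (- B (z + h z) (P0 x))"
    proof (rule B_estimate[OF z l(1)])
      fix k assume k: "P0 k = 0"
      show "inner (B (z + h z) (lin z x)) k = inner (- B (z + h z) (P0 x)) k"
        using l(2)[OF k, of x] by (simp add: blinfun.bilinear_simps inner_add_left)
    qed
    also have "\<dots> \<le> norm (B (z + h z)) * norm (P0 x)" by (simp add: norm_blinfun)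
    also have "\<dots> \<le> norm (B (z + h z)) * norm x" by (intro mult_left_mono norm_P0_le) auto
    finally show ?thesis using c_pos by (simp add: pos_le_divide_eq ac_simps)
  qed
qed

definition D :: "'a \<Rightarrow> 'a \<Rightarrow>\<^sub>L 'a" where "D z = Blinfun (lin z)"

lemma D_apply: "z \<in> Z \<Longrightarrow> D z u = lin z u"
  by (simp add: D_def bounded_linear_Blinfun_apply bounded_linear_lin)

text \<open>The difference of the solutions at \<open>y\<close> and \<open>z\<close> solves the linearized equation at \<open>y\<close> whose
  right-hand side is the difference of the operators applied to a vector independent of \<open>y\<close>.\<close>
lemma D_cont:
  assumes B_cont: "continuous_on V B"
  shows "continuous_on Z D"
  unfolding continuous_on_def
proof
  fix z assume z: "z \<in> Z"
  let ?w = "\<lambda>z. z + h z"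
  have "continuous_on Z (\<lambda>z. B (?w z))"
    by (intro continuous_on_compose2[OF B_cont] continuous_intros h_cont) (use in_V h in auto)
  then have lim: "((\<lambda>z. B (?w z)) \<longlongrightarrow> B (?w z)) (at z within Z)" using z by (simp add: continuous_on_def)
  let ?g = "\<lambda>y. norm (B (?w y) - B (?w z)) * (1 + norm (D z))"
  have "norm (D y - D z) \<le> ?g y / c" if y: "y \<in> Z" for y
  proof (rule norm_blinfun_bound)
    fix u
    let ?d = "(D y - D z) u" and ?v = "P0 u + D z u"
    have d: "?d = lin y u - lin z u" by (simp add: blinfun.bilinear_simps D_apply y z)
    have "c * norm ?d \<le> norm (- (B (?w y) - B (?w z)) ?v)"
    proof (rule B_estimate[OF y])
      show "P0 ?d = 0" unfolding d by (simp add: blinfun.diff_right lin(1)[OF y] lin(1)[OF z])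
      fix k assume k: "P0 k = 0"
      have "inner (B (?w y) (P0 u + lin y u)) k = 0" "inner (B (?w z) (P0 u + lin z u)) k = 0"
        using lin(2)[OF y k] lin(2)[OF z k] by auto
      then show "inner (B (?w y) ?d) k = inner (- (B (?w y) - B (?w z)) ?v) k"
        unfolding d D_apply[OF z] by (simp add: blinfun.bilinear_simps inner_add_left inner_diff_left)
    qed
    also have "\<dots> \<le> norm (B (?w y) - B (?w z)) * norm ?v"
      unfolding norm_minus_cancel by (rule norm_blinfun)
    also have "\<dots> \<le> norm (B (?w y) - B (?w z)) * ((1 + norm (D z)) * norm u)"
    proof (rule mult_left_mono)
      have "norm ?v \<le> norm (P0 u) + norm (D z u)" by (rule norm_triangle_ineq)
      also have "\<dots> \<le> norm u + norm (D z) * norm u" by (intro add_mono norm_P0_le norm_blinfun)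
      finally show "norm ?v \<le> (1 + norm (D z)) * norm u" by (simp add: algebra_simps)
    qed simp
    finally show "norm ?d \<le> ?g y / c * norm u"
      using c_pos by (simp add: field_simps)
  qed (use c_pos in simp)
  then have "c * norm (D y - D z) \<le> norm (?g y)" if "y \<in> Z" for y
    using that c_pos by (simp add: pos_le_divide_eq abs_mult mult.commute)
  moreover have "(?g \<longlongrightarrow> norm (B (?w z) - B (?w z)) * (1 + norm (D z))) (at z within Z)"
    by (intro tendsto_intros lim)
  then have "(?g \<longlongrightarrow> 0) (at z within Z)" by simp
  ultimately show "(D \<longlongrightarrow> D z) (at z within Z)" by (rule tendsto_if_norm_le[OF _ c_pos])
qed

text \<open>The error \<open>h y - h z - D z (y - z)\<close> solves the linearized equation whose
  right-hand side is, up to sign, the Taylor remainder of \<open>A\<close>.\<close>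
lemma h_derivative:
  assumes z: "z \<in> Z" and A': "(A has_derivative B (z + h z)) (at (z + h z))"
  shows "(h has_derivative D z) (at z within Z)"
  unfolding has_derivative_within_alt
proof (intro conjI allI impI)
  show "bounded_linear (D z)" by (rule blinfun.bounded_linear_right)
  fix e :: real assume e: "e > 0"
  let ?w = "\<lambda>z. z + h z" and ?C = "1 + norm (D z)"
  define \<epsilon> where "\<epsilon> = min (c / 2) (e * c / (2 * ?C))"
  have C: "?C > 0" using norm_ge_zero[of "D z"] by linarith
  have \<epsilon>: "\<epsilon> > 0" "\<epsilon> \<le> c / 2" "\<epsilon> * (2 * ?C) \<le> e * c"
  proof -
    show "\<epsilon> > 0" using C c_pos e by (simp add: \<epsilon>_def)
    show "\<epsilon> \<le> c / 2" unfolding \<epsilon>_def by (rule min.cobounded1)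
    have "\<epsilon> \<le> e * c / (2 * ?C)" unfolding \<epsilon>_def by (rule min.cobounded2)
    then show "\<epsilon> * (2 * ?C) \<le> e * c" using C by (simp add: pos_le_divide_eq)
  qed
  obtain \<delta> where \<delta>: "\<delta> > 0" "\<And>y. norm (y - ?w z) < \<delta> \<Longrightarrow>
      norm (A y - A (?w z) - B (?w z) (y - ?w z)) \<le> \<epsilon> * norm (y - ?w z)"
    using A' \<epsilon>(1) unfolding has_derivative_at_alt by blast
  have "continuous_on Z ?w" by (intro continuous_intros h_cont)
  then obtain \<delta>' where \<delta>': "\<delta>' > 0" "\<And>y. y \<in> Z \<Longrightarrow> dist y z < \<delta>' \<Longrightarrow> dist (?w y) (?w z) < \<delta>"
    using \<delta>(1) z unfolding continuous_on_iff by blast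
  have "norm (h y - h z - D z (y - z)) \<le> e * norm (y - z)" if y: "y \<in> Z" "norm (y - z) < \<delta>'" for y
  proof -
    let ?d = "h y - h z - D z (y - z)" and ?r = "A (?w y) - A (?w z) - B (?w z) (?w y - ?w z)"
    have "norm (?w y - ?w z) < \<delta>" using \<delta>'(2)[OF y(1)] y(2) by (simp add: dist_norm)
    then have r: "norm ?r \<le> \<epsilon> * norm (?w y - ?w z)" by (rule \<delta>(2))
    have P0yz: "P0 (y - z) = y - z" using y(1) z by (simp add: Z_def blinfun.bilinear_simps)
    have "c * norm ?d \<le> norm (- ?r)"
    proof (rule B_estimate[OF z])
      show "P0 ?d = 0" by (simp add: blinfun.diff_right h(1) y z D_apply lin)
      fix k assume k: "P0 k = 0"
      have "inner (B (?w z) (P0 (y - z) + lin z (y - z))) k = 0" by (rule lin(2)[OF z k])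
      then have "inner (B (?w z) (y - z)) k + inner (B (?w z) (D z (y - z))) k = 0"
        by (simp add: P0yz D_apply[OF z] blinfun.add_right inner_add_left)
      moreover have "?w y - ?w z = (y - z) + (h y - h z)" by simp
      ultimately show "inner (B (?w z) ?d) k = inner (- ?r) k"
        using critical[OF y(1) k] critical[OF z k]
        by (simp only: inner_minus_left inner_diff_left blinfun.diff_right blinfun.add_right inner_add_left)
    qed
    then have d: "c * norm ?d \<le> \<epsilon> * norm (?w y - ?w z)"
      using r unfolding norm_minus_cancel by (rule order_trans)
    \<comment> \<open>The increment of \<open>z + h z\<close> is first bounded in terms of \<open>y - z\<close> by absorbing the remainder.\<close>
    have eq: "?w y - ?w z = ((y - z) + D z (y - z)) + ?d" by simp
    have "norm (?w y - ?w z) \<le> norm (y - z) + norm (D z (y - z)) + norm ?d"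
      unfolding eq by (rule norm_triangle_le[OF add_right_mono[OF norm_triangle_ineq]])
    also have "\<dots> \<le> ?C * norm (y - z) + norm ?d"
      using norm_blinfun[of "D z" "y - z"] by (simp add: algebra_simps)
    also have "norm ?d \<le> norm (?w y - ?w z) / 2"
    proof -
      have "c * norm ?d \<le> c / 2 * norm (?w y - ?w z)"
        using d \<epsilon>(2) mult_right_mono[OF \<epsilon>(2) norm_ge_zero[of "?w y - ?w z"]] by linarith
      then have "c * norm ?d \<le> c * (norm (?w y - ?w z) / 2)" by simp
      then show ?thesis using c_pos by (rule mult_left_le_imp_le)
    qed
    finally have "norm (?w y - ?w z) \<le> ?C * norm (y - z) + norm (?w y - ?w z) / 2" by simp
    then have "norm (?w y - ?w z) \<le> 2 * (?C * norm (y - z))" by linarith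
    then have "norm (?w y - ?w z) \<le> 2 * ?C * norm (y - z)" by (simp only: mult.assoc)
    then have "\<epsilon> * norm (?w y - ?w z) \<le> \<epsilon> * (2 * ?C * norm (y - z))" using \<epsilon>(1) by simp
    also have "\<dots> = (\<epsilon> * (2 * ?C)) * norm (y - z)" by (simp only: mult.assoc)
    also have "\<dots> \<le> (e * c) * norm (y - z)" by (rule mult_right_mono[OF \<epsilon>(3)]) simp
    finally have "c * norm ?d \<le> c * (e * norm (y - z))" using d by (simp add: ac_simps)
    then show ?thesis using c_pos by (rule mult_left_le_imp_le)
  qed
  then show "\<exists>d>0. \<forall>y\<in>Z. norm (y - z) < d \<longrightarrow> norm (h y - h z - D z (y - z)) \<le> e * norm (y - z)"
    using \<delta>'(1) by blast
qed

text \<open>In the derivative of the reduced function the contribution of \<open>D z\<close> drops out, because \<open>A (z + h z)\<close>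
  is orthogonal to its range. The gradient \<open>A (z + h z)\<close> that remains is differentiable once more.\<close>
theorem reduction_smooth:
  assumes A': "\<And>x. x \<in> V \<Longrightarrow> (A has_derivative B x) (at x)" and B_cont: "continuous_on V B"
  shows "C1_on Z h" "C2_on Z (\<lambda>z. L (z + h z))"
proof -
  have wV: "z + h z \<in> V" if "z \<in> Z" for z using in_V h(1) that by blast
  have h': "(h has_derivative D z) (at z within Z)" if "z \<in> Z" for z
    by (rule h_derivative[OF that A'[OF wV[OF that]]])
  then show "C1_on Z h" unfolding C1_on_def using D_cont[OF B_cont] by blast
  have w': "((\<lambda>z. z + h z) has_derivative (\<lambda>u. u + D z u)) (at z within Z)" if "z \<in> Z" for z
    by (intro derivative_intros h' that)
  let ?J = "blinfun_inner_right :: 'a \<Rightarrow> 'a \<Rightarrow>\<^sub>L real"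
  let ?f' = "\<lambda>z. ?J (A (z + h z))"
  have "((\<lambda>z. L (z + h z)) has_derivative ?f' z) (at z within Z)" if z: "z \<in> Z" for z
  proof -
    have "(L has_derivative (\<lambda>u. inner u (A (z + h z)))) (at (z + h z))"
      using grad[OF wV[OF z]] by (simp add: gderiv_def)
    from has_derivative_compose[OF w'[OF z] this]
    have "((\<lambda>z. L (z + h z)) has_derivative (\<lambda>u. inner (u + D z u) (A (z + h z)))) (at z within Z)" .
    moreover have "inner (u + D z u) (A (z + h z)) = ?f' z u" for u
      using critical[OF z lin(1)[OF z, of u]]
      by (simp add: D_apply[OF z] inner_add_right blinfun_inner_right.rep_eq inner_commute[of _ "A (z + h z)"])
    ultimately show ?thesis by simp
  qed
  moreover have "C1_on Z ?f'"
  proof -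
    let ?f'' = "\<lambda>z. Blinfun ?J o\<^sub>L (B (z + h z) o\<^sub>L (id_blinfun + D z))"
    have deriv: "(?f' has_derivative ?f'' z) (at z within Z)" if z: "z \<in> Z" for z
    proof -
      have "((\<lambda>z. A (z + h z)) has_derivative (\<lambda>u. B (z + h z) (u + D z u))) (at z within Z)"
        by (rule has_derivative_compose[OF w'[OF z] A'[OF wV[OF z]]])
      then have "(?f' has_derivative (\<lambda>u. ?J (B (z + h z) (u + D z u)))) (at z within Z)"
        by (rule bounded_linear.has_derivative[OF bounded_linear_blinfun_inner_right])
      then show ?thesis
        by (rule has_derivative_eq_rhs)
          (simp add: fun_eq_iff bounded_linear_Blinfun_apply bounded_linear_blinfun_inner_right blinfun.add_left)
    qed
    have cont: "continuous_on Z ?f''"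
    proof -
      note compose = bounded_bilinear.continuous_on[OF bounded_bilinear_blinfun_compose]
      have "continuous_on Z (\<lambda>z. z + h z)" by (intro continuous_intros h_cont)
      then have 1: "continuous_on Z (\<lambda>z. B (z + h z))"
        by (rule continuous_on_compose2[OF B_cont]) (use wV in blast)
      have 2: "continuous_on Z (\<lambda>z. id_blinfun + D z)"
        by (rule continuous_on_add[OF continuous_on_const D_cont[OF B_cont]])
      show ?thesis by (rule compose[OF continuous_on_const compose[OF 1 2]])
    qed
    show ?thesis unfolding C1_on_def
      by (rule exI[of _ ?f''], rule conjI, rule ballI, erule deriv, rule cont)
  qed
  ultimately show "C2_on Z (\<lambda>z. L (z + h z))" unfolding C2_on_def
    by (intro exI[of _ ?f'] conjI ballI)
qed

end

section \<open>Gradients and Hessians\<close>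

lemma norm_le_norm_inner_functional: "norm x \<le> norm (blinfun_inner_right x)"
proof (cases "x = 0")
  case False
  have "norm x * norm x = blinfun_inner_right x x"
    by (simp add: blinfun_inner_right.rep_eq dot_square_norm power2_eq_square)
  also have "\<dots> \<le> norm (blinfun_inner_right x x)" by simp
  also have "\<dots> \<le> norm (blinfun_inner_right x) * norm x" by (rule norm_blinfun)
  finally show ?thesis using False by simp
qed simp

lemma inner_functional_diff: "blinfun_inner_right x - blinfun_inner_right y = blinfun_inner_right (x - y)"
  by (rule linear_diff[OF bounded_linear.linear[OF bounded_linear_blinfun_inner_right], symmetric])

lemma derivative_eq_gradient:
  fixes L :: "'a::real_inner \<Rightarrow> real"
  assumes "open V" "x \<in> V" "GDERIV L x :> g" "(L has_derivative blinfun_apply f) (at x within V)"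
  shows "f = blinfun_inner_right g"
proof (rule blinfun_eqI)
  fix u
  have "(L has_derivative blinfun_apply f) (at x)" using assms(4) at_within_open[OF assms(2,1)] by simp
  moreover have "(L has_derivative (\<lambda>u. inner u g)) (at x)" using assms(3) by (simp add: gderiv_def)
  ultimately have "blinfun_apply f = (\<lambda>u. inner u g)" by (rule has_derivative_unique)
  then show "f u = blinfun_inner_right g u" by (simp add: blinfun_inner_right.rep_eq inner_commute)
qed

lemma C1_gradient_continuous:
  fixes L :: "'a::real_inner \<Rightarrow> real"
  assumes V: "open V" and L: "C1_on V L" and grad: "\<And>x. x \<in> V \<Longrightarrow> GDERIV L x :> A x"
  shows "continuous_on V A"
proof -
  obtain f' where f': "\<And>x. x \<in> V \<Longrightarrow> (L has_derivative blinfun_apply (f' x)) (at x within V)" "continuous_on V f'"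
    using L unfolding C1_on_def by blast
  have eq: "f' x = blinfun_inner_right (A x)" if "x \<in> V" for x
    by (rule derivative_eq_gradient[OF V that grad[OF that] f'(1)[OF that]])
  have le: "dist (A y) (A x) \<le> dist (f' y) (f' x)" if "x \<in> V" "y \<in> V" for x y
    using norm_le_norm_inner_functional[of "A y - A x"] that
    by (simp add: dist_norm eq inner_functional_diff)
  show ?thesis by (rule continuous_on_if_dist_le[OF f'(2) le])
qed

text \<open>The inner product embeds gradients isometrically into the functionals. Under this embedding \<open>A\<close> is
  the derivative of \<open>L\<close>, so \<open>B\<close>, known from directional limits, must be the second derivative.\<close>
lemma C2_gradient_differentiable:
  fixes L :: "'a::real_inner \<Rightarrow> real" and B :: "'a \<Rightarrow> 'a \<Rightarrow>\<^sub>L 'a"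
  assumes V: "open V" and L: "C2_on V L" and grad: "\<And>x. x \<in> V \<Longrightarrow> GDERIV L x :> A x"
    and dir: "\<And>x u. x \<in> V \<Longrightarrow> ((\<lambda>t. (A (x + t *\<^sub>R u) - A x) /\<^sub>R t) \<longlongrightarrow> B x u) (at 0)"
  shows "\<And>x. x \<in> V \<Longrightarrow> (A has_derivative B x) (at x)" and "continuous_on V B"
proof -
  let ?J = "blinfun_inner_right :: 'a \<Rightarrow> 'a \<Rightarrow>\<^sub>L real"
  obtain f' where f': "\<And>x. x \<in> V \<Longrightarrow> (L has_derivative blinfun_apply (f' x)) (at x within V)" "C1_on V f'"
    using L unfolding C2_on_def by blast
  have eq: "f' x = ?J (A x)" if "x \<in> V" for x
    by (rule derivative_eq_gradient[OF V that grad[OF that] f'(1)[OF that]])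
  obtain f'' where f'': "\<And>x. x \<in> V \<Longrightarrow> (f' has_derivative blinfun_apply (f'' x)) (at x within V)" "continuous_on V f''"
    using f'(2) unfolding C1_on_def by blast
  have J': "((\<lambda>y. ?J (A y)) has_derivative f'' x) (at x)" if x: "x \<in> V" for x
    by (rule has_derivative_transform_within_open[OF _ V x eq])
      (use f''(1)[OF x] at_within_open[OF x V] in simp)
  have f''_eq: "f'' x u = ?J (B x u)" if x: "x \<in> V" for x u
  proof (rule blinfun_eqI)
    fix k
    have "((\<lambda>t::real. x + t *\<^sub>R u) has_derivative (\<lambda>t. t *\<^sub>R u)) (at 0)"
      by (auto intro!: derivative_eq_intros)
    moreover have "((\<lambda>y. ?J (A y)) has_derivative f'' x) (at (x + 0 *\<^sub>R u))" using J'[OF x] by simp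
    ultimately have "((\<lambda>t. ?J (A (x + t *\<^sub>R u))) has_derivative (\<lambda>t. f'' x (t *\<^sub>R u))) (at 0)"
      by (rule has_derivative_compose)
    then have "((\<lambda>t. ?J (A (x + t *\<^sub>R u)) k) has_derivative (\<lambda>t. f'' x (t *\<^sub>R u) k)) (at 0)"
      by (rule bounded_linear.has_derivative[OF bounded_linear_apply_blinfun])
    then have "((\<lambda>t. inner (A (x + t *\<^sub>R u)) k) has_real_derivative f'' x u k) (at 0)"
      by (simp add: has_field_derivative_def blinfun_inner_right.rep_eq blinfun.scaleR_right
          blinfun.scaleR_left mult.commute[of _ "blinfun_apply _ _"])
    then have "((\<lambda>t. (inner (A (x + t *\<^sub>R u)) k - inner (A x) k) / t) \<longlongrightarrow> f'' x u k) (at 0)"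
      by (simp add: DERIV_def)
    moreover have "((\<lambda>t. inner ((A (x + t *\<^sub>R u) - A x) /\<^sub>R t) k) \<longlongrightarrow> inner (B x u) k) (at 0)"
      by (intro tendsto_intros dir x)
    then have "((\<lambda>t. (inner (A (x + t *\<^sub>R u)) k - inner (A x) k) / t) \<longlongrightarrow> inner (B x u) k) (at 0)"
      by (simp add: inner_diff_left divide_inverse mult.commute)
    ultimately show "f'' x u k = ?J (B x u) k"
      using LIM_unique by (auto simp: blinfun_inner_right.rep_eq)
  qed
  show "(A has_derivative B x) (at x)" if x: "x \<in> V" for x
    unfolding has_derivative_at_alt
  proof (intro conjI allI impI)
    show "bounded_linear (B x)" by (rule blinfun.bounded_linear_right)
    fix e :: real assume "e > 0"
    then obtain d where d: "d > 0" "\<And>y. norm (y - x) < d \<Longrightarrow>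
        norm (?J (A y) - ?J (A x) - f'' x (y - x)) \<le> e * norm (y - x)"
      using J'[OF x] unfolding has_derivative_at_alt by blast
    have "norm (A y - A x - B x (y - x)) \<le> norm (?J (A y) - ?J (A x) - f'' x (y - x))" for y
      using norm_le_norm_inner_functional[of "A y - A x - B x (y - x)"]
      by (simp add: f''_eq[OF x] inner_functional_diff)
    then show "\<exists>d>0. \<forall>y. norm (y - x) < d \<longrightarrow> norm (A y - A x - B x (y - x)) \<le> e * norm (y - x)"
      using d by (intro exI[of _ d]) (auto intro: order_trans)
  qed
  have le: "dist (B y) (B x) \<le> dist (f'' y) (f'' x)" if "x \<in> V" "y \<in> V" for x y
    unfolding dist_norm
  proof (rule norm_blinfun_bound)
    fix u
    have "norm ((B y - B x) u) \<le> norm (?J ((B y - B x) u))" by (rule norm_le_norm_inner_functional)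
    also have "?J ((B y - B x) u) = (f'' y - f'' x) u"
      using that by (simp add: f''_eq blinfun.diff_left inner_functional_diff)
    also have "norm \<dots> \<le> norm (f'' y - f'' x) * norm u" by (rule norm_blinfun)
    finally show "norm ((B y - B x) u) \<le> norm (f'' y - f'' x) * norm u" .
  qed simp
  show "continuous_on V B" by (rule continuous_on_if_dist_le[OF f''(2) le])
qed

section \<open>The quantitative hypotheses\<close>

text \<open>Some bound is needed for the supremum that defines \<open>onorm_on\<close> to be meaningful; the supremum is
  then the best bound.\<close>
lemma norm_le_onorm_on:
  assumes bound: "\<And>x. x \<in> S \<Longrightarrow> norm (f x) \<le> M * norm x" and x: "x \<in> S"
  shows "norm (f x) \<le> onorm_on S f * norm x"
proof (cases "norm x = 0")
  case False
  have "bdd_above ((\<lambda>x. norm (f x) / norm x) ` S)"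
  proof (rule bdd_aboveI2)
    fix x assume x: "x \<in> S"
    show "norm (f x) / norm x \<le> max M 0"
    proof (cases "norm x = 0")
      case False
      then have "norm (f x) / norm x \<le> M" using bound[OF x] by (simp add: pos_divide_le_eq)
      then show ?thesis by simp
    qed simp
  qed
  then have "norm (f x) / norm x \<le> onorm_on S f"
    unfolding onorm_on_def by (rule cSUP_upper[OF x])
  then show ?thesis using False by (simp add: pos_divide_le_eq)
qed (use bound[OF x] in auto)

text \<open>If unit vectors \<open>x n\<close> off the kernel had images tending to 0, then along a subsequence \<open>Q\<close> would
  converge on them, hence so would \<open>P\<close>, hence the vectors themselves; their limit would be a unit
  vector in the kernel and orthogonal to it.\<close>
lemma compact_perturbation_bounded_below:
  fixes P Q :: "'a::{real_inner, complete_space} \<Rightarrow>\<^sub>L 'a"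
  assumes P: "positive_definite P" and Q: "compact_operator Q"
  shows "\<exists>a>0. \<forall>y\<in>orthogonal_comp (op_kernel (P + Q)). a * norm y \<le> norm ((P + Q) y)"
proof (rule ccontr)
  let ?T = "P + Q" and ?K = "orthogonal_comp (op_kernel (P + Q))"
  assume contra: "\<not> ?thesis"
  have sub: "subspace ?K" by (rule subspace_orthogonal_comp)
  have "\<exists>x\<in>?K. norm x = 1 \<and> norm (?T x) < 1 / real (Suc n)" for n
  proof -
    have "1 / real (Suc n) > 0" by simp
    then obtain y where y: "y \<in> ?K" "norm (?T y) < 1 / real (Suc n) * norm y"
      using contra by (meson not_le)
    then have y0: "norm y > 0" by (metis mult_zero_right norm_ge_zero not_le zero_less_norm_iff norm_zero)
    let ?x = "(1 / norm y) *\<^sub>R y"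
    have "?x \<in> ?K" by (rule subspace_scale[OF sub y(1)])
    moreover have "norm ?x = 1" using y0 by simp
    moreover have "norm (?T ?x) = norm (?T y) / norm y" by (simp add: blinfun.scaleR_right)
    then have "norm (?T ?x) < 1 / real (Suc n)" using y(2) y0 by (simp add: pos_divide_less_eq)
    ultimately show ?thesis by blast
  qed
  then obtain x where x: "\<And>n. x n \<in> ?K" "\<And>n. norm (x n) = 1" "\<And>n. norm (?T (x n)) < 1 / real (Suc n)"
    by metis
  have "(\<lambda>n. ?T (x n)) \<longlonglongrightarrow> 0"
  proof (rule Lim_null_comparison)
    show "\<forall>\<^sub>F n in sequentially. norm (?T (x n)) \<le> 1 / real (Suc n)" using x(3) by (simp add: less_imp_le)
    show "(\<lambda>n. 1 / real (Suc n)) \<longlonglongrightarrow> 0" by (intro LIMSEQ_Suc lim_1_over_n)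
  qed
  moreover have "compact (closure (Q ` cball 0 1))" using Q by (auto simp: compact_operator_def)
  then have "seq_compact (closure (Q ` cball 0 1))" by (simp add: compact_eq_seq_compact_metric)
  moreover have "Q (x n) \<in> closure (Q ` cball 0 1)" for n
    by (intro subsetD[OF closure_subset] imageI) (simp add: x(2))
  ultimately obtain l r where r: "strict_mono r" and Ql: "((\<lambda>n. Q (x n)) \<circ> r) \<longlonglongrightarrow> l" and T0: "(\<lambda>n. ?T (x n)) \<longlonglongrightarrow> 0"
    unfolding seq_compact_def by meson
  have T0r: "(\<lambda>n. ?T (x (r n))) \<longlonglongrightarrow> 0" using LIMSEQ_subseq_LIMSEQ[OF T0 r] by (simp add: o_def)
  have "(\<lambda>n. ?T (x (r n)) - Q (x (r n))) \<longlonglongrightarrow> 0 - l"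
    using Ql by (intro tendsto_diff T0r) (simp add: o_def)
  then have "(\<lambda>n. P (x (r n))) \<longlonglongrightarrow> 0 - l" by (simp add: blinfun.add_left)
  then have "Cauchy (\<lambda>n. P (x (r n)))" by (rule LIMSEQ_imp_Cauchy)
  obtain c where c: "c > 0" "\<And>u. c * (norm u)\<^sup>2 \<le> inner (P u) u" using P by (auto simp: positive_definite_def)
  have P_below: "c * norm u \<le> norm (P u)" for u
    by (rule cancel_norm[OF order_trans[OF c(2) norm_cauchy_schwarz]]) simp
  have "c * dist (x (r m)) (x (r n)) \<le> dist (P (x (r m))) (P (x (r n)))" for m n
    using P_below[of "x (r m) - x (r n)"] by (simp add: dist_norm blinfun.diff_right)
  then have "Cauchy (\<lambda>n. x (r n))"
    by (rule Cauchy_if_dist_le[OF \<open>Cauchy (\<lambda>n. P (x (r n)))\<close> c(1)])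
  then obtain x0 where x0: "(\<lambda>n. x (r n)) \<longlonglongrightarrow> x0" by (meson Cauchy_convergent_iff convergent_def)
  have "x0 \<in> ?K" by (rule closed_sequentially[OF closed_orthogonal_comp x(1) x0])
  moreover have "(\<lambda>n. ?T (x (r n))) \<longlonglongrightarrow> ?T x0" by (intro tendsto_intros x0)
  then have "?T x0 = 0" using T0r LIMSEQ_unique by blast
  ultimately have "inner x0 x0 = 0" by (auto simp: orthogonal_comp_def orthogonal_def op_kernel_def)
  moreover have "(\<lambda>n. norm (x (r n))) \<longlonglongrightarrow> norm x0" by (intro tendsto_intros x0)
  then have "norm x0 = 1" by (simp add: x(2) LIMSEQ_const_iff)
  ultimately show False by simp
qed

text \<open>The suprema are antitone in the radius, so \<open>M_inf\<close> is their infimum.\<close>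
lemma M_inf_bounds:
  fixes H0 :: "'a::{real_inner, complete_space} set"
  assumes H0: "subspace H0" "H0 \<noteq> {0}"
  shows "0 \<le> M_inf H0 A"
    and "M_inf H0 A < ereal m \<Longrightarrow> \<exists>R. \<forall>z\<in>H0. norm z \<ge> R \<longrightarrow> norm (A z - orth_proj H0 (A z)) \<le> m"
proof -
  define g where "g R = (SUP z\<in>cball_inf H0 R. ereal (norm (A z - orth_proj H0 (A z))))" for R
  have anti: "g R' \<le> g R" if "R \<le> R'" for R R'
    unfolding g_def by (rule SUP_subset_mono) (use that in \<open>auto simp: cball_inf_def\<close>)
  have "(g \<longlongrightarrow> (INF R. g R)) at_top"
  proof (rule order_tendstoI)
    fix y assume "y < (INF R. g R)"
    then have "y < g R" for R by (meson INF_lower UNIV_I less_le_trans)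
    then show "\<forall>\<^sub>F R in at_top. y < g R" by simp
  next
    fix y assume "(INF R. g R) < y"
    then obtain R0 where "g R0 < y" by (auto simp: INF_less_iff)
    then have "g R < y" if "R \<ge> R0" for R using anti[OF that] by (rule le_less_trans[rotated])
    then show "\<forall>\<^sub>F R in at_top. g R < y" using eventually_at_top_linorder by blast
  qed
  then have M: "M_inf H0 A = (INF R. g R)"
    unfolding M_inf_def g_def[symmetric] by (intro tendsto_Lim) simp_all
  obtain v where v: "v \<in> H0" "v \<noteq> 0" using H0 subspace_0 by blast
  have "0 \<le> g R" for R
  proof -
    let ?z = "(\<bar>R\<bar> / norm v) *\<^sub>R v"
    have "?z \<in> cball_inf H0 R" using v H0(1) by (auto simp: cball_inf_def subspace_scale)
    then show ?thesis unfolding g_def by (rule SUP_upper2) simp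
  qed
  then show "0 \<le> M_inf H0 A" unfolding M by (intro INF_greatest)
  show "\<exists>R. \<forall>z\<in>H0. norm z \<ge> R \<longrightarrow> norm (A z - orth_proj H0 (A z)) \<le> m" if "M_inf H0 A < ereal m"
  proof -
    obtain R where R: "g R < ereal m" using \<open>M_inf H0 A < ereal m\<close> unfolding M by (auto simp: INF_less_iff)
    have "norm (A z - orth_proj H0 (A z)) \<le> m" if "z \<in> H0" "norm z \<ge> R" for z
    proof -
      have "ereal (norm (A z - orth_proj H0 (A z))) \<le> g R"
        unfolding g_def by (rule SUP_upper) (use that in \<open>simp add: cball_inf_def\<close>)
      then have "ereal (norm (A z - orth_proj H0 (A z))) < ereal m" using R by (rule le_less_trans)
      then show ?thesis by simp
    qed
    then show ?thesis by blast
  qed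
qed

lemma (in bounded_below_off_kernel) norm_le_onorm_inverse:
  assumes y: "y \<in> K"
  shows "norm y \<le> onorm_on K (inv_into K (blinfun_apply T)) * norm (T y)"
proof -
  let ?f = "inv_into K (blinfun_apply T)"
  have inj: "inj_on (blinfun_apply T) K"
  proof (rule inj_onI)
    fix x y assume "x \<in> K" "y \<in> K" "T x = T y"
    then have "x - y \<in> K" "T (x - y) = 0" using closed_K(1) by (auto simp: subspace_diff blinfun.diff_right)
    then have "x - y = 0" by (rule in_K_eq_0)
    then show "x = y" by simp
  qed
  have "norm (?f (T y)) \<le> onorm_on K ?f * norm (T y)"
  proof (rule norm_le_onorm_on[OF _ range_in_K])
    fix k assume "k \<in> K"
    then have "k \<in> T ` K" unfolding maps_onto_K .
    then have "?f k \<in> K" "T (?f k) = k" by (rule inv_into_into, rule f_inv_into_f)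
    then have "a * norm (?f k) \<le> norm k" using below[of "?f k"] by simp
    then show "norm (?f k) \<le> (1 / a) * norm k" using a_pos by (simp add: pos_le_divide_eq mult.commute)
  qed
  then show ?thesis by (simp add: inv_into_f_f[OF inj y])
qed

lemma (in bounded_below_off_kernel) spectral_projections:
  defines "P0 \<equiv> Blinfun (orth_proj (op_kernel T))" and "Pp \<equiv> Blinfun (orth_proj (positive_subspace T))"
    and "Pm \<equiv> Blinfun (orth_proj (negative_subspace T))"
  shows "hilbert_splitting T P0 Pp Pm a"
    and "P0 x = orth_proj (op_kernel T) x" "P0 x = 0 \<longleftrightarrow> x \<in> K" "P0 x = x \<longleftrightarrow> x \<in> op_kernel T"
    "Pp x = x \<longleftrightarrow> x \<in> positive_subspace T" "Pm x = x \<longleftrightarrow> x \<in> negative_subspace T"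
proof -
  let ?H0 = "op_kernel T" and ?Hp = "positive_subspace T" and ?Hm = "negative_subspace T"
  note S = spectral_splitting
  note Hp = S(1,2) and Hm = S(3,4)
  have P0: "P0 x = orth_proj ?H0 x" for x
    unfolding P0_def by (simp add: bounded_linear_Blinfun_apply bounded_linear_orth_proj[OF closed_kernel])
  have Pp: "Pp x = orth_proj ?Hp x" for x
    unfolding Pp_def by (simp add: bounded_linear_Blinfun_apply bounded_linear_orth_proj[OF Hp])
  have Pm: "Pm x = orth_proj ?Hm x" for x
    unfolding Pm_def by (simp add: bounded_linear_Blinfun_apply bounded_linear_orth_proj[OF Hm])
  have in0: "P0 x \<in> ?H0" and inp: "Pp x \<in> ?Hp" and inm: "Pm x \<in> ?Hm" for x
    unfolding P0 Pp Pm by (rule orth_proj_in[OF closed_kernel] orth_proj_in[OF Hp] orth_proj_in[OF Hm])+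
  have o0: "inner z k = 0" if "z \<in> ?H0" "k \<in> K" for z k
    using that by (simp add: K_iff op_kernel_def)
  have op: "inner z u = 0" if "z \<in> ?H0" "u \<in> ?Hp" for z u using o0[OF that(1)] S(5) that(2) by blast
  have om: "inner z v = 0" if "z \<in> ?H0" "v \<in> ?Hm" for z v using o0[OF that(1)] S(6) that(2) by blast
  have opm: "inner u v = 0" if "u \<in> ?Hp" "v \<in> ?Hm" for u v using S(7) that .
  have sum: "P0 x + Pp x + Pm x = x" for x
  proof -
    have "x - P0 x \<in> K" unfolding P0 K_def by (rule orth_proj_residual[OF closed_kernel])
    then obtain u v where uv: "u \<in> ?Hp" "v \<in> ?Hm" "x - P0 x = u + v" using S(8) by blast
    then have x: "x = P0 x + u + v" by (simp add: algebra_simps)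
    have "inner (x - u) s = 0" if "s \<in> ?Hp" for s
    proof -
      have "x - u = P0 x + v" using x by (simp add: algebra_simps)
      then show ?thesis using op[OF in0 that] opm[OF that uv(2)] by (simp add: inner_add_left inner_commute[of v])
    qed
    then have "Pp x = u" unfolding Pp by (intro orth_proj_eqI[OF Hp] uv(1))
    moreover have "inner (x - v) s = 0" if "s \<in> ?Hm" for s
    proof -
      have "x - v = P0 x + u" using x by (simp add: algebra_simps)
      then show ?thesis using om[OF in0 that] opm[OF uv(1) that] by (simp add: inner_add_left)
    qed
    then have "Pm x = v" unfolding Pm by (intro orth_proj_eqI[OF Hm] uv(2))
    ultimately show ?thesis using x by simp
  qed
  have p_iff: "Pp x = x \<longleftrightarrow> x \<in> ?Hp" for x
    using inp[of x] orth_proj_self[OF Hp, of x] unfolding Pp by auto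
  have m_iff: "Pm x = x \<longleftrightarrow> x \<in> ?Hm" for x
    using inm[of x] orth_proj_self[OF Hm, of x] unfolding Pm by auto
  show "P0 x = orth_proj ?H0 x" "Pp x = x \<longleftrightarrow> x \<in> ?Hp" "Pm x = x \<longleftrightarrow> x \<in> ?Hm" by (fact P0 p_iff m_iff)+
  show "P0 x = x \<longleftrightarrow> x \<in> ?H0"
    using in0[of x] orth_proj_self[OF closed_kernel, of x] unfolding P0 by auto
  show "P0 x = 0 \<longleftrightarrow> x \<in> K"
  proof
    assume "P0 x = 0"
    then show "x \<in> K" using orth_proj_residual[OF closed_kernel, of x] unfolding P0 K_def by simp
  next
    assume "x \<in> K"
    then show "P0 x = 0" unfolding P0
      by (intro orth_proj_eqI[OF closed_kernel]) (auto simp: subspace_0[OF closed_kernel(1)] inner_commute o0)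
  qed
  show "hilbert_splitting T P0 Pp Pm a"
  proof
    show "T ` {u. Pp u = u} = {u. Pp u = u}" "T ` {v. Pm v = v} = {v. Pm v = v}"
      unfolding p_iff m_iff by (simp_all add: S(9,10))
  qed (use sum a_pos op om opm in0 inp inm S(11,12) in auto)
qed

section \<open>The splitting theorem at infinity\<close>

theorem corollary1p7:
  fixes V :: "'a::{real_inner, complete_space} set"
    and L :: "'a \<Rightarrow> real"
    and A :: "'a \<Rightarrow> 'a"
    and DA :: "'a \<Rightarrow> 'a \<Rightarrow> 'a"
    and B :: "'a \<Rightarrow> 'a \<Rightarrow>\<^sub>L 'a"
    and Binf Pinf Qinf :: "'a \<Rightarrow>\<^sub>L 'a"
    and H0 Hpm Hp Hm :: "'a set"
    and P0 :: "'a \<Rightarrow> 'a"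
    and C1 R1 \<kappa> :: real
    and \<rho> :: ereal
  assumes V_nhd: "open V" "\<exists>R>0. ball_inf UNIV R \<subseteq> V"
    and L_C1: "C1_on V L"
    and A_grad: "\<And>x. x \<in> V \<Longrightarrow> GDERIV L x :> A x"
    and A_diff: "cont_dir_differentiable_on V A DA"
    and B_sa: "\<And>x. x \<in> V \<Longrightarrow> self_adjoint (B x)" "self_adjoint Binf"
    and B_eq: "\<And>x u v. x \<in> V \<Longrightarrow> inner (DA x u) v = inner (B x u) v"
    and b: "0 \<in> real_spectrum Binf"
      "Binf = Pinf + Qinf"
      "self_adjoint Pinf" "positive_definite Pinf"
      "self_adjoint Qinf" "compact_operator Qinf"
    and c: "\<And>x :: nat \<Rightarrow> 'a. range x \<subseteq> V \<Longrightarrow>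
      filterlim (\<lambda>n. norm (x n)) at_top sequentially \<Longrightarrow>
      \<exists>C0>0. \<exists>n0>0. \<forall>n\<ge>n0. \<forall>u. inner ((B (x n) - Qinf) u) u \<ge> C0 * (norm u)\<^sup>2"
    and H0_def: "H0 = op_kernel Binf"
    and H0_nontrivial: "H0 \<noteq> {0}"
    and Hpm_def: "Hpm = orthogonal_comp H0"
    and Hp_def: "Hp = positive_subspace Binf"
    and Hm_def: "Hm = negative_subspace Binf"
    and P0_def: "P0 = orth_proj H0"
    and C1_def: "C1 = onorm_on Hpm (inv_into Hpm (blinfun_apply Binf))"
    and R1: "R1 > 0"
    and \<kappa>: "\<kappa> > 1"
    and d: "\<And>y z. y \<in> ball_in Hpm \<rho> \<Longrightarrow> z \<in> cball_inf H0 R1 \<Longrightarrow> z + y \<in> V \<Longrightarrow>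
      onorm_on Hpm (\<lambda>u. (B (z + y) - Binf) u - P0 ((B (z + y) - Binf) u)) \<le> 1 / (\<kappa> * C1)"
    and \<rho>: "(M_inf H0 A < \<infinity> \<and> ereal (\<kappa> / (\<kappa> - 1) * C1) * M_inf H0 A < \<rho> \<and> \<rho> < \<infinity>) \<or> \<rho> = \<infinity>"
  shows "\<forall>r::real. r > 0 \<longrightarrow>
    (\<exists>R \<delta> h W \<Phi>.
       R \<ge> R1 \<and> \<delta> > 0 \<and>
       continuous_on (ball_inf H0 R) h \<and>
       (\<forall>z\<in>ball_inf H0 R. h z \<in> cball_in Hpm \<rho> \<and> z + h z \<in> V \<and>
          A (z + h z) - P0 (A (z + h z)) = 0) \<and>
       (\<forall>g. (\<forall>z\<in>ball_inf H0 R. g z \<in> cball_in Hpm \<rho> \<and> z + g z \<in> V \<and>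
               A (z + g z) - P0 (A (z + g z)) = 0) \<longrightarrow>
            (\<forall>z\<in>ball_inf H0 R. g z = h z)) \<and>
       open W \<and> W \<subseteq> V \<and> W \<subseteq> closure (C_set H0 Hp Hm R (ereal r + \<rho>)) \<and>
       (\<exists>\<Psi>. homeomorphism (C_set H0 Hp Hm R (ereal \<delta>)) W \<Phi> \<Psi>) \<and>
       (\<forall>z\<in>ball_inf H0 R. \<forall>u\<in>ball_in Hp (ereal \<delta>). \<forall>v\<in>ball_in Hm (ereal \<delta>).
          L (\<Phi> (z + u + v)) = (norm u)\<^sup>2 - (norm v)\<^sup>2 + L (z + h z)) \<and>
       (C2_on V L \<longrightarrow>
          C1_on (ball_inf H0 R) h \<and> C2_on (ball_inf H0 R) (\<lambda>z. L (z + h z))))"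
proof (intro allI impI, goal_cases)
  case (1 r)
  then have r: "r > 0" .
  \<comment> \<open>Some lower bound \<open>a0\<close> is needed to see that \<open>C1\<close> is a genuine norm. The sharp one is \<open>1 / C1\<close>;
    for trivial \<open>Hpm\<close>, where \<open>C1 = 0\<close>, any positive number will do.\<close>
  obtain a0 where a0: "a0 > 0" "\<And>y. y \<in> Hpm \<Longrightarrow> a0 * norm y \<le> norm (Binf y)"
    using compact_perturbation_bounded_below[OF b(4,6)] unfolding Hpm_def H0_def b(2) by blast
  interpret coarse: bounded_below_off_kernel Binf Hpm a0
    by unfold_locales (use B_sa(2) a0 in \<open>simp_all add: Hpm_def H0_def\<close>)
  have C1_lower: "norm y \<le> C1 * norm (Binf y)" if "y \<in> Hpm" for y
    using coarse.norm_le_onorm_inverse[OF that] by (simp add: C1_def)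
  define a where "a = (if Hpm = {0} then 1 else 1 / C1)"
  have C1_pos: "C1 > 0" if "Hpm \<noteq> {0}"
  proof -
    have "0 \<in> Hpm" by (rule subspace_0[OF coarse.closed_K(1)])
    then have "\<exists>y. y \<in> Hpm \<and> y \<noteq> 0" using that by fastforce
    then obtain y where y: "y \<in> Hpm" "y \<noteq> 0" by blast
    have "0 < norm y" using y(2) by simp
    also have "\<dots> \<le> C1 * norm (Binf y)" by (rule C1_lower[OF y(1)])
    finally show ?thesis by (simp add: zero_less_mult_iff)
  qed
  have a_pos: "a > 0" using C1_pos by (simp add: a_def)
  interpret inf: bounded_below_off_kernel Binf Hpm a
  proof
    fix y assume y: "y \<in> Hpm"
    show "a * norm y \<le> norm (Binf y)"
    proof (cases "Hpm = {0}")
      case False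
      then show ?thesis using C1_lower[OF y] C1_pos by (simp add: a_def pos_divide_le_eq mult.commute)
    qed (use y in simp)
  qed (use B_sa(2) a_pos in \<open>simp_all add: Hpm_def H0_def\<close>)
  have H0_sub: "subspace H0" "closed H0" using inf.closed_kernel by (simp_all add: H0_def)
  define p0 where "p0 = Blinfun (orth_proj (op_kernel Binf))"
  define pp where "pp = Blinfun (orth_proj (positive_subspace Binf))"
  define pm where "pm = Blinfun (orth_proj (negative_subspace Binf))"
  note proj = inf.spectral_projections[folded p0_def pp_def pm_def]
  interpret hilbert_splitting Binf p0 pp pm a by (rule proj(1))
  have p0_P0: "p0 x = P0 x" for x by (simp add: proj(2) P0_def H0_def)
  have p0_Hpm: "p0 x = 0 \<longleftrightarrow> x \<in> Hpm" and p0_H0: "p0 x = x \<longleftrightarrow> x \<in> H0" for x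
    by (simp_all only: proj(3,4) H0_def)
  have pp_Hp: "pp x = x \<longleftrightarrow> x \<in> Hp" and pm_Hm: "pm x = x \<longleftrightarrow> x \<in> Hm" for x
    by (simp_all only: proj(5,6) Hp_def Hm_def)
  define \<theta> where "\<theta> = 1 / \<kappa>"
  have \<theta>: "0 \<le> \<theta>" "\<theta> < 1" "(1 - \<theta>) * (\<kappa> / (\<kappa> - 1)) = 1" using \<kappa> by (auto simp: \<theta>_def field_simps)

  \<comment> \<open>The a priori radius of the solution. For finite \<open>\<rho>\<close> the strict inequality between \<open>M_inf\<close> and \<open>\<rho>\<close>
    leaves room for a radius \<open>r' < \<rho>\<close> that is the same for all \<open>z\<close>.\<close>
  have "\<exists>R2 \<eta> rad. \<eta> > 0 \<and> (\<forall>z\<in>H0. norm z \<ge> R2 \<longrightarrow> 0 \<le> rad z \<and> ereal (rad z + \<eta>) \<le> \<rho> \<and>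
      norm (A z - P0 (A z)) \<le> (1 - \<theta>) * a * rad z)"
  proof (cases "\<rho> = \<infinity>")
    case True
    let ?rad = "\<lambda>z. norm (A z - P0 (A z)) / ((1 - \<theta>) * a)"
    have "0 \<le> (1 - \<theta>) * a" "\<theta> \<noteq> 1" "a \<noteq> 0" using \<theta> a_pos by simp_all
    then show ?thesis by - (rule exI[of _ 0], rule exI[of _ 1], rule exI[of _ ?rad], simp add: True)
  next
    case False
    then have fin: "M_inf H0 A < \<infinity>" "ereal (\<kappa> / (\<kappa> - 1) * C1) * M_inf H0 A < \<rho>" "\<rho> < \<infinity>" using \<rho> by auto
    have M0: "0 \<le> M_inf H0 A" by (rule M_inf_bounds(1)[OF H0_sub(1) H0_nontrivial])
    then obtain m0 where m0: "M_inf H0 A = ereal m0" "m0 \<ge> 0" using fin(1) by (cases "M_inf H0 A") auto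
    define q where "q = \<kappa> / (\<kappa> - 1) * C1"
    have "ereal (q * m0) < \<rho>" using fin(2) by (simp add: m0(1) q_def)
    then obtain r0 where r0: "\<rho> = ereal r0" "q * m0 < r0" using fin(3) by (cases \<rho>) auto
    show ?thesis
    proof (cases "Hpm = {0}")
      case True
      have "norm (A z - P0 (A z)) = 0" for z
      proof -
        have "p0 (A z - p0 (A z)) = 0" by (simp add: blinfun.diff_right)
        then have "A z - p0 (A z) \<in> {0}" by (simp only: p0_Hpm True)
        then show ?thesis by (simp add: p0_P0)
      qed
      moreover have "C1 = 0"
      proof -
        have "inv_into {0} (blinfun_apply Binf) 0 = 0"
          using inv_into_into[of 0 "blinfun_apply Binf" "{0}"] by simp
        then show ?thesis by (simp add: C1_def onorm_on_def True)
      qed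
      then have "r0 > 0" using r0(2) by (simp add: q_def)
      ultimately show ?thesis by - (rule exI[of _ 0], rule exI[of _ r0], rule exI[of _ "\<lambda>_. 0"], simp add: r0(1))
    next
      case False
      have q: "q > 0" using \<kappa> C1_pos[OF False] by (simp add: q_def)
      have "0 \<le> q * m0" using q m0(2) by simp
      moreover obtain r' where "q * m0 < r'" "r' < r0" using dense[OF r0(2)] by blast
      ultimately have r': "q * m0 < r'" "r' < r0" "0 \<le> r'" by (simp_all add: le_less_trans less_imp_le)
      have "m0 < r' / q" using r'(1) q by (simp add: pos_less_divide_eq mult.commute)
      then obtain R2 where R2: "\<And>z. z \<in> H0 \<Longrightarrow> norm z \<ge> R2 \<Longrightarrow> norm (A z - orth_proj H0 (A z)) \<le> r' / q"
        using M_inf_bounds(2)[OF H0_sub(1) H0_nontrivial, of A "r' / q"] m0(1) by auto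
      have "a * C1 = 1" using C1_pos[OF False] False by (simp add: a_def)
      moreover have "(1 - \<theta>) * a * q = ((1 - \<theta>) * (\<kappa> / (\<kappa> - 1))) * (a * C1)" by (simp only: q_def ac_simps)
      ultimately have "(1 - \<theta>) * a * q = 1" by (simp only: \<theta>(3) mult_1)
      then have "r' / q = (1 - \<theta>) * a * r'" using q by (simp add: divide_eq_eq ac_simps)
      then show ?thesis using R2 r' r0(1)
        by - (rule exI[of _ R2], rule exI[of _ "r0 - r'"], rule exI[of _ "\<lambda>_. r'"], simp add: P0_def)
    qed
  qed
  then obtain R2 \<eta> rad where \<eta>: "\<eta> > 0" and rad: "\<And>z. z \<in> H0 \<Longrightarrow> norm z \<ge> R2 \<Longrightarrow>
      0 \<le> rad z \<and> ereal (rad z + \<eta>) \<le> \<rho> \<and> norm (A z - P0 (A z)) \<le> (1 - \<theta>) * a * rad z"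
    by blast
  obtain RV where RV: "ball_inf UNIV RV \<subseteq> V" using V_nhd(2) by blast
  define R where "R = max R1 (max RV R2)"
  have R: "R1 \<le> R" "RV \<le> R" "R2 \<le> R" by (auto simp: R_def)
  have A_dir: "((\<lambda>t. (A (x + t *\<^sub>R u) - A x) /\<^sub>R t) \<longlongrightarrow> B x u) (at 0)" if "x \<in> V" for x u
  proof -
    have "DA x u = B x u" using B_eq[OF that] by (metis vector_eq_rdot)
    moreover have "((\<lambda>t. (A (x + t *\<^sub>R u) - A x) /\<^sub>R t) \<longlongrightarrow> DA x u) (at 0)"
      using A_diff that unfolding cont_dir_differentiable_on_def by blast
    ultimately show ?thesis by (simp only:)
  qed
  have far_in_V: "x \<in> V" if "norm x > R" for x using RV R(2) that by (auto simp: ball_inf_def)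
  have orth0: "inner z y = 0" if "p0 z = z" "p0 y = 0" for z y
    using that by (auto simp: p0_H0 p0_Hpm H0_def op_kernel_def inf.K_iff)
  interpret splitting_at_infinity Binf p0 pp pm a V L A B R \<theta> \<eta> \<rho> rad
  proof
    show "continuous_on V A" by (rule C1_gradient_continuous[OF V_nhd(1) L_C1 A_grad])
    show "x \<in> V" if "norm x > R" for x by (rule far_in_V[OF that])
    show "\<bar>inner (B (z + y) u - Binf u) k\<bar> \<le> \<theta> * a * norm u * norm k"
      if z: "p0 z = z" "norm z > R" and y: "p0 y = 0" "ereal (norm y) < \<rho>" and u: "p0 u = 0" and k: "p0 k = 0" for z y u k
    proof (cases "Hpm = {0}")
      case True
      then have "k = 0" using k p0_Hpm by auto
      then show ?thesis by simp
    next
      case False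
      let ?X = "B (z + y) - Binf"
      let ?f = "\<lambda>u. ?X u - P0 (?X u)"
      have "(norm (z + y))\<^sup>2 = (norm z)\<^sup>2 + (norm y)\<^sup>2"
        using norm_add_Pythagorean[of z y] orth0[OF z(1) y(1)] by (simp add: orthogonal_def)
      then have "norm z \<le> norm (z + y)" by (auto intro: power2_le_imp_le[OF _ norm_ge_zero])
      then have zyV: "z + y \<in> V" using z(2) by (intro far_in_V) simp
      have bound: "norm (?f v) \<le> (norm ?X + norm p0 * norm ?X) * norm v" for v
      proof -
        have "norm (?f v) \<le> norm (?X v) + norm (p0 (?X v))" unfolding p0_P0[symmetric] by (rule norm_triangle_ineq4)
        also have "\<dots> \<le> norm ?X * norm v + norm p0 * (norm ?X * norm v)"
          by (intro add_mono norm_blinfun order_trans[OF norm_blinfun] mult_left_mono) auto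
        finally show ?thesis by (simp add: algebra_simps)
      qed
      have "norm (?f u) \<le> onorm_on Hpm ?f * norm u"
        by (rule norm_le_onorm_on[OF bound]) (use u p0_Hpm in simp)
      also have "\<dots> \<le> 1 / (\<kappa> * C1) * norm u"
        using y z zyV R(1) by (intro mult_right_mono d) (auto simp: ball_in_def cball_inf_def p0_Hpm p0_H0)
      also have "1 / (\<kappa> * C1) = \<theta> * a" using False by (simp add: \<theta>_def a_def)
      finally have f: "norm (?f u) \<le> \<theta> * a * norm u" .
      have "inner (P0 (?X u)) k = 0" using orth0[of "p0 (?X u)" k] k by (simp add: p0_P0[symmetric])
      then have "inner (B (z + y) u - Binf u) k = inner (?f u) k" by (simp add: inner_diff_left blinfun.diff_left)
      then have "\<bar>inner (B (z + y) u - Binf u) k\<bar> \<le> norm (?f u) * norm k"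
        using Cauchy_Schwarz_ineq2[of "?f u" k] by simp
      also have "\<dots> \<le> \<theta> * a * norm u * norm k" using f by (rule mult_right_mono) simp
      finally show ?thesis .
    qed
    show "0 \<le> rad z \<and> ereal (rad z + \<eta>) \<le> \<rho> \<and> norm (A z - p0 (A z)) \<le> (1 - \<theta>) * a * rad z"
      if "p0 z = z" "norm z > R" for z
    proof -
      have "z \<in> H0" using that(1) p0_H0 by simp
      then show ?thesis using rad[of z] that(2) R(3) by (simp add: p0_P0)
    qed
  qed (fact \<theta>(1,2) \<eta> V_nhd(1) A_grad A_dir)+
  have Z_eq: "ball_inf H0 R = Z" by (auto simp: ball_inf_def Z_def p0_H0)
  obtain \<delta> W \<Phi> \<Psi> where \<delta>: "\<delta> > 0" and W: "open W" "W \<subseteq> U"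
    and homeo: "homeomorphism {x. p0 x \<in> Z \<and> norm (pp x) < \<delta> \<and> norm (pm x) < \<delta>} W \<Phi> \<Psi>"
    and form: "\<forall>x. p0 x \<in> Z \<longrightarrow> norm (pp x) < \<delta> \<longrightarrow> norm (pm x) < \<delta> \<longrightarrow>
        L (\<Phi> x) = (norm (pp x))\<^sup>2 - (norm (pm x))\<^sup>2 + L (p0 x + h (p0 x))"
    using saddle.parametrized_morse_lemma by blast
  have parts: "p0 (z + u + v) = z" "pp (z + u + v) = u" "pm (z + u + v) = v"
    if "z \<in> H0" "u \<in> Hp" "v \<in> Hm" for z u v
  proof -
    have "p0 z = z" "pp u = u" "pm v = v" using that by (simp_all add: p0_H0 pp_Hp pm_Hm)
    moreover have "p0 (p0 z + pp u + pm v) = p0 z" "pp (p0 z + pp u + pm v) = pp u"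
      "pm (p0 z + pp u + pm v) = pm v" by (simp_all add: blinfun.add_right)
    ultimately show "p0 (z + u + v) = z" "pp (z + u + v) = u" "pm (z + u + v) = v" by simp_all
  qed
  have C_set_iff: "x \<in> C_set H0 Hp Hm R e \<longleftrightarrow> p0 x \<in> Z \<and> ereal (norm (pp x)) < e \<and> ereal (norm (pm x)) < e" for x e
  proof
    assume "x \<in> C_set H0 Hp Hm R e"
    then obtain z u v where "x = z + u + v" "z \<in> H0" "norm z > R" "u \<in> Hp" "ereal (norm u) < e" "v \<in> Hm" "ereal (norm v) < e"
      by (auto simp: C_set_def ball_inf_def ball_in_def)
    then show "p0 x \<in> Z \<and> ereal (norm (pp x)) < e \<and> ereal (norm (pm x)) < e"
      using parts[of z u v] by (simp add: Z_def p0_H0)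
  next
    assume x: "p0 x \<in> Z \<and> ereal (norm (pp x)) < e \<and> ereal (norm (pm x)) < e"
    have "p0 x \<in> H0" "pp x \<in> Hp" "pm x \<in> Hm" by (simp_all flip: p0_H0 pp_Hp pm_Hm)
    then show "x \<in> C_set H0 Hp Hm R e"
      unfolding C_set_def ball_inf_def ball_in_def using x P_sum[of x, symmetric] by (auto simp: Z_def)
  qed
  have C_eq: "C_set H0 Hp Hm R (ereal \<delta>) = {x. p0 x \<in> Z \<and> norm (pp x) < \<delta> \<and> norm (pm x) < \<delta>}"
    by (auto simp: C_set_iff)
  show ?case
  proof (rule exI[of _ R], rule exI[of _ \<delta>], rule exI[of _ h], rule exI[of _ W], rule exI[of _ \<Phi>],
      unfold Z_eq, intro conjI)
    show "R1 \<le> R" by (rule R(1))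
    show "0 < \<delta>" by (rule \<delta>)
    show "continuous_on Z h" by (rule h_cont)
    show "open W" by (rule W(1))
    show "W \<subseteq> V" using W(2) U_slice(4) by blast
    show "\<forall>z\<in>Z. h z \<in> cball_in Hpm \<rho> \<and> z + h z \<in> V \<and> A (z + h z) - P0 (A (z + h z)) = 0"
    proof
      fix z assume z: "z \<in> Z"
      have "h z \<in> cball_in Hpm \<rho>"
        using h(1)[OF z] h_lt[OF z] by (simp add: cball_in_def p0_Hpm)
      moreover have "z + h z \<in> V" by (rule in_V[OF z h(1)[OF z]])
      ultimately show "h z \<in> cball_in Hpm \<rho> \<and> z + h z \<in> V \<and> A (z + h z) - P0 (A (z + h z)) = 0"
        using h(3)[OF z] by (simp add: p0_P0)
    qed
    show "\<forall>g. (\<forall>z\<in>Z. g z \<in> cball_in Hpm \<rho> \<and> z + g z \<in> V \<and> A (z + g z) - P0 (A (z + g z)) = 0) \<longrightarrow>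
        (\<forall>z\<in>Z. g z = h z)"
    proof (intro allI impI ballI)
      fix g z assume g: "\<forall>z\<in>Z. g z \<in> cball_in Hpm \<rho> \<and> z + g z \<in> V \<and> A (z + g z) - P0 (A (z + g z)) = 0"
        and z: "z \<in> Z"
      from g z have "p0 (g z) = 0" "ereal (norm (g z)) \<le> \<rho>" "A (z + g z) - p0 (A (z + g z)) = 0"
        unfolding p0_Hpm cball_in_def p0_P0[of "A (z + g z)"] by auto
      then show "g z = h z" by (rule h_unique[OF z])
    qed
    show "W \<subseteq> closure (C_set H0 Hp Hm R (ereal r + \<rho>))"
    proof
      fix x assume "x \<in> W"
      then have x: "x \<in> U" using W(2) by blast
      let ?k = "x - p0 x"
      have k: "pp ?k = pp x" "pm ?k = pm x" by (simp_all add: blinfun.diff_right)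
      have "(norm ?k)\<^sup>2 = (norm (pp x))\<^sup>2 + (norm (pm x))\<^sup>2"
        using norm_Pythagoras(1)[OF U_slice(2)[OF x]] by (simp only: k)
      then have "norm (pp x) \<le> norm ?k" "norm (pm x) \<le> norm ?k"
        by (auto intro!: power2_le_imp_le[OF _ norm_ge_zero])
      then have "ereal (norm (pp x)) \<le> ereal (norm ?k)" "ereal (norm (pm x)) \<le> ereal (norm ?k)" by simp_all
      moreover have "\<rho> \<le> ereal r + \<rho>" using r by (cases \<rho>) auto
      then have "ereal (norm ?k) < ereal r + \<rho>" by (rule less_le_trans[OF U_slice(3)[OF x]])
      ultimately have "x \<in> C_set H0 Hp Hm R (ereal r + \<rho>)"
        unfolding C_set_iff using U_slice(1)[OF x] by (blast intro: le_less_trans)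
      then show "x \<in> closure (C_set H0 Hp Hm R (ereal r + \<rho>))" by (rule subsetD[OF closure_subset])
    qed
    show "\<exists>\<Psi>. homeomorphism (C_set H0 Hp Hm R (ereal \<delta>)) W \<Phi> \<Psi>" unfolding C_eq by (rule exI[of _ \<Psi>], rule homeo)
    show "\<forall>z\<in>Z. \<forall>u\<in>ball_in Hp (ereal \<delta>). \<forall>v\<in>ball_in Hm (ereal \<delta>).
        L (\<Phi> (z + u + v)) = (norm u)\<^sup>2 - (norm v)\<^sup>2 + L (z + h z)"
    proof (intro ballI)
      fix z u v assume z: "z \<in> Z" and uv: "u \<in> ball_in Hp (ereal \<delta>)" "v \<in> ball_in Hm (ereal \<delta>)"
      then have "z \<in> H0" "u \<in> Hp" "v \<in> Hm" "norm u < \<delta>" "norm v < \<delta>"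
        by (auto simp: Z_def p0_H0 ball_in_def)
      then show "L (\<Phi> (z + u + v)) = (norm u)\<^sup>2 - (norm v)\<^sup>2 + L (z + h z)"
        using form[rule_format, of "z + u + v"] parts[of z u v] z by simp
    qed
    show "C2_on V L \<longrightarrow> C1_on Z h \<and> C2_on Z (\<lambda>z. L (z + h z))"
    proof
      assume "C2_on V L"
      note C2 = C2_gradient_differentiable[OF V_nhd(1) this A_grad A_dir]
      show "C1_on Z h \<and> C2_on Z (\<lambda>z. L (z + h z))" using reduction_smooth[OF C2] by blast
    qed
  qed
qed

end
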